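(* Let $X, Y$ be complex Banach spaces with $\dim X \geq 3$, and let $\mathcal{A} \subset B(X)$ and $\mathcal{B} \subset B(Y)$ be standard operator algebras. Suppose that $\phi : \mathcal{A} \to \mathcal{B}$ is a bijective map (not assumed to be additive, linear or continuous) satisfying \[ \phi(ABA) = \phi(A)\phi(B)\phi(A) \qquad \text{for all } A, B \in \mathcal{A}. \] If $X$ is infinite dimensional, then at least one of the following holds: (i) there exist an invertible bounded linear operator $T : X \to Y$ and $c \in \{-1, 1\}$ such that $\phi(A) = cTAT^{-1}$ for all $A \in \mathcal{A}$; (ii) there exist an invertible bounded conjugate-linear operator $T : X \to Y$ and $c \in \{-1, 1\}$ such that $\phi(A) = cTAT^{-1}$ for all $A \in \mathcal{A}$; (iii) there exist an invertible bounded linear operator $T : X^* \to Y$ and $c \in \{-1, 1\}$ such that $\phi(A) = cTA^*T^{-1}$ for all $A \in \mathcal{A}$; (iv) there exist an invertible bounded conjugate-linear operator $T : X^* \to Y$ and $c \in \{-1, 1\}$ such that $\phi(A) = cTA^*T^{-1}$ for all $A \in \mathcal{A}$. If $X$ is finite dimensional, then $\dim X = \dim Y$. Write $n$ for this common dimension, and identify $\mathcal{A} = B(X)$ and $\mathcal{B} = B(Y)$ with the matrix algebra $M_n(\mathbb{C})$ by choosing bases of $X$ and $Y$, so that $\phi$ is regarded as a bijective map $\phi : M_n(\mathbb{C}) \to M_n(\mathbb{C})$. Then at least one of the following holds: (v) there exist a ring automorphism $h$ of $\mathbb{C}$, an invertible matrix $T \in M_n(\mathbb{C})$ and $c \in \{-1,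 1\}$ such that $\phi(A) = cT\,h(A)\,T^{-1}$ for all $A \in M_n(\mathbb{C})$; (vi) there exist a ring automorphism $h$ of $\mathbb{C}$, an invertible matrix $T \in M_n(\mathbb{C})$ and $c \in \{-1, 1\}$ such that $\phi(A) = cT\,h(A)^{t}\,T^{-1}$ for all $A \in M_n(\mathbb{C})$. Here $h(A)$ denotes the matrix obtained from $A$ by applying $h$ to each of its entries.
   Context: All linear spaces are over the complex field $\mathbb{C}$. For a Banach space $X$, $B(X)$ denotes the algebra of all bounded linear operators on $X$ and $F(X)$ denotes the ideal of all finite rank operators in $B(X)$. A standard operator algebra on $X$ is a subalgebra of $B(X)$ which contains $F(X)$ (it is not required to be closed or to contain the identity). $X^*$ is the dual space of $X$, and for $A \in B(X)$, $A^*$ denotes the Banach space adjoint of $A$, acting on $X^*$. $M_n(\mathbb{C})$ is the algebra of all $n \times n$ complex matrices, and ${}^t$ denotes the transpose. A ring automorphism of $\mathbb{C}$ is a bijective additive and multiplicative map $\mathbb{C} \to \mathbb{C}$, not assumed to be continuous. *)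

theory Defs
  imports "HOL-Analysis.Analysis" "Jordan_Normal_Form.Matrix"
begin

section \<open>Complex Banach spaces\<close>

text \<open>The library only has real normed spaces. A complex normed space is a real one with a
  compatible complex scalar multiplication, for which the norm is absolutely homogeneous.\<close>

class complex_vector = real_vector +
  fixes scaleC :: "complex \<Rightarrow> 'a \<Rightarrow> 'a" (infixr "*\<^sub>C" 75)
  assumes scaleC_add_right: "a *\<^sub>C (x + y) = a *\<^sub>C x + a *\<^sub>C y"
    and scaleC_add_left: "(a + b) *\<^sub>C x = a *\<^sub>C x + b *\<^sub>C x"
    and scaleC_scaleC: "a *\<^sub>C b *\<^sub>C x = (a * b) *\<^sub>C x"
    and scaleC_one: "1 *\<^sub>C x = x"
    and scaleR_scaleC: "r *\<^sub>R x = complex_of_real r *\<^sub>C x"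

class complex_normed_vector = complex_vector + real_normed_vector +
  assumes norm_scaleC: "norm (a *\<^sub>C x) = cmod a * norm x"

class cbanach = complex_normed_vector + banach

global_interpretation complex_vector:
  vector_space "scaleC :: complex \<Rightarrow> 'a \<Rightarrow> 'a::complex_vector"
  defines cdependent = complex_vector.dependent
    and crepresentation = complex_vector.representation
    and csubspace = complex_vector.subspace
    and cspan = complex_vector.span
    and cextend_basis = complex_vector.extend_basis
    and cdim = complex_vector.dim
  by unfold_locales
    (simp_all add: scaleC_add_right scaleC_add_left scaleC_scaleC scaleC_one)

abbreviation cindependent :: "'a::complex_vector set \<Rightarrow> bool"
  where "cindependent B \<equiv> \<not> cdependent B"

definition cfinite_dim :: "'a::complex_vector set \<Rightarrow> bool"
  where "cfinite_dim V \<longleftrightarrow> (\<exists>B. finite B \<and> cspan B = V)"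

text \<open>A basis is a list of vectors, since matrices need the basis vectors to be numbered.\<close>

definition is_cbasis :: "'a::complex_vector list \<Rightarrow> bool"
  where "is_cbasis es \<longleftrightarrow> distinct es \<and> cindependent (set es) \<and> cspan (set es) = UNIV"

instantiation complex :: complex_normed_vector
begin

definition scaleC_complex :: "complex \<Rightarrow> complex \<Rightarrow> complex"
  where "scaleC_complex a x = a * x"

instance
  by standard (simp_all add: scaleC_complex_def algebra_simps norm_mult scaleR_conv_of_real)

end


section \<open>Bounded operators\<close>

definition bounded_clinear :: "('a::complex_normed_vector \<Rightarrow> 'b::complex_normed_vector) \<Rightarrow> bool"
  where "bounded_clinear f \<longleftrightarrow> bounded_linear f \<and> (\<forall>a x. f (a *\<^sub>C x) = a *\<^sub>C f x)"

definition bounded_antilinear :: "('a::complex_normed_vector \<Rightarrow> 'b::complex_normed_vector) \<Rightarrow> bool"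
  where "bounded_antilinear f \<longleftrightarrow> bounded_linear f \<and> (\<forall>a x. f (a *\<^sub>C x) = cnj a *\<^sub>C f x)"

definition invertible_bounded_clinear ::
    "('a::complex_normed_vector \<Rightarrow> 'b::complex_normed_vector) \<Rightarrow> bool"
  where "invertible_bounded_clinear f \<longleftrightarrow>
    bounded_clinear f \<and> bij f \<and> bounded_clinear (inv_into UNIV f)"

definition invertible_bounded_antilinear ::
    "('a::complex_normed_vector \<Rightarrow> 'b::complex_normed_vector) \<Rightarrow> bool"
  where "invertible_bounded_antilinear f \<longleftrightarrow>
    bounded_antilinear f \<and> bij f \<and> bounded_antilinear (inv_into UNIV f)"

typedef (overloaded) ('a, 'b) cblinfun ("(_ \<Rightarrow>\<^sub>C\<^sub>L /_)" [22, 21] 21) =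
  "{f :: 'a::complex_normed_vector \<Rightarrow> 'b::complex_normed_vector. bounded_clinear f}"
  morphisms cblinfun_apply CBlinfun
  by (rule exI[of _ "\<lambda>_. 0"])
    (simp add: bounded_clinear_def bounded_linear_zero complex_vector.scale_zero_right)

declare [[coercion "cblinfun_apply :: ('a::complex_normed_vector \<Rightarrow>\<^sub>C\<^sub>L 'b::complex_normed_vector) \<Rightarrow> 'a \<Rightarrow> 'b"]]

setup_lifting type_definition_cblinfun

lemma onorm_scaleC:
  assumes "bounded_linear (f :: 'a::real_normed_vector \<Rightarrow> 'b::complex_normed_vector)"
  shows "onorm (\<lambda>x. a *\<^sub>C f x) = cmod a * onorm f"
proof -
  have "onorm (\<lambda>x. a *\<^sub>C f x) = onorm (\<lambda>x. cmod a *\<^sub>R f x)"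
    by (simp add: onorm_def norm_scaleC)
  then show ?thesis
    using onorm_scaleR[OF assms, of "cmod a"] by simp
qed

lemma bounded_linear_scaleC_right: "bounded_linear (\<lambda>x::'a::complex_normed_vector. a *\<^sub>C x)"
  by (rule bounded_linear_intro[where K = "cmod a"])
    (simp_all add: scaleC_add_right scaleR_scaleC scaleC_scaleC norm_scaleC mult.commute)

instantiation cblinfun :: (complex_normed_vector, complex_normed_vector) complex_normed_vector
begin

lift_definition norm_cblinfun :: "'a \<Rightarrow>\<^sub>C\<^sub>L 'b \<Rightarrow> real" is onorm .

lift_definition minus_cblinfun :: "'a \<Rightarrow>\<^sub>C\<^sub>L 'b \<Rightarrow> 'a \<Rightarrow>\<^sub>C\<^sub>L 'b \<Rightarrow> 'a \<Rightarrow>\<^sub>C\<^sub>L 'b"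
  is "\<lambda>f g x. f x - g x"
  by (simp add: bounded_clinear_def bounded_linear_sub complex_vector.scale_right_diff_distrib)

lift_definition uminus_cblinfun :: "'a \<Rightarrow>\<^sub>C\<^sub>L 'b \<Rightarrow> 'a \<Rightarrow>\<^sub>C\<^sub>L 'b" is "\<lambda>f x. - f x"
  by (simp add: bounded_clinear_def bounded_linear_minus complex_vector.scale_minus_right)

lift_definition zero_cblinfun :: "'a \<Rightarrow>\<^sub>C\<^sub>L 'b" is "\<lambda>x. 0"
  by (simp add: bounded_clinear_def bounded_linear_zero complex_vector.scale_zero_right)

lift_definition plus_cblinfun :: "'a \<Rightarrow>\<^sub>C\<^sub>L 'b \<Rightarrow> 'a \<Rightarrow>\<^sub>C\<^sub>L 'b \<Rightarrow> 'a \<Rightarrow>\<^sub>C\<^sub>L 'b"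
  is "\<lambda>f g x. f x + g x"
  by (simp add: bounded_clinear_def bounded_linear_add scaleC_add_right)

lift_definition scaleC_cblinfun :: "complex \<Rightarrow> 'a \<Rightarrow>\<^sub>C\<^sub>L 'b \<Rightarrow> 'a \<Rightarrow>\<^sub>C\<^sub>L 'b" is "\<lambda>a f x. a *\<^sub>C f x"
  by (auto simp: bounded_clinear_def scaleC_scaleC mult.commute
      intro: bounded_linear_compose[OF bounded_linear_scaleC_right])

definition scaleR_cblinfun :: "real \<Rightarrow> 'a \<Rightarrow>\<^sub>C\<^sub>L 'b \<Rightarrow> 'a \<Rightarrow>\<^sub>C\<^sub>L 'b"
  where "scaleR_cblinfun r f = complex_of_real r *\<^sub>C f"

definition dist_cblinfun :: "'a \<Rightarrow>\<^sub>C\<^sub>L 'b \<Rightarrow> 'a \<Rightarrow>\<^sub>C\<^sub>L 'b \<Rightarrow> real"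
  where "dist_cblinfun f g = norm (f - g)"

definition uniformity_cblinfun :: "(('a \<Rightarrow>\<^sub>C\<^sub>L 'b) \<times> ('a \<Rightarrow>\<^sub>C\<^sub>L 'b)) filter"
  where "uniformity_cblinfun = (INF e\<in>{0 <..}. principal {(x, y). dist x y < e})"

definition open_cblinfun :: "('a \<Rightarrow>\<^sub>C\<^sub>L 'b) set \<Rightarrow> bool"
  where "open_cblinfun S = (\<forall>x\<in>S. \<forall>\<^sub>F (x', y) in uniformity. x' = x \<longrightarrow> y \<in> S)"

definition sgn_cblinfun :: "'a \<Rightarrow>\<^sub>C\<^sub>L 'b \<Rightarrow> 'a \<Rightarrow>\<^sub>C\<^sub>L 'b"
  where "sgn_cblinfun f = scaleR (inverse (norm f)) f"

instance
  apply standard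
  unfolding dist_cblinfun_def open_cblinfun_def sgn_cblinfun_def uniformity_cblinfun_def
    scaleR_cblinfun_def
  apply (rule refl | (transfer, force simp: bounded_clinear_def onorm_triangle onorm_scaleC
      onorm_eq_0 scaleC_add_right scaleC_add_left scaleC_scaleC scaleC_one algebra_simps))+
  done

end

lift_definition cblinfun_compose ::
    "'b::complex_normed_vector \<Rightarrow>\<^sub>C\<^sub>L 'c::complex_normed_vector
      \<Rightarrow> 'a::complex_normed_vector \<Rightarrow>\<^sub>C\<^sub>L 'b \<Rightarrow> 'a \<Rightarrow>\<^sub>C\<^sub>L 'c" (infixl "o\<^sub>C\<^sub>L" 67)
  is "(\<circ>)"
  by (auto simp: bounded_clinear_def o_def intro: bounded_linear_compose)

type_synonym 'a cdual = "'a \<Rightarrow>\<^sub>C\<^sub>L complex"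

lift_definition cadjoint ::
    "'a::complex_normed_vector \<Rightarrow>\<^sub>C\<^sub>L 'b::complex_normed_vector \<Rightarrow> 'b cdual \<Rightarrow>\<^sub>C\<^sub>L 'a cdual"
  is "\<lambda>A f. f o\<^sub>C\<^sub>L A"
  subgoal premises prems for A
    unfolding bounded_clinear_def
  proof (intro conjI allI bounded_linear_intro[where K = "norm A"])
    show "norm (f o\<^sub>C\<^sub>L A) \<le> norm f * norm A" for f :: "'b cdual"
      by transfer (simp add: bounded_clinear_def onorm_compose)
  qed (unfold scaleR_scaleC, (transfer, force)+)
  done

definition finite_rank :: "('a::complex_normed_vector \<Rightarrow>\<^sub>C\<^sub>L 'b::complex_normed_vector) \<Rightarrow> bool"
  where "finite_rank A \<longleftrightarrow> cfinite_dim (range A)"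

definition standard_operator_algebra :: "('a::complex_normed_vector \<Rightarrow>\<^sub>C\<^sub>L 'a) set \<Rightarrow> bool"
  where "standard_operator_algebra \<A> \<longleftrightarrow>
    csubspace \<A> \<and> (\<forall>A\<in>\<A>. \<forall>B\<in>\<A>. A o\<^sub>C\<^sub>L B \<in> \<A>) \<and> {A. finite_rank A} \<subseteq> \<A>"


section \<open>Matrices\<close>

definition matrix_of :: "'a::complex_normed_vector list \<Rightarrow> ('a \<Rightarrow>\<^sub>C\<^sub>L 'a) \<Rightarrow> complex mat"
  where "matrix_of es A = mat (length es) (length es)
    (\<lambda>(i, j). crepresentation (set es) (A (es ! j)) (es ! i))"

text \<open>The map on matrices that corresponds to a map \<open>\<phi>\<close> on operators. If \<open>es\<close> is a basis,
  \<^term>\<open>matrix_of es\<close> is a bijection from all operators onto the \<open>n \<times> n\<close> matrices.\<close>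

definition matrix_map ::
    "'a::complex_normed_vector list \<Rightarrow> 'b::complex_normed_vector list
      \<Rightarrow> (('a \<Rightarrow>\<^sub>C\<^sub>L 'a) \<Rightarrow> ('b \<Rightarrow>\<^sub>C\<^sub>L 'b)) \<Rightarrow> complex mat \<Rightarrow> complex mat"
  where "matrix_map es fs \<phi> M = matrix_of fs (\<phi> (inv_into UNIV (matrix_of es) M))"

definition ring_automorphism :: "(complex \<Rightarrow> complex) \<Rightarrow> bool"
  where "ring_automorphism h \<longleftrightarrow>
    bij h \<and> (\<forall>x y. h (x + y) = h x + h y) \<and> (\<forall>x y. h (x * y) = h x * h y)"

end

theory Submission
  imports Defs
begin

text \<open>
  The proof rests on operators of rank one. They can be characterized by means of the triple
  product \<open>ABA\<close> (\<open>is_rank1_iff_triple\<close>), so \<open>\<phi>\<close> maps them bijectively onto those of the target. For \<open>R\<close> of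
  rank one, \<open>RAR = tr(RA) R\<close>, and applying \<open>\<phi>\<close> to this equation shows that
  \<open>tr(\<phi>(R) \<phi>(A)) = h(tr(RA))\<close> for a bijection \<open>h\<close> of the complex numbers, which is multiplicative and
  does not depend on \<open>R\<close> (\<open>scaling_function\<close>).

  The main point is that \<open>h\<close> is additive. By the identity above, \<open>\<phi>\<close> preserves orthogonality of
  rank-one operators, and orthogonality detects when a rank-one operator is a combination of two others
  (\<open>rank1_combination\<close>). Applied to \<open>x \<otimes> f\<close>, \<open>y \<otimes> f\<close> and \<open>(x + y) \<otimes> f\<close> this gives
  additivity of \<open>h\<close>, and because operators are separated by the pairing with rank-one operators,
  \<open>\<phi>\<close> is additive and \<open>h\<close>-homogeneous (\<open>phi_semilinear\<close>). Here \<open>x \<otimes> f\<close> denotes the operator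
  \<open>z \<mapsto> f(z) x\<close>.

  Now the triple product can be polarized. A projection \<open>x0 \<otimes> f0\<close> goes, up to a sign, to a projection
  \<open>u0 \<otimes> g0\<close>, and the Peirce decomposition with respect to it shows that either \<open>\<phi>(x \<otimes> f) = \<plusminus> T x \<otimes> S f\<close> or
  \<open>\<phi>(x \<otimes> f) = \<plusminus> T f \<otimes> S x\<close>, with \<open>h\<close>-semilinear bijections \<open>T\<close> and \<open>S\<close> that transform the duality
  bracket by \<open>h\<close> (\<open>two_forms\<close>). The pairing then determines \<open>\<phi>(A)\<close> on the range of \<open>T\<close>.

  In infinite dimension the bracket identity forces \<open>h\<close> to be bounded near zero
  (\<open>bounded_near_zero\<close>), hence to be the identity or complex conjugation, and the uniform boundedness
  principle makes \<open>T\<close> and its inverse bounded. In finite dimension \<open>T\<close> carries a basis or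
  its dual basis to a basis of the target, in which the matrix of \<open>\<phi>(A)\<close> can be read off; a
  change of basis gives the matrix form.
\<close>

section \<open>Hahn-Banach, uniform boundedness and the dual space\<close>

definition sublinear :: "('a::real_vector \<Rightarrow> real) \<Rightarrow> bool"
  where "sublinear p \<longleftrightarrow>
    (\<forall>x y. p (x + y) \<le> p x + p y) \<and> (\<forall>r\<ge>0. \<forall>x. p (r *\<^sub>R x) = r * p x)"

lemma sublinearI:
  assumes add: "\<And>x y. p (x + y) \<le> p x + p y" and zero: "p 0 = 0"
    and scale: "\<And>r x. r > 0 \<Longrightarrow> p (r *\<^sub>R x) \<le> r * p x"
  shows "sublinear p"
  unfolding sublinear_def
proof (intro conjI allI impI add)
  fix r :: real and x assume "r \<ge> 0"
  show "p (r *\<^sub>R x) = r * p x"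
  proof (cases "r = 0")
    case False
    then have r: "r > 0" using \<open>r \<ge> 0\<close> by simp
    have "p x \<le> inverse r * p (r *\<^sub>R x)"
      using scale[of "inverse r" "r *\<^sub>R x"] r by simp
    then have "r * p x \<le> p (r *\<^sub>R x)" using r by (simp add: field_simps)
    with scale[OF r, of x] show ?thesis by simp
  qed (simp add: zero)
qed

lemma sublinearD:
  assumes "sublinear p"
  shows "p (x + y) \<le> p x + p y" "r \<ge> 0 \<Longrightarrow> p (r *\<^sub>R x) = r * p x" "p 0 = 0" "- p (- x) \<le> p x"
proof -
  show *: "p (x + y) \<le> p x + p y" "r \<ge> 0 \<Longrightarrow> p (r *\<^sub>R x) = r * p x" for x y r
    using assms by (auto simp: sublinear_def)
  show "p 0 = 0" using *(2)[of 0 0] by simp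
  then show "- p (- x) \<le> p x" using *(1)[of x "- x"] by simp
qed

text \<open>The tilted functional lies below \<open>q\<close> and takes the value \<open>-q z\<close> or less at \<open>-z\<close>. So a sublinear
functional with nothing strictly below it is additive: it agrees with all its tilts. This gives
the Hahn-Banach theorem without extending functionals from subspaces.\<close>

definition tilt :: "('a::real_vector \<Rightarrow> real) \<Rightarrow> 'a \<Rightarrow> 'a \<Rightarrow> real"
  where "tilt q z x = (INF t\<in>{0..}. q (x + t *\<^sub>R z) - t * q z)"

lemma tilt_lower:
  assumes "sublinear q" "t \<ge> 0"
  shows "- q (- x) \<le> q (x + t *\<^sub>R z) - t * q z"
  using sublinearD(1)[OF assms(1), of "x + t *\<^sub>R z" "- x"] sublinearD(2)[OF assms, of z] by simp

lemma tilt_le: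
  assumes "sublinear q" "t \<ge> 0"
  shows "tilt q z x \<le> q (x + t *\<^sub>R z) - t * q z"
  unfolding tilt_def using assms(2) tilt_lower[OF assms(1)]
  by (intro cINF_lower bdd_belowI[where m = "- q (- x)"]) auto

lemma tilt_greatest:
  assumes "\<And>t. t \<ge> 0 \<Longrightarrow> m \<le> q (x + t *\<^sub>R z) - t * q z"
  shows "m \<le> tilt q z x"
  unfolding tilt_def using assms by (intro cINF_greatest) auto

lemma sublinear_tilt:
  assumes q: "sublinear q"
  shows "sublinear (tilt q z)"
proof (rule sublinearI)
  show "tilt q z 0 = 0"
  proof (rule antisym)
    show "tilt q z 0 \<le> 0" using tilt_le[OF q, of 0 z 0] sublinearD(3)[OF q] by simp
    show "0 \<le> tilt q z 0" by (rule tilt_greatest) (simp add: sublinearD(2)[OF q])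
  qed
next
  fix x y
  have "tilt q z (x + y) - (q (x + s *\<^sub>R z) - s * q z) \<le> q (y + t *\<^sub>R z) - t * q z"
    if "s \<ge> 0" "t \<ge> 0" for s t
  proof -
    have "tilt q z (x + y) \<le> q (x + y + (s + t) *\<^sub>R z) - (s + t) * q z"
      using that by (intro tilt_le q) simp
    also have "\<dots> \<le> q (x + s *\<^sub>R z) + q (y + t *\<^sub>R z) - (s + t) * q z"
      using sublinearD(1)[OF q, of "x + s *\<^sub>R z" "y + t *\<^sub>R z"] by (simp add: algebra_simps)
    finally show ?thesis by (simp add: algebra_simps)
  qed
  then have "tilt q z (x + y) - (q (x + s *\<^sub>R z) - s * q z) \<le> tilt q z y" if "s \<ge> 0" for s
    using that by (intro tilt_greatest) auto
  then have "tilt q z (x + y) - tilt q z y \<le> tilt q z x"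
    by (intro tilt_greatest) (force simp: algebra_simps)
  then show "tilt q z (x + y) \<le> tilt q z x + tilt q z y" by simp
next
  fix r :: real and x assume r: "r > 0"
  have "tilt q z (r *\<^sub>R x) / r \<le> q (x + t *\<^sub>R z) - t * q z" if "t \<ge> 0" for t
  proof -
    have "tilt q z (r *\<^sub>R x) \<le> q (r *\<^sub>R x + (r * t) *\<^sub>R z) - r * t * q z"
      using that r by (intro tilt_le q) simp
    also have "r *\<^sub>R x + (r * t) *\<^sub>R z = r *\<^sub>R (x + t *\<^sub>R z)" by (simp add: algebra_simps)
    also have "q \<dots> = r * q (x + t *\<^sub>R z)" using r by (intro sublinearD(2)[OF q]) simp
    finally show ?thesis using r by (simp add: field_simps)
  qed
  then have "tilt q z (r *\<^sub>R x) / r \<le> tilt q z x" by (rule tilt_greatest)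
  then show "tilt q z (r *\<^sub>R x) \<le> r * tilt q z x" using r by (simp add: field_simps)
qed

text \<open>Zorn's lemma applies because the pointwise infimum of a chain of sublinear functionals below \<open>p\<close> is
again sublinear; it is finite because each member is bounded below by \<open>- p (- x)\<close>.\<close>

lemma minimal_sublinear:
  assumes p: "sublinear p"
  obtains m where "sublinear m" "m \<le> p" "\<And>q. sublinear q \<Longrightarrow> q \<le> m \<Longrightarrow> q = m"
proof -
  let ?A = "{q. sublinear q \<and> q \<le> p}" and ?P = "\<lambda>a b :: 'a \<Rightarrow> real. b \<le> a"
  have "\<exists>m\<in>?A. \<forall>a\<in>?A. ?P m a \<longrightarrow> a = m"
  proof (rule predicate_Zorn)
    show "partial_order_on ?A (relation_of ?P ?A)"
      by (rule partial_order_on_relation_ofI) auto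
  next
    fix C assume C: "C \<in> Chains (relation_of ?P ?A)"
    then have CA: "C \<subseteq> ?A" by (auto simp: Chains_def relation_of_def)
    have tot: "a \<le> b \<or> b \<le> a" if "a \<in> C" "b \<in> C" for a b
      using C that by (auto simp: Chains_def relation_of_def)
    show "\<exists>u\<in>?A. \<forall>a\<in>C. ?P a u"
    proof (cases "C = {}")
      case True
      then show ?thesis using p by auto
    next
      case False
      define u where "u x = (INF q\<in>C. q x)" for x
      have low: "- p (- x) \<le> q x" if "q \<in> C" for q x
        using sublinearD(4)[of q x] CA that by (force simp: le_fun_def intro: order_trans[rotated])
      have u_le: "u x \<le> q x" if "q \<in> C" for q x
        unfolding u_def using that low by (intro cINF_lower bdd_belowI[where m = "- p (- x)"]) auto
      have u_gr: "m \<le> u x" if "\<And>q. q \<in> C \<Longrightarrow> m \<le> q x" for m x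
        unfolding u_def using that False by (intro cINF_greatest) auto
      have "sublinear u"
      proof (rule sublinearI)
        have "q 0 = 0" if "q \<in> C" for q using CA that sublinearD(3) by auto
        then have "(\<lambda>q. q 0) ` C = {0}" using False by force
        then show "u 0 = 0" unfolding u_def by simp
      next
        fix x y
        have "u (x + y) - a x \<le> b y" if ab: "a \<in> C" "b \<in> C" for a b
        proof -
          obtain c where c: "c \<in> C" "c \<le> a" "c \<le> b" using tot[OF ab] ab by auto
          have "u (x + y) \<le> c x + c y"
            using u_le[OF c(1), of "x + y"] sublinearD(1)[of c x y] CA c(1) by force
          then show ?thesis using c(2,3) by (smt (verit) le_fun_def)
        qed
        then have "u (x + y) - a x \<le> u y" if "a \<in> C" for a using that by (intro u_gr) auto
        then have "u (x + y) - u y \<le> u x" by (intro u_gr) (force simp: algebra_simps)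
        then show "u (x + y) \<le> u x + u y" by simp
      next
        fix r :: real and x assume r: "r > 0"
        have "u (r *\<^sub>R x) / r \<le> q x" if "q \<in> C" for q
          using u_le[OF that, of "r *\<^sub>R x"] sublinearD(2)[of q r x] CA that r
          by (force simp: field_simps)
        then have "u (r *\<^sub>R x) / r \<le> u x" by (rule u_gr)
        then show "u (r *\<^sub>R x) \<le> r * u x" using r by (simp add: field_simps)
      qed
      moreover have "u \<le> p"
      proof -
        obtain q where q: "q \<in> C" using False by auto
        then have "q \<le> p" using CA by auto
        then show ?thesis using u_le[OF q] by (auto simp: le_fun_def intro: order_trans)
      qed
      ultimately show ?thesis using u_le by (auto simp: le_fun_def)
    qed
  qed
  then show ?thesis using that by (auto intro: order_trans)
qed

lemma sublinear_dominates_linear: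
  assumes p: "sublinear p"
  obtains u where "linear u" "\<And>x. u x \<le> p x"
proof -
  obtain m where m: "sublinear m" "m \<le> p" and min: "\<And>q. sublinear q \<Longrightarrow> q \<le> m \<Longrightarrow> q = m"
    using minimal_sublinear[OF p] by metis
  have "tilt m z = m" for z
    using tilt_le[OF m(1), of 0 z] by (intro min sublinear_tilt m) (auto simp: le_fun_def)
  then have "m x \<le> m (x + z) - m z" for x z
    using tilt_le[OF m(1), of 1 z x] by simp
  then have add: "m (x + y) = m x + m y" for x y
    using sublinearD(1)[OF m(1), of x y] by (smt (verit))
  have neg: "m (- x) = - m x" for x
    using add[of x "- x"] sublinearD(3)[OF m(1)] by simp
  have "m (r *\<^sub>R x) = r *\<^sub>R m x" for r x
    using sublinearD(2)[OF m(1), of r x] sublinearD(2)[OF m(1), of "- r" "- x"] neg[of x]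
    by (cases "r \<ge> 0") auto
  then have "linear m" by (intro linearI add)
  then show ?thesis using that m(2) by (auto simp: le_fun_def)
qed

text \<open>Starting from the norm tilted in the direction \<open>x0\<close>, instead of the norm itself, forces the value at
\<open>x0\<close>.\<close>

lemma norming_real_functional:
  fixes x0 :: "'a::real_normed_vector"
  obtains u where "linear u" "\<And>x. \<bar>u x\<bar> \<le> norm x" "u x0 = norm x0"
proof -
  have n: "sublinear (norm :: 'a \<Rightarrow> real)"
    by (auto simp: sublinear_def norm_triangle_ineq)
  obtain u where u: "linear u" "\<And>x. u x \<le> tilt norm x0 x"
    using sublinear_dominates_linear[OF sublinear_tilt[OF n, of x0]] by metis
  have le: "u x \<le> norm x" for x
    using u(2)[of x] tilt_le[OF n, of 0 x0 x] by simp
  have "u (- x0) \<le> - norm x0"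
    using u(2)[of "- x0"] tilt_le[OF n, of 1 x0 "- x0"] by simp
  then have "u x0 = norm x0" using le[of x0] linear_neg[OF u(1), of x0] by simp
  moreover have "\<bar>u x\<bar> \<le> norm x" for x
    using le[of x] le[of "- x"] linear_neg[OF u(1), of x] by simp
  ultimately show ?thesis using that u(1) by blast
qed

lemma bounded_clinear_cblinfun: "bounded_clinear (cblinfun_apply A)"
  using cblinfun_apply by blast

lemma bounded_linear_cblinfun: "bounded_linear (cblinfun_apply A)"
  using bounded_clinear_cblinfun by (auto simp: bounded_clinear_def)

lemma cblinfun_apply_scaleC [simp]: "cblinfun_apply A (a *\<^sub>C x) = a *\<^sub>C A x"
  using bounded_clinear_cblinfun by (auto simp: bounded_clinear_def)

lemmas cblinfun_arg_simps [simp] =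
  linear_0[OF bounded_linear.linear[OF bounded_linear_cblinfun]]
  linear_add[OF bounded_linear.linear[OF bounded_linear_cblinfun]]
  linear_diff[OF bounded_linear.linear[OF bounded_linear_cblinfun]]
  linear_neg[OF bounded_linear.linear[OF bounded_linear_cblinfun]]
  linear_sum[OF bounded_linear.linear[OF bounded_linear_cblinfun]]

lemmas cblinfun_fun_simps [simp] = plus_cblinfun.rep_eq minus_cblinfun.rep_eq uminus_cblinfun.rep_eq
  zero_cblinfun.rep_eq scaleC_cblinfun.rep_eq

lemma cblinfun_compose_apply [simp]: "(A o\<^sub>C\<^sub>L B) x = A (B x)"
  by transfer simp

lemma cadjoint_apply [simp]: "cadjoint A f = f o\<^sub>C\<^sub>L A"
  by transfer simp

lemma cblinfun_apply_sum [simp]: "cblinfun_apply (sum F I) x = (\<Sum>i\<in>I. F i x)"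
  by (induction I rule: infinite_finite_induct) auto

lemma cblinfun_eqI:
  fixes A B :: "'a::complex_normed_vector \<Rightarrow>\<^sub>C\<^sub>L 'b::complex_normed_vector"
  shows "(\<And>x. A x = B x) \<Longrightarrow> A = B"
  by transfer auto

lemma norm_cblinfun_apply:
  fixes A :: "'a::complex_normed_vector \<Rightarrow>\<^sub>C\<^sub>L 'b::complex_normed_vector"
  shows "norm (A x) \<le> norm A * norm x"
  by transfer (auto simp: bounded_clinear_def onorm)

lemma norm_cblinfun_le:
  fixes A :: "'a::complex_normed_vector \<Rightarrow>\<^sub>C\<^sub>L 'b::complex_normed_vector"
  assumes "M \<ge> 0" "\<And>x. norm (A x) \<le> M * norm x"
  shows "norm A \<le> M"
  using assms by transfer (auto intro: onorm_bound)

lemma bounded_clinearI: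
  fixes F :: "'a::complex_normed_vector \<Rightarrow> 'b::complex_normed_vector"
  assumes "\<And>x y. F (x + y) = F x + F y" "\<And>a x. F (a *\<^sub>C x) = a *\<^sub>C F x"
    "\<And>x. norm (F x) \<le> M * norm x"
  shows "bounded_clinear F"
  unfolding bounded_clinear_def
  using assms by (auto intro!: bounded_linear_intro[where K = M] simp: scaleR_scaleC mult.commute)

lemma CBlinfun_apply:
  "bounded_clinear F \<Longrightarrow> cblinfun_apply (CBlinfun F) = F"
  by (simp add: CBlinfun_inverse)

lemma scaleC_complex [simp]: "a *\<^sub>C (b::complex) = a * b"
  by (simp add: scaleC_complex_def)

text \<open>The complexification \<open>u x - \<i> u (\<i> x)\<close> of a real functional of norm one has norm one as well, but
the cruder bound \<open>2\<close>, which needs no rotation argument, is enough for every application.\<close>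

lemma norming_functional:
  fixes x0 :: "'a::complex_normed_vector"
  obtains f :: "'a cdual" where "norm f \<le> 2" "norm x0 \<le> cmod (f x0)"
proof -
  obtain u :: "'a \<Rightarrow> real" where u: "linear u" "\<And>x. \<bar>u x\<bar> \<le> norm x" "u x0 = norm x0"
    using norming_real_functional[of x0] by blast
  define F where "F x = Complex (u x) (- u (\<i> *\<^sub>C x))" for x
  have scale: "a *\<^sub>C x = Re a *\<^sub>R x + Im a *\<^sub>R \<i> *\<^sub>C x" for a and x :: 'a
  proof -
    have "Re a *\<^sub>R x + Im a *\<^sub>R \<i> *\<^sub>C x = (of_real (Re a) + of_real (Im a) * \<i>) *\<^sub>C x"
      by (simp only: scaleR_scaleC scaleC_scaleC scaleC_add_left)
    also have "of_real (Re a) + of_real (Im a) * \<i> = a" by (simp add: complex_eq_iff)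
    finally show ?thesis by simp
  qed
  have F_scale: "F (a *\<^sub>C x) = a *\<^sub>C F x" for a x
  proof -
    have "u (a *\<^sub>C x) = Re a * u x + Im a * u (\<i> *\<^sub>C x)" for a x
      by (subst scale) (simp add: linear_add[OF u(1)] linear_scale[OF u(1)])
    from this[of a x] this[of "\<i> * a" x] show ?thesis
      by (simp add: F_def scaleC_scaleC complex_eq_iff)
  qed
  have F_le: "norm (F x) \<le> 2 * norm x" for x
    using cmod_le[of "F x"] u(2)[of x] u(2)[of "\<i> *\<^sub>C x"] by (simp add: F_def norm_scaleC)
  have "F (x + y) = F x + F y" for x y
    by (simp add: F_def linear_add[OF u(1)] scaleC_add_right complex_eq_iff)
  then have F: "bounded_clinear F" using F_scale F_le by (rule bounded_clinearI)
  define f where "f = CBlinfun F"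
  have f: "f x = F x" for x by (simp add: f_def CBlinfun_apply[OF F])
  show ?thesis
  proof
    show "norm f \<le> 2" using F_le by (intro norm_cblinfun_le) (simp_all add: f)
    show "norm x0 \<le> cmod (f x0)"
      using abs_Re_le_cmod[of "F x0"] u(3) by (simp add: f F_def)
  qed
qed

lemma separating_functional:
  fixes x :: "'a::complex_normed_vector"
  assumes "x \<noteq> 0"
  obtains f :: "'a cdual" where "f x = 1"
proof -
  obtain f :: "'a cdual" where "norm x \<le> cmod (f x)" by (rule norming_functional)
  then have "f x \<noteq> 0" using assms by auto
  then show ?thesis by (intro that[of "inverse (f x) *\<^sub>C f"]) simp
qed

lemma cdual_nonzero:
  assumes "f \<noteq> 0" obtains x where "cblinfun_apply (f :: 'a::complex_normed_vector cdual) x = 1"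
proof -
  obtain x where "f x \<noteq> 0" using assms cblinfun_eqI[of f 0] by auto
  then show ?thesis by (intro that[of "inverse (f x) *\<^sub>C x"]) simp
qed

text \<open>Sokal's elementary argument. If the norms were unbounded, choose operators of norm at least \<open>4 ^ n\<close>
and move by steps of length at most \<open>(1/3) ^ n\<close>, each making the value of the current operator
large; the later steps are too short to undo this, so the values at the limit are unbounded.\<close>

lemma uniform_boundedness:
  fixes F :: "'i \<Rightarrow> 'a::banach \<Rightarrow> 'b::real_normed_vector"
  assumes lin: "\<And>i. i \<in> I \<Longrightarrow> bounded_linear (F i)"
    and bdd: "\<And>x. \<exists>K. \<forall>i\<in>I. norm (F i x) \<le> K"
  obtains M where "\<And>i x. i \<in> I \<Longrightarrow> norm (F i x) \<le> M * norm x"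
proof (rule ccontr)
  assume neg: "\<not> thesis"
  have "\<exists>i\<in>I. onorm (F i) \<ge> 4 ^ n" for n :: nat
  proof (rule ccontr)
    assume "\<not> ?thesis"
    then have *: "onorm (F i) \<le> 4 ^ n" if "i \<in> I" for i using that by force
    have "norm (F i x) \<le> 4 ^ n * norm x" if "i \<in> I" for i x
      using onorm[OF lin[OF that], of x] *[OF that] mult_right_mono[of _ _ "norm x"]
      by (meson norm_ge_zero order_trans)
    then show False using neg that by blast
  qed
  then obtain i where i: "\<And>n. i n \<in> I" "\<And>n. onorm (F (i n)) \<ge> 4 ^ n" by metis
  define N where "N n = onorm (F (i n))" for n
  have N4: "N n \<ge> 4 ^ n" for n using i by (simp add: N_def)
  then have Npos: "N n > 0" for n by (meson less_le_trans zero_less_numeral zero_less_power)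
  have step: "\<exists>y. norm (y - x) \<le> (1/3) ^ n \<and> norm (F (i n) y) \<ge> 2/3 * (1/3) ^ n * N n" for x n
  proof -
    interpret bounded_linear "F (i n)" using lin i by auto
    have "\<exists>z. norm (F (i n) z) > 2/3 * N n * norm z"
    proof (rule ccontr)
      assume "\<not> ?thesis"
      then have "norm (F (i n) z) \<le> 2/3 * N n * norm z" for z by (force simp: not_less)
      then have "onorm (F (i n)) \<le> 2/3 * N n" using Npos[of n] by (intro onorm_bound) auto
      then show False using Npos[of n] by (simp add: N_def)
    qed
    then obtain z where z: "norm (F (i n) z) > 2/3 * N n * norm z" by blast
    then have z0: "norm z > 0" using zero by auto
    define d where "d = ((1/3) ^ n / norm z) *\<^sub>R z"
    have d: "norm d = (1/3) ^ n" using z0 by (simp add: d_def)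
    have "norm (F (i n) d) \<ge> 2/3 * (1/3) ^ n * N n"
      using z z0 by (simp add: d_def scale field_simps)
    \<comment> \<open>one of the two opposite steps gives a value at least as large as the value at the step\<close>
    moreover have "2 *\<^sub>R F (i n) d = F (i n) (x + d) - F (i n) (x - d)"
      by (simp add: add diff scaleR_2)
    then have "2 * norm (F (i n) d) \<le> norm (F (i n) (x + d)) + norm (F (i n) (x - d))"
      by (metis norm_scaleR norm_triangle_ineq4 abs_numeral)
    ultimately have "norm (F (i n) (x + d)) \<ge> 2/3 * (1/3) ^ n * N n \<or>
        norm (F (i n) (x - d)) \<ge> 2/3 * (1/3) ^ n * N n" by linarith
    then obtain y where y: "y = x + d \<or> y = x - d" "norm (F (i n) y) \<ge> 2/3 * (1/3) ^ n * N n"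
      by blast
    then have "norm (y - x) \<le> (1/3) ^ n" using d by auto
    with y(2) show ?thesis by blast
  qed
  then obtain g where g: "\<And>x n. norm (g x n - x) \<le> (1/3) ^ n"
    "\<And>x n. norm (F (i n) (g x n)) \<ge> 2/3 * (1/3) ^ n * N n" by metis
  define X where "X = rec_nat 0 (\<lambda>n x. g x n)"
  have X: "X (Suc n) = g (X n) n" for n by (simp add: X_def)
  define a where "a n = X (Suc n) - X n" for n
  have a: "norm (a n) \<le> (1/3) ^ n" for n using g(1) by (simp add: a_def X)
  have sm: "summable (\<lambda>n. (1/3::real) ^ n)" by (simp add: summable_geometric)
  have sa: "summable a" by (rule summable_comparison_test'[OF sm]) (use a in auto)
  have sumX: "(\<Sum>k<n. a k) = X n" for n
    by (induction n) (simp_all add: a_def, simp add: X_def)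
  define x where "x = suminf a"
  have dist: "norm (x - X (Suc n)) \<le> 1/2 * (1/3) ^ n" for n
  proof -
    have "x - X (Suc n) = (\<Sum>k. a (k + Suc n))"
      unfolding x_def using suminf_split_initial_segment[OF sa, of "Suc n"] sumX[of "Suc n"]
      by simp
    also have "norm \<dots> \<le> (\<Sum>k. (1/3) ^ (k + Suc n))"
      using a sm by (intro norm_suminf_le) (simp_all only: summable_iff_shift)
    also have "\<dots> = (\<Sum>k. (1/3) ^ k * (1/3) ^ Suc n)" by (simp only: power_add)
    also have "\<dots> = (\<Sum>k. (1/3) ^ k) * (1/3::real) ^ Suc n" by (rule suminf_mult2[OF sm, symmetric])
    also have "\<dots> = 1/2 * (1/3) ^ n" by (simp add: suminf_geometric)
    finally show ?thesis .
  qed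
  obtain K where K: "\<And>i. i \<in> I \<Longrightarrow> norm (F i x) \<le> K" using bdd by metis
  have "(4/3) ^ n \<le> 6 * K" for n :: nat
  proof -
    interpret bounded_linear "F (i n)" using lin i by auto
    have "norm (F (i n) (x - X (Suc n))) \<le> N n * norm (x - X (Suc n))"
      unfolding N_def by (rule onorm[OF lin[OF i(1)]])
    also have "\<dots> \<le> N n * (1/2 * (1/3) ^ n)"
      using dist[of n] Npos[of n] by (intro mult_left_mono) auto
    finally have tail: "norm (F (i n) (x - X (Suc n))) \<le> N n * (1/2 * (1/3) ^ n)" .
    have "norm (F (i n) (X (Suc n))) \<le> norm (F (i n) x) + norm (F (i n) (x - X (Suc n)))"
      using norm_triangle_ineq4[of "F (i n) x" "F (i n) (x - X (Suc n))"] by (simp add: diff)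
    also have "\<dots> \<le> K + N n * (1/2 * (1/3) ^ n)"
      using K[OF i(1)] tail by (intro add_mono) auto
    finally have "2/3 * (1/3) ^ n * N n \<le> K + N n * (1/2 * (1/3) ^ n)"
      using g(2)[of n "X n"] by (simp add: X)
    then have "(1/3) ^ n * N n \<le> 6 * K" by (simp add: algebra_simps)
    moreover have "(1/3) ^ n * 4 ^ n \<le> (1/3) ^ n * N n" using N4 by (intro mult_left_mono) auto
    ultimately show ?thesis by (simp add: power_divide)
  qed
  moreover obtain n where "(4/3::real) ^ n > 6 * K" using real_arch_pow[of "4/3"] by auto
  ultimately show False by (meson not_less)
qed

instance complex :: cbanach ..

text \<open>The dual of a normed space is complete. This is what allows the uniform boundedness principle to be
applied to operators that are defined on a dual space.\<close>

instance cblinfun :: (complex_normed_vector, cbanach) cbanach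
proof
  fix A :: "nat \<Rightarrow> 'a \<Rightarrow>\<^sub>C\<^sub>L 'b" assume A: "Cauchy A"
  have pt: "norm (A m x - A n x) \<le> norm (A m - A n) * norm x" for m n x
    using norm_cblinfun_apply[of "A m - A n" x] by simp
  define L where "L x = lim (\<lambda>n. A n x)" for x
  have cau: "\<exists>M. \<forall>m\<ge>M. \<forall>n\<ge>M. norm (A m - A n) < e" if "e > 0" for e :: real
    using metric_CauchyD[OF A that] by (simp only: dist_norm)
  have "convergent (\<lambda>n. A n x)" for x
  proof (rule Cauchy_convergent, rule metric_CauchyI)
    fix e :: real assume "e > 0"
    then have "e / (norm x + 1) > 0" by (simp add: add_nonneg_pos)
    then obtain M where M: "\<And>m n. m \<ge> M \<Longrightarrow> n \<ge> M \<Longrightarrow> dist (A m) (A n) < e / (norm x + 1)"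
      using cau[of "e / (norm x + 1)"] unfolding dist_norm by blast
    have "dist (A m x) (A n x) < e" if "m \<ge> M" "n \<ge> M" for m n
    proof -
      have "dist (A m x) (A n x) \<le> dist (A m) (A n) * norm x" using pt by (simp add: dist_norm)
      also have "\<dots> \<le> dist (A m) (A n) * (norm x + 1)" by (simp add: mult_left_mono)
      also have "\<dots> < e" using M[OF that] by (simp add: pos_less_divide_eq add_nonneg_pos)
      finally show ?thesis .
    qed
    then show "\<exists>M. \<forall>m\<ge>M. \<forall>n\<ge>M. dist (A m x) (A n x) < e" by blast
  qed
  then have L: "(\<lambda>n. A n x) \<longlonglongrightarrow> L x" for x by (simp add: L_def convergent_LIMSEQ_iff)
  have near: "\<exists>M. \<forall>n\<ge>M. \<forall>x. norm (L x - A n x) \<le> e * norm x" if "e > 0" for e :: real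
  proof -
    obtain M where M: "\<And>m n. m \<ge> M \<Longrightarrow> n \<ge> M \<Longrightarrow> norm (A m - A n) < e"
      using cau[OF \<open>e > 0\<close>] by blast
    have "norm (L x - A n x) \<le> e * norm x" if "n \<ge> M" for n x
    proof (rule Lim_bounded)
      show "(\<lambda>m. norm (A m x - A n x)) \<longlonglongrightarrow> norm (L x - A n x)"
        by (intro tendsto_norm tendsto_diff L tendsto_const)
      show "\<forall>m\<ge>M. norm (A m x - A n x) \<le> e * norm x"
      proof (intro allI impI)
        fix m assume "m \<ge> M"
        then have "norm (A m - A n) * norm x \<le> e * norm x"
          using M[OF _ that] by (intro mult_right_mono) (auto intro: less_imp_le)
        with pt[of m x n] show "norm (A m x - A n x) \<le> e * norm x" by simp
      qed
    qed
    then show ?thesis by blast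
  qed
  have "(0::real) < 1" by simp
  from near[OF this] obtain M where "\<forall>n\<ge>M. \<forall>x. norm (L x - A n x) \<le> 1 * norm x" ..
  then have M: "norm (L x - A M x) \<le> norm x" for x by simp
  have "bounded_clinear L"
  proof (rule bounded_clinearI)
    show "L (x + y) = L x + L y" for x y
      using LIMSEQ_unique[OF L tendsto_add[OF L L, of x y, folded cblinfun_arg_simps(2)]] .
    show "L (a *\<^sub>C x) = a *\<^sub>C L x" for a x
      using LIMSEQ_unique[OF L bounded_linear.tendsto[OF bounded_linear_scaleC_right L,
          of a x, folded cblinfun_apply_scaleC]] .
    show "norm (L x) \<le> (1 + norm (A M)) * norm x" for x
      using M[of x] norm_cblinfun_apply[of "A M" x] norm_triangle_sub[of "L x" "A M x"]
      by (simp add: algebra_simps)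
  qed
  then have app: "cblinfun_apply (CBlinfun L) = L" by (rule CBlinfun_apply)
  have "A \<longlonglongrightarrow> CBlinfun L"
  proof (rule metric_LIMSEQ_I)
    fix r :: real assume "r > 0"
    then obtain M where M: "\<And>n x. n \<ge> M \<Longrightarrow> norm (L x - A n x) \<le> r / 2 * norm x"
      using near[of "r / 2"] by auto
    have "dist (A n) (CBlinfun L) < r" if "n \<ge> M" for n
    proof -
      have "norm (CBlinfun L - A n) \<le> r / 2"
        using M[OF that] \<open>r > 0\<close> by (intro norm_cblinfun_le) (auto simp: app)
      then show ?thesis using \<open>r > 0\<close> by (simp add: dist_norm norm_minus_commute)
    qed
    then show "\<exists>M. \<forall>n\<ge>M. dist (A n) (CBlinfun L) < r" by blast
  qed
  then show "convergent A" by (auto simp: convergent_def)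
qed

section \<open>Rank-one operators and their pairing\<close>

lemma cblinfun_compose_simps [simp]:
  "(A + B) o\<^sub>C\<^sub>L C = A o\<^sub>C\<^sub>L C + B o\<^sub>C\<^sub>L C" "C o\<^sub>C\<^sub>L (A + B) = C o\<^sub>C\<^sub>L A + C o\<^sub>C\<^sub>L B"
  "(a *\<^sub>C A) o\<^sub>C\<^sub>L B = a *\<^sub>C (A o\<^sub>C\<^sub>L B)" "A o\<^sub>C\<^sub>L (a *\<^sub>C B) = a *\<^sub>C (A o\<^sub>C\<^sub>L B)"
  "0 o\<^sub>C\<^sub>L A = 0" "A o\<^sub>C\<^sub>L 0 = 0"
  by (rule cblinfun_eqI; simp add: scaleC_add_right)+

definition rank1 :: "'b::complex_normed_vector \<Rightarrow> 'a::complex_normed_vector cdual \<Rightarrow> 'a \<Rightarrow>\<^sub>C\<^sub>L 'b"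
  where "rank1 x f = CBlinfun (\<lambda>y. f y *\<^sub>C x)"

lemma rank1_apply [simp]: "rank1 x f y = f y *\<^sub>C x"
proof -
  have "bounded_clinear (\<lambda>y. f y *\<^sub>C x)"
  proof (rule bounded_clinearI[where M = "norm f * norm x"])
    show "norm (f y *\<^sub>C x) \<le> norm f * norm x * norm y" for y
      using mult_right_mono[OF norm_cblinfun_apply[of f y] norm_ge_zero[of x]]
      by (simp add: norm_scaleC mult_ac)
  qed (simp_all add: scaleC_add_left scaleC_scaleC)
  then show ?thesis by (simp add: rank1_def CBlinfun_apply)
qed

lemma rank1_simps [simp]:
  "A o\<^sub>C\<^sub>L rank1 x f = rank1 (A x) f" "rank1 x f o\<^sub>C\<^sub>L B = rank1 x (f o\<^sub>C\<^sub>L B)"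
  "rank1 (a *\<^sub>C x) f = a *\<^sub>C rank1 x f" "rank1 x (a *\<^sub>C f) = a *\<^sub>C rank1 x f"
  "rank1 0 f = 0" "rank1 x 0 = 0"
  by (rule cblinfun_eqI; simp add: scaleC_scaleC mult.commute)+

lemma rank1_add:
  "rank1 (x + y) f = rank1 x f + rank1 y f" "rank1 x (f + g) = rank1 x f + rank1 x g"
  by (rule cblinfun_eqI; simp add: scaleC_add_left scaleC_add_right)+

lemma rank1_complex [simp]: "rank1 c g = c *\<^sub>C g"
  by (rule cblinfun_eqI) (simp add: mult.commute)

lemma rank1_right_cancel: "rank1 x f = rank1 y f \<longleftrightarrow> x = y \<or> f = 0"
proof -
  have "x = y" if eq: "rank1 x f = rank1 y f" and "f \<noteq> 0"
  proof -
    obtain z where "f z = 1" using cdual_nonzero[OF \<open>f \<noteq> 0\<close>] by blast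
    then show ?thesis using arg_cong[OF eq, of "\<lambda>A. A z"] by simp
  qed
  then show ?thesis by auto
qed

lemma rank1_left_cancel:
  fixes x :: "'b::complex_normed_vector"
  shows "rank1 x f = rank1 x g \<longleftrightarrow> f = g \<or> x = 0"
proof -
  have "f = g" if eq: "rank1 x f = rank1 x g" and "x \<noteq> 0"
  proof (rule cblinfun_eqI)
    obtain k :: "'b cdual" where "k x = 1" using separating_functional[OF \<open>x \<noteq> 0\<close>] .
    then show "f z = g z" for z using arg_cong[OF eq, of "\<lambda>A. k (A z)"] by simp
  qed
  then show ?thesis by auto
qed

lemma rank1_eq_0_iff [simp]: "rank1 x f = 0 \<longleftrightarrow> x = 0 \<or> f = 0"
  using rank1_right_cancel[of x f 0] by auto

lemma finite_rank_rank1: "finite_rank (rank1 x f)"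
proof (cases "f = 0")
  case True
  then have "range (rank1 x f) = cspan {}" by auto
  then show ?thesis unfolding finite_rank_def cfinite_dim_def by blast
next
  case False
  then obtain z where z: "f z = 1" using cdual_nonzero by metis
  have "a *\<^sub>C x \<in> range (rank1 x f)" for a
    using z by (intro image_eqI[of _ _ "a *\<^sub>C z"]) auto
  then have "range (rank1 x f) = range (\<lambda>a. a *\<^sub>C x)" by auto
  also have "\<dots> = cspan {x}" by (simp add: complex_vector.span_singleton)
  finally show ?thesis unfolding finite_rank_def cfinite_dim_def
    by (intro exI[of _ "{x}"]) simp
qed

definition is_rank1 :: "('a::complex_normed_vector \<Rightarrow>\<^sub>C\<^sub>L 'b::complex_normed_vector) \<Rightarrow> bool"
  where "is_rank1 A \<longleftrightarrow> (\<exists>x f. x \<noteq> 0 \<and> f \<noteq> 0 \<and> A = rank1 x f)"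

lemma is_rank1_rank1: "is_rank1 (rank1 x f) \<longleftrightarrow> x \<noteq> 0 \<and> f \<noteq> 0"
  by (metis is_rank1_def rank1_eq_0_iff)

lemma is_rank1E:
  assumes "is_rank1 A" obtains x f where "x \<noteq> 0" "f \<noteq> 0" "A = rank1 x f"
  using assms by (auto simp: is_rank1_def)

lemma is_rank1_nonzero: "is_rank1 A \<Longrightarrow> A \<noteq> 0"
  by (auto simp: is_rank1_def)

lemma scaleC_eq_0_iff [simp]: "a *\<^sub>C (x::'a::complex_vector) = 0 \<longleftrightarrow> a = 0 \<or> x = 0"
  by (rule complex_vector.scale_eq_0_iff)

lemma is_rank1_scaleC [simp]: "is_rank1 (a *\<^sub>C A) \<longleftrightarrow> a \<noteq> 0 \<and> is_rank1 A"
proof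
  assume "is_rank1 (a *\<^sub>C A)"
  then obtain x f where *: "x \<noteq> 0" "f \<noteq> 0" "a *\<^sub>C A = rank1 x f" by (rule is_rank1E)
  then have "a \<noteq> 0" by (auto simp: eq_commute[of 0])
  then have "A = rank1 (inverse a *\<^sub>C x) f"
    using arg_cong[OF *(3), of "\<lambda>B. inverse a *\<^sub>C B"] by (simp add: scaleC_scaleC)
  moreover have "inverse a *\<^sub>C x \<noteq> 0" using \<open>a \<noteq> 0\<close> * by simp
  ultimately show "a \<noteq> 0 \<and> is_rank1 A" using \<open>a \<noteq> 0\<close> *(2) is_rank1_def by blast
next
  assume "a \<noteq> 0 \<and> is_rank1 A"
  then obtain x f where "x \<noteq> 0" "f \<noteq> 0" "A = rank1 x f" "a \<noteq> 0" by (auto elim: is_rank1E)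
  then show "is_rank1 (a *\<^sub>C A)" using is_rank1_rank1[of "a *\<^sub>C x" f] by simp
qed

lemma standard_algebraD:
  assumes "standard_operator_algebra \<A>"
  shows "0 \<in> \<A>" "A \<in> \<A> \<Longrightarrow> B \<in> \<A> \<Longrightarrow> A + B \<in> \<A>" "A \<in> \<A> \<Longrightarrow> a *\<^sub>C A \<in> \<A>"
    "A \<in> \<A> \<Longrightarrow> B \<in> \<A> \<Longrightarrow> A o\<^sub>C\<^sub>L B \<in> \<A>" "rank1 x f \<in> \<A>" "is_rank1 A \<Longrightarrow> A \<in> \<A>"
proof -
  have sub: "csubspace \<A>" and fin: "{A. finite_rank A} \<subseteq> \<A>"
    using assms by (auto simp: standard_operator_algebra_def)
  show "0 \<in> \<A>" "A \<in> \<A> \<Longrightarrow> B \<in> \<A> \<Longrightarrow> A + B \<in> \<A>" "A \<in> \<A> \<Longrightarrow> a *\<^sub>C A \<in> \<A>"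
    using sub by (auto intro: complex_vector.subspace_0
      complex_vector.subspace_add complex_vector.subspace_scale)
  show "A \<in> \<A> \<Longrightarrow> B \<in> \<A> \<Longrightarrow> A o\<^sub>C\<^sub>L B \<in> \<A>"
    using assms by (auto simp: standard_operator_algebra_def)
  show "rank1 x f \<in> \<A>" "is_rank1 A \<Longrightarrow> A \<in> \<A>"
    using fin finite_rank_rank1 unfolding is_rank1_def by blast+
qed

text \<open>A description of rank one that uses only the product \<open>ABA\<close>, so that it is preserved by Jordan
triple isomorphisms: a nonzero operator \<open>A\<close> can always be compressed to some \<open>ABA\<close> of rank one, and
if \<open>A\<close> can be recovered from that by another triple product, \<open>A\<close> itself has rank one.\<close>

lemma is_rank1_iff_triple:
  assumes std: "standard_operator_algebra \<A>" and A: "A \<in> \<A>"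
  shows "is_rank1 A \<longleftrightarrow> A \<noteq> 0 \<and> (\<forall>B\<in>\<A>. A o\<^sub>C\<^sub>L B o\<^sub>C\<^sub>L A \<noteq> 0 \<longrightarrow>
    (\<exists>C\<in>\<A>. (A o\<^sub>C\<^sub>L B o\<^sub>C\<^sub>L A) o\<^sub>C\<^sub>L C o\<^sub>C\<^sub>L (A o\<^sub>C\<^sub>L B o\<^sub>C\<^sub>L A) = A))" (is "?l \<longleftrightarrow> ?r")
proof
  assume ?l
  then obtain x f where xf: "x \<noteq> 0" "f \<noteq> 0" and A_eq: "A = rank1 x f" by (rule is_rank1E)
  obtain z where z: "f z = 1" using cdual_nonzero xf(2) by metis
  obtain k :: "'a cdual" where k: "k x = 1" using separating_functional[OF xf(1)] .
  show ?r
  proof (intro conjI ballI impI)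
    show "A \<noteq> 0" using xf A_eq by simp
    fix B assume nz: "A o\<^sub>C\<^sub>L B o\<^sub>C\<^sub>L A \<noteq> 0"
    let ?t = "f (B x)" let ?C = "rank1 z (inverse (?t * ?t) *\<^sub>C k)"
    have ABA: "A o\<^sub>C\<^sub>L B o\<^sub>C\<^sub>L A = ?t *\<^sub>C A" by (simp add: A_eq)
    then have "?t \<noteq> 0" using nz by auto
    then have "?t * (inverse ?t * inverse ?t * ?t) = 1" by (simp add: field_simps)
    then have "(A o\<^sub>C\<^sub>L B o\<^sub>C\<^sub>L A) o\<^sub>C\<^sub>L ?C o\<^sub>C\<^sub>L (A o\<^sub>C\<^sub>L B o\<^sub>C\<^sub>L A) = A"
      unfolding ABA using z k by (simp add: A_eq scaleC_scaleC)
    then show "\<exists>C\<in>\<A>. (A o\<^sub>C\<^sub>L B o\<^sub>C\<^sub>L A) o\<^sub>C\<^sub>L C o\<^sub>C\<^sub>L (A o\<^sub>C\<^sub>L B o\<^sub>C\<^sub>L A) = A"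
      using standard_algebraD(5)[OF std] by blast
  qed
next
  assume r: ?r
  then obtain x where x: "A x \<noteq> 0" using cblinfun_eqI[of A 0] by auto
  obtain g :: "'a cdual" where g: "g (A x) = 1" using separating_functional[OF x] .
  let ?D = "A o\<^sub>C\<^sub>L rank1 x g o\<^sub>C\<^sub>L A"
  have "?D x \<noteq> 0" using g x by simp
  then have "?D \<noteq> 0" by (metis zero_cblinfun.rep_eq)
  then obtain C where "?D o\<^sub>C\<^sub>L C o\<^sub>C\<^sub>L ?D = A"
    using r standard_algebraD(5)[OF std] by blast
  then have "A = g (A (C (A x))) *\<^sub>C ?D" by simp
  moreover have "is_rank1 ?D" using \<open>?D \<noteq> 0\<close> by (simp add: is_rank1_rank1)
  ultimately show ?l using r is_rank1_scaleC scaleC_eq_0_iff by metis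
qed

text \<open>For \<open>R\<close> of rank one this is the trace of \<open>RA\<close>. It is defined by the triple product so that its
relation to a Jordan triple isomorphism is immediate.\<close>

definition pair :: "('a::complex_normed_vector \<Rightarrow>\<^sub>C\<^sub>L 'a) \<Rightarrow> ('a \<Rightarrow>\<^sub>C\<^sub>L 'a) \<Rightarrow> complex"
  where "pair R A = (SOME t. R o\<^sub>C\<^sub>L A o\<^sub>C\<^sub>L R = t *\<^sub>C R)"

lemma pair_rank1:
  assumes "x \<noteq> 0" "f \<noteq> 0"
  shows "pair (rank1 x f) A = f (A x)"
  unfolding pair_def using assms
  by (intro some_equality) (auto simp: complex_vector.scale_cancel_right)

lemma pair_triple: "is_rank1 R \<Longrightarrow> R o\<^sub>C\<^sub>L A o\<^sub>C\<^sub>L R = pair R A *\<^sub>C R"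
  by (auto elim!: is_rank1E simp: pair_rank1)

lemma pair_simps:
  assumes "is_rank1 R"
  shows "pair R (A + B) = pair R A + pair R B" "pair R (a *\<^sub>C A) = a * pair R A" "pair R 0 = 0"
    "a \<noteq> 0 \<Longrightarrow> pair (a *\<^sub>C R) A = a * pair R A"
proof -
  obtain x f where R: "x \<noteq> 0" "f \<noteq> 0" "R = rank1 x f" using assms by (rule is_rank1E)
  then show "pair R (A + B) = pair R A + pair R B" "pair R (a *\<^sub>C A) = a * pair R A" "pair R 0 = 0"
    by (simp_all add: pair_rank1)
  show "pair (a *\<^sub>C R) A = a * pair R A" if "a \<noteq> 0"
    using that R pair_rank1[of "a *\<^sub>C x" f] by (simp add: pair_rank1)
qed

lemma pair_commute: "is_rank1 R \<Longrightarrow> is_rank1 S \<Longrightarrow> pair R S = pair S R"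
  by (auto elim!: is_rank1E simp: pair_rank1)

lemma pair_separates:
  assumes "\<And>R. is_rank1 R \<Longrightarrow> pair R A = pair R B"
  shows "A = B"
proof (rule cblinfun_eqI, rule ccontr)
  fix x assume ne: "A x \<noteq> B x"
  then have "A x - B x \<noteq> 0" by simp
  then obtain k :: "'a cdual" where "k (A x - B x) = 1" by (rule separating_functional)
  then have k: "k (A x) \<noteq> k (B x)" by auto
  then have "k \<noteq> 0" "x \<noteq> 0" by auto
  then show False using assms[of "rank1 x k"] k by (simp add: pair_rank1 is_rank1_rank1)
qed

lemma ex_pair_eq_1:
  assumes "is_rank1 R" obtains S where "is_rank1 S" "pair R S = 1"
proof -
  obtain x f where R: "x \<noteq> 0" "f \<noteq> 0" "R = rank1 x f" using assms by (rule is_rank1E)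
  obtain z where z: "f z = 1" using cdual_nonzero R(2) by metis
  obtain k :: "'a cdual" where k: "k x = 1" using separating_functional[OF R(1)] .
  have "k \<noteq> 0" "z \<noteq> 0" using k z by auto
  then have "is_rank1 (rank1 z k)" by (simp add: is_rank1_rank1)
  then show ?thesis using that[of "rank1 z k"] R z k by (simp add: pair_rank1)
qed

text \<open>Neither two nonzero functionals nor two nonzero vectors can have kernels, or annihilators, that
cover the space, because a vector space is not the union of two proper subspaces.\<close>

lemma ex_pair_nonzero_both:
  assumes "is_rank1 R" "is_rank1 S"
  obtains Q where "is_rank1 Q" "pair R Q \<noteq> 0" "pair S Q \<noteq> 0"
proof -
  obtain x f where R: "x \<noteq> 0" "f \<noteq> 0" "R = rank1 x f" using assms(1) by (rule is_rank1E)
  obtain y g where S: "y \<noteq> 0" "g \<noteq> 0" "S = rank1 y g" using assms(2) by (rule is_rank1E)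
  have "\<exists>z. f z \<noteq> 0 \<and> g z \<noteq> 0"
  proof -
    obtain u v where "f u = 1" "g v = 1" using cdual_nonzero R(2) S(2) by metis
    then have "(f u \<noteq> 0 \<and> g u \<noteq> 0) \<or> (f v \<noteq> 0 \<and> g v \<noteq> 0) \<or> (f (u + v) \<noteq> 0 \<and> g (u + v) \<noteq> 0)"
      by auto
    then show ?thesis by blast
  qed
  moreover have "\<exists>k :: 'a cdual. k x \<noteq> 0 \<and> k y \<noteq> 0"
  proof -
    obtain k l :: "'a cdual" where "k x = 1" "l y = 1" using separating_functional R(1) S(1) by metis
    then have "(k x \<noteq> 0 \<and> k y \<noteq> 0) \<or> (l x \<noteq> 0 \<and> l y \<noteq> 0) \<or> ((k + l) x \<noteq> 0 \<and> (k + l) y \<noteq> 0)"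
      by auto
    then show ?thesis by blast
  qed
  ultimately obtain z and k :: "'a cdual"
    where zk: "f z \<noteq> 0" "g z \<noteq> 0" "k x \<noteq> 0" "k y \<noteq> 0" by blast
  then have "z \<noteq> 0" "k \<noteq> 0" by auto
  then show ?thesis
    using that[of "rank1 z k"] R S zk by (simp add: is_rank1_rank1 pair_rank1)
qed

section \<open>Jordan triple isomorphisms on rank-one operators\<close>

locale jordan_triple_iso =
  fixes \<A> :: "('a::complex_normed_vector \<Rightarrow>\<^sub>C\<^sub>L 'a) set"
    and \<B> :: "('b::complex_normed_vector \<Rightarrow>\<^sub>C\<^sub>L 'b) set"
    and \<phi> :: "('a \<Rightarrow>\<^sub>C\<^sub>L 'a) \<Rightarrow> ('b \<Rightarrow>\<^sub>C\<^sub>L 'b)"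
  assumes std_A: "standard_operator_algebra \<A>"
    and std_B: "standard_operator_algebra \<B>"
    and bij: "bij_betw \<phi> \<A> \<B>"
    and triple: "A \<in> \<A> \<Longrightarrow> B \<in> \<A> \<Longrightarrow> \<phi> (A o\<^sub>C\<^sub>L B o\<^sub>C\<^sub>L A) = \<phi> A o\<^sub>C\<^sub>L \<phi> B o\<^sub>C\<^sub>L \<phi> A"
begin

lemmas A_closed = standard_algebraD[OF std_A]
lemmas B_closed = standard_algebraD[OF std_B]

lemma phi_in [simp]: "A \<in> \<A> \<Longrightarrow> \<phi> A \<in> \<B>"
  using bij by (auto simp: bij_betw_def)

lemma phi_surj: assumes "B \<in> \<B>" obtains A where "A \<in> \<A>" "\<phi> A = B"
  using bij assms by (auto simp: bij_betw_def)

lemma phi_inj: "A \<in> \<A> \<Longrightarrow> B \<in> \<A> \<Longrightarrow> \<phi> A = \<phi> B \<longleftrightarrow> A = B"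
  using bij by (auto simp: bij_betw_def inj_on_def)

lemma inverse_jordan_triple_iso: "jordan_triple_iso \<B> \<A> (inv_into \<A> \<phi>)"
proof
  show "bij_betw (inv_into \<A> \<phi>) \<B> \<A>" by (rule bij_betw_inv_into[OF bij])
  fix C D assume "C \<in> \<B>" "D \<in> \<B>"
  then obtain A B where "A \<in> \<A>" "\<phi> A = C" "B \<in> \<A>" "\<phi> B = D" using phi_surj by metis
  then show "inv_into \<A> \<phi> (C o\<^sub>C\<^sub>L D o\<^sub>C\<^sub>L C) =
      inv_into \<A> \<phi> C o\<^sub>C\<^sub>L inv_into \<A> \<phi> D o\<^sub>C\<^sub>L inv_into \<A> \<phi> C"
    using bij by (auto simp: bij_betw_def A_closed(4) simp flip: triple)
qed (fact std_A std_B)+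

lemma inv_phi [simp]: "A \<in> \<A> \<Longrightarrow> inv_into \<A> \<phi> (\<phi> A) = A"
  using bij by (auto simp: bij_betw_def)

lemma phi_0 [simp]: "\<phi> 0 = 0"
proof -
  obtain C where C: "C \<in> \<A>" "\<phi> C = 0" using phi_surj[OF B_closed(1)] .
  then show ?thesis using triple[OF A_closed(1) C(1)] by simp
qed

lemma phi_eq_0_iff: "A \<in> \<A> \<Longrightarrow> \<phi> A = 0 \<longleftrightarrow> A = 0"
  using phi_inj[OF _ A_closed(1), of A] by simp

lemma is_rank1_phi:
  assumes "is_rank1 A"
  shows "is_rank1 (\<phi> A)"
proof -
  have A: "A \<in> \<A>" using assms by (rule A_closed(6))
  have A_char: "A \<noteq> 0" "\<And>B. B \<in> \<A> \<Longrightarrow> A o\<^sub>C\<^sub>L B o\<^sub>C\<^sub>L A \<noteq> 0 \<Longrightarrow>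
    \<exists>C\<in>\<A>. (A o\<^sub>C\<^sub>L B o\<^sub>C\<^sub>L A) o\<^sub>C\<^sub>L C o\<^sub>C\<^sub>L (A o\<^sub>C\<^sub>L B o\<^sub>C\<^sub>L A) = A"
    using assms is_rank1_iff_triple[OF std_A A] by auto
  show ?thesis
    unfolding is_rank1_iff_triple[OF std_B phi_in[OF A]]
  proof (intro conjI ballI impI)
    show "\<phi> A \<noteq> 0" using A_char(1) phi_eq_0_iff[OF A] by simp
    fix D assume "D \<in> \<B>" and nz: "\<phi> A o\<^sub>C\<^sub>L D o\<^sub>C\<^sub>L \<phi> A \<noteq> 0"
    then obtain B where B: "B \<in> \<A>" "\<phi> B = D" using phi_surj by metis
    let ?E = "A o\<^sub>C\<^sub>L B o\<^sub>C\<^sub>L A"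
    have E: "?E \<in> \<A>" "\<phi> ?E = \<phi> A o\<^sub>C\<^sub>L D o\<^sub>C\<^sub>L \<phi> A"
      using A B by (auto simp: triple intro!: A_closed(4))
    then have "?E \<noteq> 0" using nz by auto
    then obtain C where "C \<in> \<A>" "?E o\<^sub>C\<^sub>L C o\<^sub>C\<^sub>L ?E = A" using A_char(2) B(1) by blast
    then show "\<exists>C\<in>\<B>. (\<phi> A o\<^sub>C\<^sub>L D o\<^sub>C\<^sub>L \<phi> A) o\<^sub>C\<^sub>L C o\<^sub>C\<^sub>L (\<phi> A o\<^sub>C\<^sub>L D o\<^sub>C\<^sub>L \<phi> A) = \<phi> A"
      using triple[OF E(1), of C] E(2) by (intro bexI[of _ "\<phi> C"]) auto
  qed
qed

lemma rank1_preimage: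
  assumes "is_rank1 S" obtains R where "is_rank1 R" "\<phi> R = S"
proof -
  interpret inv: jordan_triple_iso \<B> \<A> "inv_into \<A> \<phi>" by (rule inverse_jordan_triple_iso)
  have "S \<in> \<B>" using assms by (rule B_closed(6))
  then have "\<phi> (inv_into \<A> \<phi> S) = S" using bij by (auto simp: bij_betw_def f_inv_into_f)
  then show ?thesis using that inv.is_rank1_phi[OF assms] by blast
qed

lemma phi_pair:
  assumes "is_rank1 R" "A \<in> \<A>"
  shows "\<phi> (pair R A *\<^sub>C R) = pair (\<phi> R) (\<phi> A) *\<^sub>C \<phi> R"
  using triple[OF A_closed(6)[OF assms(1)] assms(2)] pair_triple[OF assms(1), of A]
    pair_triple[OF is_rank1_phi[OF assms(1)], of "\<phi> A"] by simp

lemma phi_scale_exists: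
  assumes "is_rank1 R"
  shows "\<exists>b. \<phi> (a *\<^sub>C R) = b *\<^sub>C \<phi> R"
proof -
  obtain S where S: "is_rank1 S" "pair R S = 1" using ex_pair_eq_1[OF assms] .
  then show ?thesis using phi_pair[OF assms, of "a *\<^sub>C S"] assms
    by (auto simp: pair_simps A_closed)
qed

text \<open>On the line through a rank-one operator \<open>R\<close> the map acts by some scaling \<open>k R\<close>, and
\<open>k R\<close> also transforms the pairing with \<open>R\<close>. Symmetry of the pairing compares the scalings of different
operators. The result is one multiplicative bijection \<open>h\<close> with \<open>tr (\<phi>(R) \<phi>(A)) = h (tr (R A))\<close>; this
identity carries the rest of the proof.\<close>

lemma scaling_function:
  assumes "is_rank1 (R0 :: 'a \<Rightarrow>\<^sub>C\<^sub>L 'a)"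
  obtains h where "\<And>R a. is_rank1 R \<Longrightarrow> \<phi> (a *\<^sub>C R) = h a *\<^sub>C \<phi> R"
    "\<And>R A. is_rank1 R \<Longrightarrow> A \<in> \<A> \<Longrightarrow> pair (\<phi> R) (\<phi> A) = h (pair R A)"
    "\<And>a b. h (a * b) = h a * h b" "h 0 = 0" "h 1 = 1" "bij h"
proof -
  obtain k where k: "\<And>R a. is_rank1 R \<Longrightarrow> \<phi> (a *\<^sub>C R) = k R a *\<^sub>C \<phi> R"
    using phi_scale_exists by metis
  have cancel: "a = b" if "a *\<^sub>C \<phi> R = b *\<^sub>C \<phi> R" "is_rank1 R" for a b R
    using that is_rank1_nonzero[OF is_rank1_phi[OF that(2)]] complex_vector.scale_right_imp_eq by blast
  have k_pair: "pair (\<phi> R) (\<phi> A) = k R (pair R A)" if "is_rank1 R" "A \<in> \<A>" for R A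
    by (rule cancel[OF _ that(1)]) (simp add: k[OF that(1), symmetric] phi_pair[OF that])
  have k1: "k R 1 = 1" if "is_rank1 R" for R
    using k[OF that, of 1] cancel[OF _ that, of 1 "k R 1"] by simp
  have k0: "k R 0 = 0" if "is_rank1 R" for R
    using k[OF that, of 0] cancel[OF _ that, of 0 "k R 0"] by simp
  have sym: "k R (pair R S) = k S (pair R S)" if "is_rank1 R" "is_rank1 S" for R S
    using that k_pair[of R S] k_pair[of S R] pair_commute[of R S]
      pair_commute[of "\<phi> R" "\<phi> S"] by (simp add: A_closed(6) is_rank1_phi)
  have move: "k R (a * pair R S) = k S a * k R (pair R S)" if "is_rank1 R" "is_rank1 S" for R S a
    using that k_pair[of R "a *\<^sub>C S"] k_pair[of R S]
    by (simp add: k A_closed pair_simps is_rank1_phi)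
  have mult: "k R (a * b) = k R a * k R b" if R: "is_rank1 R" for R a b
  proof -
    obtain S where S: "is_rank1 S" "pair R S = 1" using ex_pair_eq_1[OF R] .
    then have kRS: "k R c = k S c" for c using move[OF R S(1), of c] k1[OF R] by simp
    \<comment> \<open>pass from \<open>R\<close> to \<open>m R\<close> and compare both with \<open>S\<close>; every complex number is a square\<close>
    have square: "k R (c * (m * m)) = k R c * k R m * k R m" for c m
    proof (cases "m = 0")
      case False
      then have mR: "is_rank1 (m *\<^sub>C R)" using R by simp
      have p: "pair (m *\<^sub>C R) S = m" using pair_simps(4)[OF R False, of S] S(2) by simp
      have "k R (c * (m * m)) *\<^sub>C \<phi> R = (k (m *\<^sub>C R) (c * m) * k R m) *\<^sub>C \<phi> R"
        using k[OF mR, of "c * m"] k[OF R, of "c * (m * m)"] k[OF R, of m]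
        by (simp add: scaleC_scaleC mult.assoc)
      then have "k R (c * (m * m)) = k (m *\<^sub>C R) (c * m) * k R m" using R by (rule cancel)
      also have "k (m *\<^sub>C R) (c * m) = k S c * k S m"
        using move[OF mR S(1), of c] sym[OF mR S(1)] p by simp
      finally show ?thesis using kRS by simp
    qed (use k0[OF R] in simp)
    define m where "m = csqrt b"
    have b: "b = m * m" by (simp add: m_def flip: power2_eq_square)
    show ?thesis
      unfolding b using square[of a m] square[of 1 m] k1[OF R] by simp
  qed
  have k_eq_pair: "k R a = k S a" if RS: "is_rank1 R" "is_rank1 S" "pair R S \<noteq> 0" for R S a
  proof -
    have "k R (pair R S) * k R (inverse (pair R S)) = 1"
      using RS mult[OF RS(1), of "pair R S" "inverse (pair R S)"] k1[OF RS(1)] by simp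
    then have "k R (pair R S) \<noteq> 0" by auto
    then show ?thesis using move[OF RS(1,2), of a] mult[OF RS(1)] by simp
  qed
  have k_eq: "k R a = k R0 a" if R: "is_rank1 R" for R a
  proof -
    obtain Q where "is_rank1 Q" "pair R Q \<noteq> 0" "pair R0 Q \<noteq> 0"
      using ex_pair_nonzero_both[OF R assms] .
    then show ?thesis using k_eq_pair R assms by metis
  qed
  have "bij (k R0)"
  proof (rule bijI)
    show "inj (k R0)"
    proof (rule injI)
      fix a b assume "k R0 a = k R0 b"
      then have "\<phi> (a *\<^sub>C R0) = \<phi> (b *\<^sub>C R0)" using k[OF assms] by simp
      then have "a *\<^sub>C R0 = b *\<^sub>C R0" using phi_inj assms by (simp add: A_closed)
      then show "a = b" using is_rank1_nonzero[OF assms] complex_vector.scale_right_imp_eq by blast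
    qed
    show "surj (k R0)"
    proof (rule surjI)
      interpret inv: jordan_triple_iso \<B> \<A> "inv_into \<A> \<phi>" by (rule inverse_jordan_triple_iso)
      fix b
      let ?a = "SOME a. inv_into \<A> \<phi> (b *\<^sub>C \<phi> R0) = a *\<^sub>C R0"
      have "\<exists>a. inv_into \<A> \<phi> (b *\<^sub>C \<phi> R0) = a *\<^sub>C R0"
        using inv.phi_scale_exists[OF is_rank1_phi[OF assms], of b] assms by (simp add: A_closed)
      then have "inv_into \<A> \<phi> (b *\<^sub>C \<phi> R0) = ?a *\<^sub>C R0" by (rule someI_ex)
      moreover have "b *\<^sub>C \<phi> R0 \<in> \<B>" using assms by (simp add: A_closed B_closed)
      then have "\<phi> (inv_into \<A> \<phi> (b *\<^sub>C \<phi> R0)) = b *\<^sub>C \<phi> R0"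
        using bij by (auto simp: bij_betw_def f_inv_into_f)
      ultimately show "k R0 ?a = b" using k[OF assms, of ?a] cancel[OF _ assms] by metis
    qed
  qed
  then show ?thesis
    using that[of "k R0"] k k_pair k_eq mult[OF assms] k0[OF assms] k1[OF assms] by metis
qed

end

section \<open>Additivity of the scaling function\<close>

lemma functional_multiple:
  fixes f m :: "'a::complex_normed_vector cdual"
  assumes "\<And>z. f z = 0 \<Longrightarrow> m z = 0"
  shows "\<exists>a. m = a *\<^sub>C f"
proof (cases "f = 0")
  case True
  then have "m = 0" using assms by (intro cblinfun_eqI) simp
  then show ?thesis by (intro exI[of _ 0]) simp
next
  case False
  then obtain z where z: "f z = 1" by (rule cdual_nonzero)
  have "m = m z *\<^sub>C f"
  proof (rule cblinfun_eqI)
    show "m y = (m z *\<^sub>C f) y" for y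
      using assms[of "y - f y *\<^sub>C z"] z by (simp add: mult.commute)
  qed
  then show ?thesis by blast
qed

text \<open>If \<open>g\<close> vanishes on the kernel of \<open>f\<close>, one functional suffices. Otherwise subtracting a suitable
multiple of \<open>g\<close> from \<open>m\<close> makes the difference vanish on the kernel of \<open>f\<close>.\<close>

lemma functional_combination:
  fixes f g m :: "'a::complex_normed_vector cdual"
  assumes "\<And>z. f z = 0 \<Longrightarrow> g z = 0 \<Longrightarrow> m z = 0"
  shows "\<exists>a b. m = a *\<^sub>C f + b *\<^sub>C g"
proof (cases "\<exists>z. f z = 0 \<and> g z \<noteq> 0")
  case True
  then obtain z where z: "f z = 0" "g z \<noteq> 0" by blast
  let ?b = "m z / g z"
  have "(m - ?b *\<^sub>C g) y = 0" if "f y = 0" for y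
    using assms[of "y - (g y / g z) *\<^sub>C z"] that z by (simp add: field_simps)
  then obtain a where "m - ?b *\<^sub>C g = a *\<^sub>C f" using functional_multiple by blast
  then have "m = a *\<^sub>C f + ?b *\<^sub>C g" by (simp add: diff_eq_eq)
  then show ?thesis by blast
next
  case False
  then obtain a where "m = a *\<^sub>C f" using functional_multiple[of f m] assms by blast
  then show ?thesis by (intro exI[of _ a] exI[of _ 0]) simp
qed

text \<open>The next two lemmas are the preceding ones with vectors and functionals exchanged; the separation of
points by functionals replaces extensionality.\<close>

lemma vector_multiple:
  fixes x w :: "'a::complex_normed_vector"
  assumes "\<And>k :: 'a cdual. k x = 0 \<Longrightarrow> k w = 0"
  shows "\<exists>a. w = a *\<^sub>C x"
proof (cases "x = 0")
  case True
  then have "w = 0" using assms separating_functional[of w] by force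
  then show ?thesis by (intro exI[of _ 0]) simp
next
  case False
  then obtain k0 :: "'a cdual" where k0: "k0 x = 1" by (rule separating_functional)
  have "w - k0 w *\<^sub>C x = 0"
  proof (rule ccontr)
    assume "w - k0 w *\<^sub>C x \<noteq> 0"
    then obtain k :: "'a cdual" where "k (w - k0 w *\<^sub>C x) = 1" by (rule separating_functional)
    then show False using assms[of "k - k x *\<^sub>C k0"] k0 by (simp add: mult.commute)
  qed
  then show ?thesis by auto
qed

lemma vector_combination:
  fixes x y w :: "'a::complex_normed_vector"
  assumes "\<And>k :: 'a cdual. k x = 0 \<Longrightarrow> k y = 0 \<Longrightarrow> k w = 0"
  shows "\<exists>a b. w = a *\<^sub>C x + b *\<^sub>C y"
proof (cases "\<exists>k :: 'a cdual. k x = 0 \<and> k y \<noteq> 0")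
  case True
  then obtain k0 :: "'a cdual" where k0: "k0 x = 0" "k0 y \<noteq> 0" by blast
  let ?b = "k0 w / k0 y"
  have "k (w - ?b *\<^sub>C y) = 0" if "k x = 0" for k :: "'a cdual"
    using assms[of "k - (k y / k0 y) *\<^sub>C k0"] that k0 by (simp add: field_simps)
  then obtain a where "w - ?b *\<^sub>C y = a *\<^sub>C x" using vector_multiple by blast
  then have "w = a *\<^sub>C x + ?b *\<^sub>C y" by (simp add: diff_eq_eq)
  then show ?thesis by blast
next
  case False
  then obtain a where "w = a *\<^sub>C x" using vector_multiple[of x w] assms by blast
  then show ?thesis by (intro exI[of _ a] exI[of _ 0]) simp
qed

lemma functional_with_values:
  fixes x y :: "'a::complex_normed_vector"
  assumes "\<And>a. y \<noteq> a *\<^sub>C x" "x \<noteq> 0"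
  obtains k :: "'a cdual" where "k x = s" "k y = t"
proof -
  obtain k1 :: "'a cdual" where k1: "k1 x = 0" "k1 y \<noteq> 0"
    using vector_multiple[of x y] assms(1) by blast
  have "x \<noteq> a *\<^sub>C y" for a
  proof
    assume x: "x = a *\<^sub>C y"
    then have "y = inverse a *\<^sub>C x" using assms(2) by (auto simp: scaleC_scaleC)
    then show False using assms(1) by blast
  qed
  then obtain k2 :: "'a cdual" where k2: "k2 y = 0" "k2 x \<noteq> 0"
    using vector_multiple[of y x] by blast
  show ?thesis
    using that[of "(s / k2 x) *\<^sub>C k2 + (t / k1 y) *\<^sub>C k1"] k1 k2 by simp
qed

text \<open>Orthogonality relations detect linear combinations of rank-one operators. Write
\<open>R = x \<otimes> f\<close>, \<open>S = y \<otimes> g\<close>, \<open>W = w \<otimes> m\<close> and test with \<open>Q = z \<otimes> k\<close>, so that the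
pairing of \<open>R\<close> and \<open>Q\<close> is \<open>f(z) k(x)\<close>. Letting \<open>f\<close> and \<open>g\<close> vanish at \<open>z\<close> puts \<open>m\<close> into the
span of \<open>f\<close> and \<open>g\<close>, and dually for \<open>w\<close>. Mixed tests show that \<open>m\<close> is a multiple of \<open>f\<close> or
\<open>w\<close> one of \<open>y\<close>, and likewise with the roles of \<open>R\<close> and \<open>S\<close> exchanged. Since \<open>W\<close> is on
neither line, \<open>m\<close> is a multiple of both functionals or \<open>w\<close> one of both vectors, and then \<open>W\<close> splits.\<close>

lemma rank1_combination:
  fixes R S W :: "'a::complex_normed_vector \<Rightarrow>\<^sub>C\<^sub>L 'a"
  assumes rank1: "is_rank1 R" "is_rank1 S" "is_rank1 W"
    and orth: "\<And>Q. is_rank1 Q \<Longrightarrow> pair R Q = 0 \<Longrightarrow> pair S Q = 0 \<Longrightarrow> pair W Q = 0"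
    and WR: "\<And>a. W \<noteq> a *\<^sub>C R" and WS: "\<And>a. W \<noteq> a *\<^sub>C S"
  shows "\<exists>a b. W = a *\<^sub>C R + b *\<^sub>C S"
proof -
  obtain x f where R: "x \<noteq> 0" "f \<noteq> 0" "R = rank1 x f" using rank1(1) by (rule is_rank1E)
  obtain y g where S: "y \<noteq> 0" "g \<noteq> 0" "S = rank1 y g" using rank1(2) by (rule is_rank1E)
  obtain w m where W: "w \<noteq> 0" "m \<noteq> 0" "W = rank1 w m" using rank1(3) by (rule is_rank1E)
  have orth': "m z = 0 \<or> k w = 0"
    if "f z = 0 \<or> k x = 0" "g z = 0 \<or> k y = 0" for z and k :: "'a cdual"
  proof (cases "z = 0 \<or> k = 0")
    case False
    then have "is_rank1 (rank1 z k)" by (simp add: is_rank1_rank1)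
    from orth[OF this] show ?thesis using R S W that by (auto simp: pair_rank1)
  qed auto
  have "\<exists>a b. m = a *\<^sub>C f + b *\<^sub>C g"
  proof (rule functional_combination)
    fix z assume "f z = 0" "g z = 0"
    obtain k :: "'a cdual" where "k w = 1" using separating_functional[OF W(1)] .
    then show "m z = 0" using orth'[of z k] \<open>f z = 0\<close> \<open>g z = 0\<close> by auto
  qed
  then obtain a b where m: "m = a *\<^sub>C f + b *\<^sub>C g" by blast
  have "\<exists>c d. w = c *\<^sub>C x + d *\<^sub>C y"
  proof (rule vector_combination)
    fix k :: "'a cdual" assume "k x = 0" "k y = 0"
    obtain z where "m z = 1" using W(2) by (rule cdual_nonzero)
    then show "k w = 0" using orth'[of z k] \<open>k x = 0\<close> \<open>k y = 0\<close> by auto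
  qed
  then obtain c d where w: "w = c *\<^sub>C x + d *\<^sub>C y" by blast
  have alt: "(\<exists>a. m = a *\<^sub>C f) \<or> (\<exists>a. w = a *\<^sub>C y)"
  proof (rule ccontr)
    assume neg: "\<not> ?thesis"
    obtain z where z: "f z = 0" "m z \<noteq> 0" using functional_multiple[of f m] neg by blast
    obtain k :: "'a cdual" where k: "k y = 0" "k w \<noteq> 0" using vector_multiple[of y w] neg by blast
    show False using orth'[of z k] z k by blast
  qed
  have alt': "(\<exists>a. m = a *\<^sub>C g) \<or> (\<exists>a. w = a *\<^sub>C x)"
  proof (rule ccontr)
    assume neg: "\<not> ?thesis"
    obtain z where z: "g z = 0" "m z \<noteq> 0" using functional_multiple[of g m] neg by blast
    obtain k :: "'a cdual" where k: "k x = 0" "k w \<noteq> 0" using vector_multiple[of x w] neg by blast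
    show False using orth'[of z k] z k by blast
  qed
  have not_R: "\<not> (m = p *\<^sub>C f \<and> w = q *\<^sub>C x)" for p q
    using WR[of "q * p"] W R by (auto simp: scaleC_scaleC mult.commute)
  have not_S: "\<not> (m = p *\<^sub>C g \<and> w = q *\<^sub>C y)" for p q
    using WS[of "q * p"] W S by (auto simp: scaleC_scaleC mult.commute)
  from alt alt' not_R not_S
  consider p q where "m = p *\<^sub>C f" "m = q *\<^sub>C g" | p q where "w = p *\<^sub>C x" "w = q *\<^sub>C y"
    by blast
  then show ?thesis
  proof cases
    case 1
    have "W = c *\<^sub>C rank1 x m + d *\<^sub>C rank1 y m" by (simp add: W(3) w rank1_add)
    also have "rank1 x m = p *\<^sub>C R" using 1(1) R(3) by simp
    also have "rank1 y m = q *\<^sub>C S" using 1(2) S(3) by simp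
    finally show ?thesis by (auto simp: scaleC_scaleC)
  next
    case 2
    have "W = a *\<^sub>C rank1 w f + b *\<^sub>C rank1 w g" by (simp add: W(3) m rank1_add)
    also have "rank1 w f = p *\<^sub>C R" using 2(1) R(3) by simp
    also have "rank1 w g = q *\<^sub>C S" using 2(2) S(3) by simp
    finally show ?thesis by (auto simp: scaleC_scaleC)
  qed
qed

lemma ring_automorphismD:
  assumes "ring_automorphism h"
  shows "h (a + b) = h a + h b" "h (a * b) = h a * h b" "h 0 = 0" "h 1 = 1" "h (- a) = - h a"
    "h a = h b \<longleftrightarrow> a = b" "h a = 0 \<longleftrightarrow> a = 0" "bij h"
proof -
  show add: "h (a + b) = h a + h b" and mult: "h (a * b) = h a * h b" and b: "bij h" for a b
    using assms by (auto simp: ring_automorphism_def)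
  show zero: "h 0 = 0" using add[of 0 0] by simp
  show inj: "h a = h b \<longleftrightarrow> a = b" for a b using b by (auto simp: bij_def inj_def)
  show "h a = 0 \<longleftrightarrow> a = 0" for a using inj[of a 0] zero by simp
  show "h 1 = 1" using mult[of 1 1] inj[of 1 0] zero by auto
  show "h (- a) = - h a" using add[of a "- a"] zero by (simp add: add_eq_0_iff2)
qed

context jordan_triple_iso
begin

text \<open>The operators \<open>x \<otimes> f\<close>, \<open>y \<otimes> f\<close> and their sum have rank one, and every operator orthogonal to the
first two is orthogonal to the third. This is inherited by the images, so the image of the sum is a
combination of the two images. Pairing with operators \<open>x \<otimes> k\<close>, where \<open>k\<close> has
prescribed values at \<open>x\<close> and \<open>y\<close>, turns this into additivity of \<open>h\<close>. Since operators are
determined by their pairings with rank-one operators, the map itself is then semilinear.\<close>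

lemma phi_semilinear:
  assumes two_dim: "\<And>x :: 'a. \<exists>y. \<forall>a. y \<noteq> a *\<^sub>C x"
  obtains h where "ring_automorphism h"
    "\<And>R A. is_rank1 R \<Longrightarrow> A \<in> \<A> \<Longrightarrow> pair (\<phi> R) (\<phi> A) = h (pair R A)"
    "\<And>A B. A \<in> \<A> \<Longrightarrow> B \<in> \<A> \<Longrightarrow> \<phi> (A + B) = \<phi> A + \<phi> B"
    "\<And>a A. A \<in> \<A> \<Longrightarrow> \<phi> (a *\<^sub>C A) = h a *\<^sub>C \<phi> A"
proof -
  obtain x :: 'a where "\<forall>a. x \<noteq> a *\<^sub>C 0" using two_dim by blast
  then have x: "x \<noteq> 0" by simp
  obtain y :: 'a where y: "\<And>a. y \<noteq> a *\<^sub>C x" using two_dim by blast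
  then have y0: "y \<noteq> 0" and xy: "x + y \<noteq> 0"
    using y[of 0] y[of "-1"] by (auto simp: add_eq_0_iff)
  obtain f :: "'a cdual" where f: "f x = 1" using separating_functional[OF x] .
  then have f0: "f \<noteq> 0" by auto
  let ?R = "rank1 x f" and ?S = "rank1 y f" and ?W = "rank1 (x + y) f"
  have rank1: "is_rank1 ?R" "is_rank1 ?S" "is_rank1 ?W"
    using x y0 xy f0 by (simp_all add: is_rank1_rank1)
  obtain h where scale: "\<And>R a. is_rank1 R \<Longrightarrow> \<phi> (a *\<^sub>C R) = h a *\<^sub>C \<phi> R"
    and h_pair: "\<And>R A. is_rank1 R \<Longrightarrow> A \<in> \<A> \<Longrightarrow> pair (\<phi> R) (\<phi> A) = h (pair R A)"
    and h_mult: "\<And>a b. h (a * b) = h a * h b" and h0: "h 0 = 0" and h1: "h 1 = 1" and h_bij: "bij h"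
    using scaling_function[OF rank1(1)] by metis
  have h_eq_0: "h a = 0 \<longleftrightarrow> a = 0" for a
    using h_bij h0 by (metis bij_pointE)
  have not_multiple: "\<phi> ?W \<noteq> b *\<^sub>C \<phi> V" if V: "is_rank1 V" "\<And>a. ?W \<noteq> a *\<^sub>C V" for b V
  proof
    assume eq: "\<phi> ?W = b *\<^sub>C \<phi> V"
    obtain a where "h a = b" using h_bij by (metis bij_pointE)
    then have "\<phi> ?W = \<phi> (a *\<^sub>C V)" using eq scale[OF V(1)] by simp
    then show False using V by (simp add: phi_inj A_closed)
  qed
  have "\<exists>a b. \<phi> ?W = a *\<^sub>C \<phi> ?R + b *\<^sub>C \<phi> ?S"
  proof (rule rank1_combination)
    show "is_rank1 (\<phi> ?R)" "is_rank1 (\<phi> ?S)" "is_rank1 (\<phi> ?W)"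
      using rank1 by (simp_all only: is_rank1_phi)
    show "pair (\<phi> ?W) Q = 0" if "is_rank1 Q" and orth: "pair (\<phi> ?R) Q = 0" "pair (\<phi> ?S) Q = 0" for Q
    proof -
      obtain Q' where Q': "is_rank1 Q'" "\<phi> Q' = Q" using rank1_preimage[OF \<open>is_rank1 Q\<close>] .
      then have eq: "pair (\<phi> V) Q = h (pair V Q')" if "is_rank1 V" for V
        using h_pair[OF that A_closed(6)[OF Q'(1)]] by simp
      show ?thesis
        using orth unfolding eq[OF rank1(1)] eq[OF rank1(2)] eq[OF rank1(3)] h_eq_0
        using x y0 xy f0 by (simp add: pair_rank1)
    qed
    show "\<phi> ?W \<noteq> a *\<^sub>C \<phi> ?R" for a
    proof (rule not_multiple[OF rank1(1)])
      fix b show "?W \<noteq> b *\<^sub>C ?R"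
      proof
        assume "?W = b *\<^sub>C ?R"
        then have "rank1 (x + y) f = rank1 (b *\<^sub>C x) f" by simp
        then have "y = (b - 1) *\<^sub>C x"
          using f0 by (simp add: rank1_right_cancel complex_vector.scale_left_diff_distrib algebra_simps
              del: rank1_simps)
        then show False using y by blast
      qed
    qed
    show "\<phi> ?W \<noteq> a *\<^sub>C \<phi> ?S" for a
    proof (rule not_multiple[OF rank1(2)])
      fix b show "?W \<noteq> b *\<^sub>C ?S"
      proof
        assume "?W = b *\<^sub>C ?S"
        then have "rank1 (x + y) f = rank1 (b *\<^sub>C y) f" by simp
        then have x_eq: "x = (b - 1) *\<^sub>C y"
          using f0 by (simp add: rank1_right_cancel complex_vector.scale_left_diff_distrib algebra_simps
              del: rank1_simps)
        then have "y = inverse (b - 1) *\<^sub>C x" using x by (auto simp: scaleC_scaleC)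
        then show False using y by blast
      qed
    qed
  qed
  then obtain a b where ab: "\<phi> ?W = a *\<^sub>C \<phi> ?R + b *\<^sub>C \<phi> ?S" by blast
  have comb: "h (s + t) = a * h s + b * h t" for s t
  proof (cases "s = 0 \<and> t = 0")
    case False
    obtain k :: "'a cdual" where k: "k x = s" "k y = t" using functional_with_values[OF y x] by metis
    then have "k \<noteq> 0" using False by auto
    then have Q: "is_rank1 (rank1 x k)" using x by (simp add: is_rank1_rank1)
    have eq: "pair (\<phi> (rank1 x k)) (\<phi> (rank1 v f)) = h (k v)" for v
      using h_pair[OF Q, of "rank1 v f"] x f \<open>k \<noteq> 0\<close> by (simp add: A_closed pair_rank1)
    have "h (s + t) = pair (\<phi> (rank1 x k)) (\<phi> ?W)" using k by (simp add: eq)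
    also have "\<dots> = a * h s + b * h t"
      using k eq[of x] eq[of y] by (simp add: ab pair_simps[OF is_rank1_phi[OF Q]])
    finally show ?thesis .
  qed (simp add: h0)
  have "a = 1" "b = 1" using comb[of 1 0] comb[of 0 1] h0 h1 by simp_all
  then have h_add: "h (s + t) = h s + h t" for s t using comb by simp
  have "ring_automorphism h" using h_bij h_mult h_add by (simp add: ring_automorphism_def)
  moreover have "\<phi> (A + B) = \<phi> A + \<phi> B" if AB: "A \<in> \<A>" "B \<in> \<A>" for A B
  proof (rule pair_separates)
    fix Q :: "'b \<Rightarrow>\<^sub>C\<^sub>L 'b" assume "is_rank1 Q"
    then obtain R where R: "is_rank1 R" "\<phi> R = Q" using rank1_preimage by metis
    have "pair Q (\<phi> (A + B)) = h (pair R A + pair R B)"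
      using h_pair[OF R(1), of "A + B"] R AB by (simp add: A_closed pair_simps)
    also have "\<dots> = pair Q (\<phi> A + \<phi> B)"
      using h_pair[OF R(1)] R AB \<open>is_rank1 Q\<close> by (simp add: h_add pair_simps)
    finally show "pair Q (\<phi> (A + B)) = pair Q (\<phi> A + \<phi> B)" .
  qed
  moreover have "\<phi> (a *\<^sub>C A) = h a *\<^sub>C \<phi> A" if A: "A \<in> \<A>" for a A
  proof (rule pair_separates)
    fix Q :: "'b \<Rightarrow>\<^sub>C\<^sub>L 'b" assume "is_rank1 Q"
    then obtain R where R: "is_rank1 R" "\<phi> R = Q" using rank1_preimage by metis
    have "pair Q (\<phi> (a *\<^sub>C A)) = h (a * pair R A)"
      using h_pair[OF R(1), of "a *\<^sub>C A"] R A by (simp add: A_closed pair_simps)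
    also have "\<dots> = pair Q (h a *\<^sub>C \<phi> A)"
      using h_pair[OF R(1)] R A \<open>is_rank1 Q\<close> by (simp add: h_mult pair_simps)
    finally show "pair Q (\<phi> (a *\<^sub>C A)) = pair Q (h a *\<^sub>C \<phi> A)" .
  qed
  ultimately show ?thesis using that h_pair by blast
qed

end

section \<open>Semilinear representation\<close>

definition semilinear_bij :: "(complex \<Rightarrow> complex) \<Rightarrow> ('a::complex_vector \<Rightarrow> 'b::complex_vector) \<Rightarrow> bool"
  where "semilinear_bij h T \<longleftrightarrow>
    bij T \<and> (\<forall>x y. T (x + y) = T x + T y) \<and> (\<forall>a x. T (a *\<^sub>C x) = h a *\<^sub>C T x)"

lemma semilinear_bijI:
  assumes "ring_automorphism h"
    and add: "\<And>x y. T (x + y) = T x + T y" and scale: "\<And>a x. T (a *\<^sub>C x) = h a *\<^sub>C T x"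
    and ker: "\<And>x. T x = 0 \<Longrightarrow> x = 0" and onto: "\<And>y. \<exists>a x. y = a *\<^sub>C T x"
  shows "semilinear_bij h T"
proof -
  have "x = y" if "T x = T y" for x y
    using ker[of "x - y"] add[of "x - y" y] that by simp
  moreover have "\<exists>x. y = T x" for y
  proof -
    obtain a x where y: "y = a *\<^sub>C T x" using onto by blast
    obtain b where "h b = a" using ring_automorphismD(8)[OF assms(1)] by (metis bij_pointE)
    then have "y = T (b *\<^sub>C x)" using y scale by simp
    then show ?thesis ..
  qed
  ultimately have "bij T" unfolding bij_def inj_def surj_def by blast
  then show ?thesis using add scale by (simp add: semilinear_bij_def)
qed

text \<open>A group is not the union of two proper subgroups.\<close>

lemma additive_dichotomy:
  assumes add: "\<And>x y. F (x + y) = F x + (F y :: 'b::ab_group_add)"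
    and P: "\<And>u v. u \<in> P \<Longrightarrow> v \<in> P \<Longrightarrow> u - v \<in> P" and Q: "\<And>u v. u \<in> Q \<Longrightarrow> v \<in> Q \<Longrightarrow> u - v \<in> Q"
    and PQ: "\<And>x. F x \<in> P \<or> F x \<in> Q"
  shows "(\<forall>x. F x \<in> P) \<or> (\<forall>x. F x \<in> Q)"
proof (rule ccontr)
  assume "\<not> ?thesis"
  then obtain x y where xy: "F x \<notin> P" "F y \<notin> Q" by blast
  then have "F x \<in> Q" "F y \<in> P" using PQ by blast+
  from PQ[of "x + y"] show False
  proof
    assume "F (x + y) \<in> P"
    then have "F (x + y) - F y \<in> P" using P \<open>F y \<in> P\<close> by blast
    then show False using xy(1) by (simp add: add)
  next
    assume "F (x + y) \<in> Q"
    then have "F (x + y) - F x \<in> Q" using Q \<open>F x \<in> Q\<close> by blast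
    then show False using xy(2) by (simp add: add)
  qed
qed

text \<open>The projection \<open>x0 \<otimes> f0\<close> goes to a projection \<open>u0 \<otimes> g0\<close>; this holds after division by a sign. The vector
\<open>x1\<close> witnesses that the space has dimension at least two, which separates the two possible forms of
the map.\<close>

locale normalized_jordan_iso = jordan_triple_iso \<A> \<B> \<phi>
  for \<A> :: "('a::complex_normed_vector \<Rightarrow>\<^sub>C\<^sub>L 'a) set"
    and \<B> :: "('b::complex_normed_vector \<Rightarrow>\<^sub>C\<^sub>L 'b) set"
    and \<phi> :: "('a \<Rightarrow>\<^sub>C\<^sub>L 'a) \<Rightarrow> ('b \<Rightarrow>\<^sub>C\<^sub>L 'b)" +
  fixes h :: "complex \<Rightarrow> complex" and x0 :: 'a and f0 :: "'a cdual" and u0 :: 'b and g0 :: "'b cdual"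
    and x1 :: 'a
  assumes h: "ring_automorphism h"
    and h_pair: "is_rank1 R \<Longrightarrow> A \<in> \<A> \<Longrightarrow> pair (\<phi> R) (\<phi> A) = h (pair R A)"
    and phi_add: "A \<in> \<A> \<Longrightarrow> B \<in> \<A> \<Longrightarrow> \<phi> (A + B) = \<phi> A + \<phi> B"
    and phi_scale: "A \<in> \<A> \<Longrightarrow> \<phi> (a *\<^sub>C A) = h a *\<^sub>C \<phi> A"
    and f0_x0: "f0 x0 = 1" and g0_u0: "g0 u0 = 1"
    and phi_P: "\<phi> (rank1 x0 f0) = rank1 u0 g0"
    and x1: "x1 \<noteq> 0" "f0 x1 = 0"
begin

lemmas h_simps [simp] = ring_automorphismD(1-7)[OF h]

lemma base_vectors_nonzero [simp]: "x0 \<noteq> 0" "f0 \<noteq> 0" "u0 \<noteq> 0" "g0 \<noteq> 0"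
  using f0_x0 g0_u0 by auto

lemma phi_polarized:
  assumes A: "A \<in> \<A>" and B: "B \<in> \<A>" and C: "C \<in> \<A>"
  shows "\<phi> (A o\<^sub>C\<^sub>L B o\<^sub>C\<^sub>L C + C o\<^sub>C\<^sub>L B o\<^sub>C\<^sub>L A)
    = \<phi> A o\<^sub>C\<^sub>L \<phi> B o\<^sub>C\<^sub>L \<phi> C + \<phi> C o\<^sub>C\<^sub>L \<phi> B o\<^sub>C\<^sub>L \<phi> A"
proof -
  have "\<phi> ((A o\<^sub>C\<^sub>L B o\<^sub>C\<^sub>L C + C o\<^sub>C\<^sub>L B o\<^sub>C\<^sub>L A) + (A o\<^sub>C\<^sub>L B o\<^sub>C\<^sub>L A + C o\<^sub>C\<^sub>L B o\<^sub>C\<^sub>L C))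
      = \<phi> ((A + C) o\<^sub>C\<^sub>L B o\<^sub>C\<^sub>L (A + C))"
    by (simp add: algebra_simps)
  also have "\<dots> = (\<phi> A + \<phi> C) o\<^sub>C\<^sub>L \<phi> B o\<^sub>C\<^sub>L (\<phi> A + \<phi> C)"
    using assms by (simp only: triple A_closed phi_add)
  finally show ?thesis
    using assms by (simp add: phi_add triple A_closed algebra_simps)
qed

text \<open>For an off-diagonal block \<open>R\<close> of the projection \<open>P = x0 \<otimes> f0\<close> one has \<open>R = RPP + PPR\<close>. So the
image \<open>u \<otimes> g\<close> of \<open>R\<close> equals \<open>g(u0) u \<otimes> g0 + g0(u) u0 \<otimes> g\<close>, and one of the two
coefficients vanishes because the diagonal block \<open>PRP\<close> does.\<close>

lemma phi_slice:
  assumes R: "is_rank1 R" and PRP: "rank1 x0 f0 o\<^sub>C\<^sub>L R o\<^sub>C\<^sub>L rank1 x0 f0 = 0"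
    and RP: "R o\<^sub>C\<^sub>L rank1 x0 f0 + rank1 x0 f0 o\<^sub>C\<^sub>L R = R"
  shows "\<phi> R \<in> range (\<lambda>u. rank1 u g0) \<or> \<phi> R \<in> range (rank1 u0)"
proof -
  obtain u g where ug: "u \<noteq> 0" "g \<noteq> 0" "\<phi> R = rank1 u g"
    using is_rank1_phi[OF R] by (rule is_rank1E)
  have RA: "R \<in> \<A>" by (rule A_closed(6)[OF R])
  have "0 = rank1 u0 g0 o\<^sub>C\<^sub>L \<phi> R o\<^sub>C\<^sub>L rank1 u0 g0"
    using triple[OF A_closed(5) RA, of x0 f0] by (simp only: PRP phi_P phi_0)
  then have zero: "g0 u = 0 \<or> g u0 = 0" using ug by auto
  have "R o\<^sub>C\<^sub>L rank1 x0 f0 o\<^sub>C\<^sub>L rank1 x0 f0 + rank1 x0 f0 o\<^sub>C\<^sub>L rank1 x0 f0 o\<^sub>C\<^sub>L R = R"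
    using RP by (simp add: f0_x0)
  then have "\<phi> R = \<phi> R o\<^sub>C\<^sub>L rank1 u0 g0 o\<^sub>C\<^sub>L rank1 u0 g0 + rank1 u0 g0 o\<^sub>C\<^sub>L rank1 u0 g0 o\<^sub>C\<^sub>L \<phi> R"
    using phi_polarized[OF RA A_closed(5) A_closed(5), of x0 f0 x0 f0] by (simp only: phi_P)
  also have "\<dots> = rank1 (g u0 *\<^sub>C u) g0 + rank1 u0 (g0 u *\<^sub>C g)"
    by (simp add: ug g0_u0)
  finally have split: "\<phi> R = rank1 (g u0 *\<^sub>C u) g0 + rank1 u0 (g0 u *\<^sub>C g)" .
  from zero show ?thesis
  proof
    assume "g0 u = 0"
    then have "\<phi> R = rank1 (g u0 *\<^sub>C u) g0" using split by simp
    then show ?thesis by blast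
  next
    assume "g u0 = 0"
    then have "\<phi> R = rank1 u0 (g0 u *\<^sub>C g)" using split by simp
    then show ?thesis by blast
  qed
qed

lemma range_rank1_diff:
  "A \<in> range (\<lambda>u. rank1 u g) \<Longrightarrow> B \<in> range (\<lambda>u. rank1 u g) \<Longrightarrow> A - B \<in> range (\<lambda>u. rank1 u g)"
  "A \<in> range (rank1 v) \<Longrightarrow> B \<in> range (rank1 v) \<Longrightarrow> A - B \<in> range (rank1 v)"
proof -
  have "rank1 x g - rank1 y g = rank1 (x - y) g" for x y
    by (rule cblinfun_eqI) (simp add: complex_vector.scale_right_diff_distrib)
  then show "A \<in> range (\<lambda>u. rank1 u g) \<Longrightarrow> B \<in> range (\<lambda>u. rank1 u g) \<Longrightarrow> A - B \<in> range (\<lambda>u. rank1 u g)"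
    by auto
  have "rank1 v f - rank1 v k = rank1 v (f - k)" for f k
    by (rule cblinfun_eqI) (simp add: complex_vector.scale_left_diff_distrib)
  then show "A \<in> range (rank1 v) \<Longrightarrow> B \<in> range (rank1 v) \<Longrightarrow> A - B \<in> range (rank1 v)"
    by auto
qed

lemma range_rank1_add:
  "A \<in> range (\<lambda>u. rank1 u g) \<Longrightarrow> \<exists>u. A + a *\<^sub>C rank1 v g = rank1 u g"
  "A \<in> range (rank1 v) \<Longrightarrow> \<exists>k. A + a *\<^sub>C rank1 v g = rank1 v k"
proof -
  have "rank1 u g + a *\<^sub>C rank1 v g = rank1 (u + a *\<^sub>C v) g" for u by (simp add: rank1_add)
  then show "A \<in> range (\<lambda>u. rank1 u g) \<Longrightarrow> \<exists>u. A + a *\<^sub>C rank1 v g = rank1 u g" by blast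
  have "rank1 v k + a *\<^sub>C rank1 v g = rank1 v (k + a *\<^sub>C g)" for k by (simp add: rank1_add)
  then show "A \<in> range (rank1 v) \<Longrightarrow> \<exists>k. A + a *\<^sub>C rank1 v g = rank1 v k" by blast
qed

lemma vector_slices:
  "(\<forall>x. \<exists>u. \<phi> (rank1 x f0) = rank1 u g0) \<or> (\<forall>x. \<exists>g. \<phi> (rank1 x f0) = rank1 u0 g)"
proof -
  define D where "D x = x - f0 x *\<^sub>C x0" for x
  have D: "f0 (D x) = 0" for x by (simp add: D_def f0_x0)
  have "(\<forall>x. \<phi> (rank1 (D x) f0) \<in> range (\<lambda>u. rank1 u g0)) \<or> (\<forall>x. \<phi> (rank1 (D x) f0) \<in> range (rank1 u0))"
  proof (rule additive_dichotomy)
    have "D (x + y) = D x + D y" for x y by (simp add: D_def scaleC_add_left)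
    then show "\<phi> (rank1 (D (x + y)) f0) = \<phi> (rank1 (D x) f0) + \<phi> (rank1 (D y) f0)" for x y
      by (simp add: rank1_add phi_add A_closed)
    show "\<phi> (rank1 (D x) f0) \<in> range (\<lambda>u. rank1 u g0) \<or> \<phi> (rank1 (D x) f0) \<in> range (rank1 u0)" for x
    proof (cases "D x = 0")
      case True
      then show ?thesis by (auto intro: range_eqI[of _ _ 0])
    next
      case False
      then show ?thesis by (intro phi_slice) (simp_all add: is_rank1_rank1 D f0_x0)
    qed
  qed (rule range_rank1_diff; assumption)+
  moreover have eq: "\<phi> (rank1 x f0) = \<phi> (rank1 (D x) f0) + h (f0 x) *\<^sub>C rank1 u0 g0" for x
  proof -
    have "rank1 x f0 = rank1 (D x + f0 x *\<^sub>C x0) f0" by (simp add: D_def del: rank1_simps)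
    also have "\<dots> = rank1 (D x) f0 + f0 x *\<^sub>C rank1 x0 f0" by (simp add: rank1_add)
    finally show ?thesis by (simp add: phi_add phi_scale phi_P A_closed)
  qed
  ultimately show ?thesis
  proof (elim disjE)
    assume *: "\<forall>x. \<phi> (rank1 (D x) f0) \<in> range (\<lambda>u. rank1 u g0)"
    have "\<exists>u. \<phi> (rank1 x f0) = rank1 u g0" for x
      unfolding eq[of x] using * by (intro range_rank1_add) blast
    then show ?thesis by blast
  next
    assume *: "\<forall>x. \<phi> (rank1 (D x) f0) \<in> range (rank1 u0)"
    have "\<exists>g. \<phi> (rank1 x f0) = rank1 u0 g" for x
      unfolding eq[of x] using * by (intro range_rank1_add) blast
    then show ?thesis by blast
  qed
qed

lemma functional_slices:
  "(\<forall>f. \<exists>u. \<phi> (rank1 x0 f) = rank1 u g0) \<or> (\<forall>f. \<exists>g. \<phi> (rank1 x0 f) = rank1 u0 g)"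
proof -
  define D where "D f = f - f x0 *\<^sub>C f0" for f :: "'a cdual"
  have D: "D f x0 = 0" for f by (simp add: D_def f0_x0)
  have "(\<forall>f. \<phi> (rank1 x0 (D f)) \<in> range (\<lambda>u. rank1 u g0)) \<or> (\<forall>f. \<phi> (rank1 x0 (D f)) \<in> range (rank1 u0))"
  proof (rule additive_dichotomy)
    have "D (f + g) = D f + D g" for f g by (simp add: D_def scaleC_add_left)
    then show "\<phi> (rank1 x0 (D (f + g))) = \<phi> (rank1 x0 (D f)) + \<phi> (rank1 x0 (D g))" for f g
      by (simp add: rank1_add phi_add A_closed)
    show "\<phi> (rank1 x0 (D f)) \<in> range (\<lambda>u. rank1 u g0) \<or> \<phi> (rank1 x0 (D f)) \<in> range (rank1 u0)" for f
    proof (cases "D f = 0")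
      case True
      then show ?thesis by (auto intro: range_eqI[of _ _ 0])
    next
      case False
      then show ?thesis by (intro phi_slice) (simp_all add: is_rank1_rank1 D f0_x0)
    qed
  qed (rule range_rank1_diff; assumption)+
  moreover have eq: "\<phi> (rank1 x0 f) = \<phi> (rank1 x0 (D f)) + h (f x0) *\<^sub>C rank1 u0 g0" for f
  proof -
    have "rank1 x0 f = rank1 x0 (D f + f x0 *\<^sub>C f0)" by (simp add: D_def del: rank1_simps)
    also have "\<dots> = rank1 x0 (D f) + f x0 *\<^sub>C rank1 x0 f0" by (simp add: rank1_add)
    finally show ?thesis by (simp add: phi_add phi_scale phi_P A_closed)
  qed
  ultimately show ?thesis
  proof (elim disjE)
    assume *: "\<forall>f. \<phi> (rank1 x0 (D f)) \<in> range (\<lambda>u. rank1 u g0)"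
    have "\<exists>u. \<phi> (rank1 x0 f) = rank1 u g0" for f
      unfolding eq[of f] using * by (intro range_rank1_add) blast
    then show ?thesis by blast
  next
    assume *: "\<forall>f. \<phi> (rank1 x0 (D f)) \<in> range (rank1 u0)"
    have "\<exists>g. \<phi> (rank1 x0 f) = rank1 u0 g" for f
      unfolding eq[of f] using * by (intro range_rank1_add) blast
    then show ?thesis by blast
  qed
qed

text \<open>If both slices through the projection were mapped to operators with the same functional, or with the
same range, then \<open>x1 \<otimes> f0\<close> and \<open>x0 \<otimes> k\<close> would have images with pairing \<open>0\<close>, although their own
pairing is \<open>1\<close>.\<close>

lemma slice_types:
  "(\<forall>x. \<exists>u. \<phi> (rank1 x f0) = rank1 u g0) \<and> (\<forall>f. \<exists>g. \<phi> (rank1 x0 f) = rank1 u0 g) \<or>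
   (\<forall>x. \<exists>g. \<phi> (rank1 x f0) = rank1 u0 g) \<and> (\<forall>f. \<exists>u. \<phi> (rank1 x0 f) = rank1 u g0)"
proof -
  obtain k :: "'a cdual" where k: "k x0 = 0" "k x1 = 1"
  proof (rule functional_with_values[of x1 x0])
    show "x1 \<noteq> a *\<^sub>C x0" for a using x1 f0_x0 by auto
  qed simp
  then have k0: "k \<noteq> 0" by auto
  have P: "is_rank1 (rank1 x0 f0)" by (simp add: is_rank1_rank1)
  have R1: "is_rank1 (rank1 x1 f0)" and R2: "is_rank1 (rank1 x0 k)"
    using x1 k0 by (simp_all add: is_rank1_rank1)
  have "pair (rank1 u0 g0) (\<phi> (rank1 x1 f0)) = 0"
    using h_pair[OF P, of "rank1 x1 f0"] x1 by (simp add: phi_P pair_rank1 A_closed)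
  then have z1: "g0 (\<phi> (rank1 x1 f0) u0) = 0" by (simp add: pair_rank1)
  have "pair (rank1 u0 g0) (\<phi> (rank1 x0 k)) = 0"
    using h_pair[OF P, of "rank1 x0 k"] k by (simp add: phi_P pair_rank1 A_closed)
  then have z2: "g0 (\<phi> (rank1 x0 k) u0) = 0" by (simp add: pair_rank1)
  have one: "pair (\<phi> (rank1 x1 f0)) (\<phi> (rank1 x0 k)) = 1"
    using h_pair[OF R1, of "rank1 x0 k"] k x1 by (simp add: pair_rank1 A_closed f0_x0)
  have "\<not> (\<phi> (rank1 x1 f0) = rank1 u g0 \<and> \<phi> (rank1 x0 k) = rank1 v g0)" for u v
    using z1 z2 one is_rank1_phi[OF R1] by (auto simp: pair_rank1 is_rank1_rank1 g0_u0)
  moreover have "\<not> (\<phi> (rank1 x1 f0) = rank1 u0 g \<and> \<phi> (rank1 x0 k) = rank1 u0 g')" for g g'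
    using z1 z2 one is_rank1_phi[OF R1] by (auto simp: pair_rank1 is_rank1_rank1 g0_u0)
  ultimately show ?thesis using vector_slices functional_slices by metis
qed

text \<open>A slice is a linear family \<open>F\<close> of operators all of whose images share the functional \<open>g0\<close>; in the
dual version below the images share the range.\<close>

lemma left_slice_bij:
  fixes F :: "'v::complex_vector \<Rightarrow> 'a \<Rightarrow>\<^sub>C\<^sub>L 'a"
  assumes F: "\<And>v. F v \<in> \<A>" "\<And>v w. F (v + w) = F v + F w" "\<And>a v. F (a *\<^sub>C v) = a *\<^sub>C F v"
      "\<And>v. F v = 0 \<Longrightarrow> v = 0"
    and T: "\<And>v. \<phi> (F v) = rank1 (T v) g0"
    and onto: "\<And>R. is_rank1 R \<Longrightarrow> \<exists>v g. \<phi> R = rank1 (T v) g"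
  shows "semilinear_bij h T"
proof (rule semilinear_bijI[OF h])
  show add: "T (v + w) = T v + T w" for v w
  proof -
    have "rank1 (T (v + w)) g0 = rank1 (T v + T w) g0"
      by (simp add: rank1_add phi_add F flip: T)
    then show ?thesis by (simp add: rank1_right_cancel)
  qed
  show "T (a *\<^sub>C v) = h a *\<^sub>C T v" for a v
  proof -
    have "rank1 (T (a *\<^sub>C v)) g0 = rank1 (h a *\<^sub>C T v) g0"
      by (simp add: phi_scale F flip: T)
    then show ?thesis by (simp add: rank1_right_cancel del: rank1_simps)
  qed
  show "v = 0" if "T v = 0" for v
    using phi_eq_0_iff[OF F(1), of v] F(4)[of v] that by (simp add: T)
  show "\<exists>a v. y = a *\<^sub>C T v" for y
  proof (cases "y = 0")
    case True
    then show ?thesis by (intro exI[of _ 0]) simp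
  next
    case False
    then have "is_rank1 (rank1 y g0)" by (simp add: is_rank1_rank1)
    then obtain v g where "rank1 y g0 = rank1 (T v) g" using rank1_preimage onto by metis
    from arg_cong[OF this, of "\<lambda>A. A u0"] show ?thesis by (auto simp: g0_u0)
  qed
qed

lemma right_slice_bij:
  fixes F :: "'v::complex_vector \<Rightarrow> 'a \<Rightarrow>\<^sub>C\<^sub>L 'a"
  assumes F: "\<And>v. F v \<in> \<A>" "\<And>v w. F (v + w) = F v + F w" "\<And>a v. F (a *\<^sub>C v) = a *\<^sub>C F v"
      "\<And>v. F v = 0 \<Longrightarrow> v = 0"
    and S: "\<And>v. \<phi> (F v) = rank1 u0 (S v)"
    and onto: "\<And>R. is_rank1 R \<Longrightarrow> \<exists>u v. \<phi> R = rank1 u (S v)"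
  shows "semilinear_bij h S"
proof (rule semilinear_bijI[OF h])
  show "S (v + w) = S v + S w" for v w
  proof -
    have "rank1 u0 (S (v + w)) = rank1 u0 (S v + S w)"
      by (simp add: rank1_add phi_add F flip: S)
    then show ?thesis by (simp add: rank1_left_cancel)
  qed
  show "S (a *\<^sub>C v) = h a *\<^sub>C S v" for a v
  proof -
    have "rank1 u0 (S (a *\<^sub>C v)) = rank1 u0 (h a *\<^sub>C S v)"
      by (simp add: phi_scale F flip: S)
    then show ?thesis by (simp add: rank1_left_cancel del: rank1_simps)
  qed
  show "v = 0" if "S v = 0" for v
    using phi_eq_0_iff[OF F(1), of v] F(4)[of v] that by (simp add: S)
  show "\<exists>a v. g = a *\<^sub>C S v" for g
  proof (cases "g = 0")
    case True
    then show ?thesis by (intro exI[of _ 0]) simp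
  next
    case False
    then have "is_rank1 (rank1 u0 g)" by (simp add: is_rank1_rank1)
    then obtain u v where "rank1 u0 g = rank1 u (S v)" using rank1_preimage onto by metis
    from arg_cong[OF this, of "\<lambda>A. g0 o\<^sub>C\<^sub>L A"] show ?thesis by (auto simp: g0_u0)
  qed
qed

lemma eq_if_functionals_eq:
  assumes "semilinear_bij h (S :: 'v::complex_vector \<Rightarrow> 'b cdual)" "\<And>v. S v y = S v z"
  shows "y = z"
proof (rule ccontr)
  assume "y \<noteq> z"
  then have "y - z \<noteq> 0" by simp
  then obtain g :: "'b cdual" where "g (y - z) = 1" by (rule separating_functional)
  moreover obtain v where "g = S v"
    using assms(1) unfolding semilinear_bij_def by (metis bij_pointE)
  ultimately show False using assms(2)[of v] by simp
qed

lemma phi_pair_rank1: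
  fixes f :: "'a cdual"
  assumes "\<And>x f. \<phi> (rank1 x f) = rank1 (u x f) (g x f)" "A \<in> \<A>" "x \<noteq> 0" "f \<noteq> 0"
  shows "g x f (\<phi> A (u x f)) = h (f (A x))"
proof -
  have R: "is_rank1 (rank1 x f)" using assms by (simp add: is_rank1_rank1)
  show ?thesis
    using h_pair[OF R assms(2)] is_rank1_phi[OF R] assms
    by (auto simp: is_rank1_rank1 pair_rank1)
qed

text \<open>Polarizing the triple product reconstructs \<open>x \<otimes> f\<close> from the two slices, up to a multiple of
the projection, and yields \<open>\<phi>(x \<otimes> f) = T x \<otimes> S f\<close>. Comparing pairings then determines the image
of every operator.\<close>

lemma direct_form:
  assumes vec: "\<forall>x. \<exists>u. \<phi> (rank1 x f0) = rank1 u g0"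
    and func: "\<forall>f. \<exists>g. \<phi> (rank1 x0 f) = rank1 u0 g"
  obtains T S where "semilinear_bij h T" "semilinear_bij h S"
    "\<And>f x. cblinfun_apply (S f) (T x) = h (cblinfun_apply f x)" "\<And>A x. A \<in> \<A> \<Longrightarrow> \<phi> A (T x) = T (A x)"
proof -
  obtain T where T: "\<And>x. \<phi> (rank1 x f0) = rank1 (T x) g0" using vec by metis
  obtain S where S: "\<And>f. \<phi> (rank1 x0 f) = rank1 u0 (S f)" using func by metis
  have T0: "T x = 0 \<longleftrightarrow> x = 0" for x
    using phi_eq_0_iff[OF A_closed(5), of x f0] by (simp add: T)
  have S0: "S f = 0 \<longleftrightarrow> f = 0" for f
    using phi_eq_0_iff[OF A_closed(5), of x0 f] by (simp add: S)
  have x0: "T x0 = u0" using T[of x0] by (simp add: phi_P rank1_right_cancel)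
  have f0: "S f0 = g0" using S[of f0] by (simp add: phi_P rank1_left_cancel)
  have ST: "S f (T x) = h (f x)" for f x
  proof (cases "x = 0 \<or> f = 0")
    case True
    then have "T x = 0 \<or> S f = 0" using T0 S0 by blast
    then show ?thesis using True by auto
  next
    case False
    then have "is_rank1 (rank1 x f0)" by (simp add: is_rank1_rank1)
    from h_pair[OF this A_closed(5), of x0 f] False show ?thesis
      using T0[of x] by (simp add: T S pair_rank1 f0_x0 g0_u0)
  qed
  have TS: "\<phi> (rank1 x f) = rank1 (T x) (S f)" for x f
  proof -
    have "rank1 x f0 o\<^sub>C\<^sub>L rank1 x0 f0 o\<^sub>C\<^sub>L rank1 x0 f + rank1 x0 f o\<^sub>C\<^sub>L rank1 x0 f0 o\<^sub>C\<^sub>L rank1 x f0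
        = rank1 x f + (f x0 * f0 x) *\<^sub>C rank1 x0 f0"
      by (simp add: f0_x0 scaleC_scaleC mult.commute)
    then have "\<phi> (rank1 x f + (f x0 * f0 x) *\<^sub>C rank1 x0 f0)
        = rank1 (T x) g0 o\<^sub>C\<^sub>L rank1 u0 g0 o\<^sub>C\<^sub>L rank1 u0 (S f) + rank1 u0 (S f) o\<^sub>C\<^sub>L rank1 u0 g0 o\<^sub>C\<^sub>L rank1 (T x) g0"
      using phi_polarized[of "rank1 x f0" "rank1 x0 f0" "rank1 x0 f"]
      by (simp only: A_closed T[of x] S[of f] phi_P)
    also have "\<dots> = rank1 (T x) (S f) + h (f x0 * f0 x) *\<^sub>C rank1 u0 g0"
      using ST[of f x0] ST[of f0 x] by (simp add: x0 f0 g0_u0 scaleC_scaleC mult.commute)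
    finally show ?thesis by (simp add: phi_add phi_scale phi_P A_closed)
  qed
  have onto: "\<exists>x f. \<phi> R = rank1 (T x) (S f)" if "is_rank1 R" for R
    using that TS by (metis is_rank1E)
  have T_bij: "semilinear_bij h T"
  proof (rule left_slice_bij[of "\<lambda>x. rank1 x f0", OF _ _ _ _ T])
    show "\<exists>v g. \<phi> R = rank1 (T v) g" if "is_rank1 R" for R using onto[OF that] by blast
  qed (simp_all add: A_closed rank1_add)
  have S_bij: "semilinear_bij h S"
  proof (rule right_slice_bij[of "\<lambda>f. rank1 x0 f", OF _ _ _ _ S])
    show "\<exists>u v. \<phi> R = rank1 u (S v)" if "is_rank1 R" for R using onto[OF that] by blast
  qed (simp_all add: A_closed rank1_add)
  have "\<phi> A (T x) = T (A x)" if A: "A \<in> \<A>" for A x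
  proof (rule eq_if_functionals_eq[OF S_bij])
    show "S f (\<phi> A (T x)) = S f (T (A x))" for f
    proof (cases "x = 0 \<or> f = 0")
      case True
      then have "T x = 0 \<or> S f = 0" using T0 S0 by blast
      then show ?thesis using ST[of f "A x"] True by auto
    next
      case False
      then show ?thesis
        using phi_pair_rank1[of "\<lambda>x f. T x" "\<lambda>x f. S f", OF TS A] ST by auto
    qed
  qed
  then show ?thesis using that T_bij S_bij ST by blast
qed

text \<open>The same argument with the two slices exchanged, which leads to \<open>\<phi>(x \<otimes> f) = T f \<otimes> S x\<close>.\<close>

lemma transposed_form:
  assumes vec: "\<forall>x. \<exists>g. \<phi> (rank1 x f0) = rank1 u0 g"
    and func: "\<forall>f. \<exists>u. \<phi> (rank1 x0 f) = rank1 u g0"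
  obtains T S where "semilinear_bij h T" "semilinear_bij h S"
    "\<And>f x. cblinfun_apply (S x) (T f) = h (cblinfun_apply f x)"
    "\<And>A f. A \<in> \<A> \<Longrightarrow> \<phi> A (T f) = T (f o\<^sub>C\<^sub>L A)"
proof -
  obtain T where T: "\<And>f. \<phi> (rank1 x0 f) = rank1 (T f) g0" using func by metis
  obtain S where S: "\<And>x. \<phi> (rank1 x f0) = rank1 u0 (S x)" using vec by metis
  have T0: "T f = 0 \<longleftrightarrow> f = 0" for f
    using phi_eq_0_iff[OF A_closed(5), of x0 f] by (simp add: T)
  have S0: "S x = 0 \<longleftrightarrow> x = 0" for x
    using phi_eq_0_iff[OF A_closed(5), of x f0] by (simp add: S)
  have f0: "T f0 = u0" using T[of f0] by (simp add: phi_P rank1_right_cancel)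
  have x0: "S x0 = g0" using S[of x0] by (simp add: phi_P rank1_left_cancel)
  have ST: "S x (T f) = h (f x)" for f x
  proof (cases "x = 0 \<or> f = 0")
    case True
    then have "T f = 0 \<or> S x = 0" using T0 S0 by blast
    then show ?thesis using True by auto
  next
    case False
    then have "is_rank1 (rank1 x f0)" by (simp add: is_rank1_rank1)
    from h_pair[OF this A_closed(5), of x0 f] False show ?thesis
      using S0[of x] by (simp add: T S pair_rank1 f0_x0 g0_u0)
  qed
  have TS: "\<phi> (rank1 x f) = rank1 (T f) (S x)" for x f
  proof -
    have "rank1 x f0 o\<^sub>C\<^sub>L rank1 x0 f0 o\<^sub>C\<^sub>L rank1 x0 f + rank1 x0 f o\<^sub>C\<^sub>L rank1 x0 f0 o\<^sub>C\<^sub>L rank1 x f0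
        = rank1 x f + (f x0 * f0 x) *\<^sub>C rank1 x0 f0"
      by (simp add: f0_x0 scaleC_scaleC mult.commute)
    then have "\<phi> (rank1 x f + (f x0 * f0 x) *\<^sub>C rank1 x0 f0)
        = rank1 u0 (S x) o\<^sub>C\<^sub>L rank1 u0 g0 o\<^sub>C\<^sub>L rank1 (T f) g0 + rank1 (T f) g0 o\<^sub>C\<^sub>L rank1 u0 g0 o\<^sub>C\<^sub>L rank1 u0 (S x)"
      using phi_polarized[of "rank1 x f0" "rank1 x0 f0" "rank1 x0 f"]
      by (simp only: A_closed T[of f] S[of x] phi_P)
    also have "\<dots> = rank1 (T f) (S x) + h (f x0 * f0 x) *\<^sub>C rank1 u0 g0"
      using ST[of x0 f] ST[of x f0] by (simp add: x0 f0 g0_u0 scaleC_scaleC mult.commute)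
    finally show ?thesis by (simp add: phi_add phi_scale phi_P A_closed)
  qed
  have onto: "\<exists>x f. \<phi> R = rank1 (T f) (S x)" if "is_rank1 R" for R
    using that TS by (metis is_rank1E)
  have T_bij: "semilinear_bij h T"
  proof (rule left_slice_bij[of "\<lambda>f. rank1 x0 f", OF _ _ _ _ T])
    show "\<exists>v g. \<phi> R = rank1 (T v) g" if "is_rank1 R" for R using onto[OF that] by blast
  qed (simp_all add: A_closed rank1_add)
  have S_bij: "semilinear_bij h S"
  proof (rule right_slice_bij[of "\<lambda>x. rank1 x f0", OF _ _ _ _ S])
    show "\<exists>u v. \<phi> R = rank1 u (S v)" if "is_rank1 R" for R using onto[OF that] by blast
  qed (simp_all add: A_closed rank1_add)
  have "\<phi> A (T f) = T (f o\<^sub>C\<^sub>L A)" if A: "A \<in> \<A>" for A f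
  proof (rule eq_if_functionals_eq[OF S_bij])
    show "S x (\<phi> A (T f)) = S x (T (f o\<^sub>C\<^sub>L A))" for x
    proof (cases "x = 0 \<or> f = 0")
      case True
      then have "T f = 0 \<or> S x = 0" using T0 S0 by blast
      then show ?thesis using ST[of x "f o\<^sub>C\<^sub>L A"] True by auto
    next
      case False
      then show ?thesis
        using phi_pair_rank1[of "\<lambda>x f. T f" "\<lambda>x f. S x", OF TS A] ST by auto
    qed
  qed
  then show ?thesis using that T_bij S_bij ST by blast
qed

end

text \<open>The image \<open>u0 \<otimes> g\<close> of a projection of rank one satisfies \<open>g(u0)\<^sup>2 = 1\<close>; the sign \<open>c = g(u0)\<close> is divided
out before the normalized case is applied.\<close>

lemma (in jordan_triple_iso) two_forms:
  assumes two_dim: "\<And>x :: 'a. \<exists>y. \<forall>a. y \<noteq> a *\<^sub>C x"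
  obtains (direct) c h T S where "c \<in> {-1, 1}" "ring_automorphism h" "semilinear_bij h T"
      "semilinear_bij h S" "\<And>f x. cblinfun_apply (S f) (T x) = h (cblinfun_apply f x)"
      "\<And>A x. A \<in> \<A> \<Longrightarrow> \<phi> A (T x) = c *\<^sub>C T (A x)"
  | (transposed) c h T S where "c \<in> {-1, 1}" "ring_automorphism h" "semilinear_bij h T"
      "semilinear_bij h S" "\<And>f x. cblinfun_apply (S x) (T f) = h (cblinfun_apply f x)"
      "\<And>A f. A \<in> \<A> \<Longrightarrow> \<phi> A (T f) = c *\<^sub>C T (f o\<^sub>C\<^sub>L A)"
proof -
  obtain x0 :: 'a where "\<forall>a. x0 \<noteq> a *\<^sub>C 0" using two_dim by blast
  then have x0: "x0 \<noteq> 0" by simp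
  then obtain f0 :: "'a cdual" where f0_x0: "f0 x0 = 1" by (rule separating_functional)
  then have f0: "f0 \<noteq> 0" by auto
  obtain y where y: "\<And>a. y \<noteq> a *\<^sub>C x0" using two_dim by blast
  define x1 where "x1 = y - f0 y *\<^sub>C x0"
  have x1: "x1 \<noteq> 0" "f0 x1 = 0" using y f0_x0 by (simp_all add: x1_def)
  have P: "is_rank1 (rank1 x0 f0)" using x0 f0 by (simp add: is_rank1_rank1)
  obtain u0 g where ug: "u0 \<noteq> 0" "g \<noteq> 0" "\<phi> (rank1 x0 f0) = rank1 u0 g"
    using is_rank1_phi[OF P] by (rule is_rank1E)
  define c where "c = g u0"
  have "rank1 u0 g o\<^sub>C\<^sub>L rank1 u0 g o\<^sub>C\<^sub>L rank1 u0 g = rank1 u0 g"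
    using triple[OF A_closed(5) A_closed(5), of x0 f0 x0 f0] ug(3) by (simp add: f0_x0)
  then have "(c * c) *\<^sub>C rank1 u0 g = 1 *\<^sub>C rank1 u0 g" by (simp add: c_def scaleC_scaleC)
  then have cc: "c * c = 1" using ug by (simp only: complex_vector.scale_cancel_right) simp
  then have c: "c \<in> {-1, 1}" using square_eq_1_iff[of c] by auto
  define \<psi> where "\<psi> A = c *\<^sub>C \<phi> A" for A
  interpret psi: jordan_triple_iso \<A> \<B> \<psi>
  proof
    show "bij_betw \<psi> \<A> \<B>"
    proof (rule bij_betw_trans[OF bij, of "\<lambda>B. c *\<^sub>C B" \<B>, unfolded o_def, folded \<psi>_def])
      show "bij_betw (\<lambda>B. c *\<^sub>C B) \<B> \<B>"
        by (rule bij_betwI[where g = "\<lambda>B. c *\<^sub>C B"]) (auto simp: B_closed cc)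
    qed
    show "\<psi> (A o\<^sub>C\<^sub>L B o\<^sub>C\<^sub>L A) = \<psi> A o\<^sub>C\<^sub>L \<psi> B o\<^sub>C\<^sub>L \<psi> A" if "A \<in> \<A>" "B \<in> \<A>" for A B
      using that by (simp add: \<psi>_def triple cc)
  qed (fact std_A std_B)+
  obtain h where h: "ring_automorphism h"
    "\<And>R A. is_rank1 R \<Longrightarrow> A \<in> \<A> \<Longrightarrow> pair (\<psi> R) (\<psi> A) = h (pair R A)"
    "\<And>A B. A \<in> \<A> \<Longrightarrow> B \<in> \<A> \<Longrightarrow> \<psi> (A + B) = \<psi> A + \<psi> B"
    "\<And>a A. A \<in> \<A> \<Longrightarrow> \<psi> (a *\<^sub>C A) = h a *\<^sub>C \<psi> A"
    using psi.phi_semilinear[OF two_dim] by metis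
  interpret psi: normalized_jordan_iso \<A> \<B> \<psi> h x0 f0 u0 "c *\<^sub>C g" x1
    by unfold_locales (use h f0_x0 x1 cc ug in \<open>simp_all add: \<psi>_def c_def\<close>)
  have phi: "\<phi> A v = c *\<^sub>C \<psi> A v" for A v by (simp add: \<psi>_def cc)
  from psi.slice_types show ?thesis
  proof
    assume "(\<forall>x. \<exists>u. \<psi> (rank1 x f0) = rank1 u (c *\<^sub>C g)) \<and> (\<forall>f. \<exists>g. \<psi> (rank1 x0 f) = rank1 u0 g)"
    then obtain T S where "semilinear_bij h T" "semilinear_bij h S"
      "\<And>f x. cblinfun_apply (S f) (T x) = h (cblinfun_apply f x)"
      "\<And>A x. A \<in> \<A> \<Longrightarrow> \<psi> A (T x) = T (A x)"
      using psi.direct_form by metis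
    then show ?thesis by (intro direct[of c h T S] c h(1)) (simp_all add: phi)
  next
    assume "(\<forall>x. \<exists>g. \<psi> (rank1 x f0) = rank1 u0 g) \<and> (\<forall>f. \<exists>u. \<psi> (rank1 x0 f) = rank1 u (c *\<^sub>C g))"
    then obtain T S where "semilinear_bij h T" "semilinear_bij h S"
      "\<And>f x. cblinfun_apply (S x) (T f) = h (cblinfun_apply f x)"
      "\<And>A f. A \<in> \<A> \<Longrightarrow> \<psi> A (T f) = T (f o\<^sub>C\<^sub>L A)"
      using psi.transposed_form by metis
    then show ?thesis by (intro transposed[of c h T S] c h(1)) (simp_all add: phi)
  qed
qed

section \<open>Infinite dimension: automatic continuity\<close>

text \<open>The common kernel of finitely many functionals has finite codimension.\<close>

lemma common_kernel_complement:
  assumes "finite (F :: 'a::complex_normed_vector cdual set)"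
  shows "\<exists>B. finite B \<and> (\<forall>x. \<exists>b\<in>cspan B. \<forall>f\<in>F. f (x - b) = 0)"
  using assms
proof induction
  case empty
  show ?case by (intro exI[of _ "{}"]) simp
next
  case (insert g F)
  then obtain B where B: "finite B" "\<And>x. \<exists>b\<in>cspan B. \<forall>f\<in>F. f (x - b) = 0" by blast
  show ?case
  proof (cases "\<exists>e. (\<forall>f\<in>F. f e = 0) \<and> g e = 1")
    case True
    then obtain e where e: "\<forall>f\<in>F. f e = 0" "g e = 1" by blast
    have "\<exists>b\<in>cspan (insert e B). \<forall>f\<in>insert g F. f (x - b) = 0" for x
    proof -
      obtain b where b: "b \<in> cspan B" "\<forall>f\<in>F. f (x - b) = 0" using B(2) by blast
      let ?b = "b + g (x - b) *\<^sub>C e"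
      have "?b \<in> cspan (insert e B)"
        using b(1) complex_vector.span_mono[of B "insert e B"]
        by (intro complex_vector.span_add complex_vector.span_scale)
          (auto intro: complex_vector.span_base)
      moreover have "f (x - ?b) = 0" if "f \<in> insert g F" for f
        using b(2) e that by (auto simp: algebra_simps)
      ultimately show ?thesis by blast
    qed
    with B(1) show ?thesis by blast
  next
    case False
    have "g e = 0" if "\<forall>f\<in>F. f e = 0" for e
    proof (rule ccontr)
      assume "g e \<noteq> 0"
      then have "(\<forall>f\<in>F. f (inverse (g e) *\<^sub>C e) = 0) \<and> g (inverse (g e) *\<^sub>C e) = 1"
        using that by simp
      then show False using False by blast
    qed
    then have "\<exists>b\<in>cspan B. \<forall>f\<in>insert g F. f (x - b) = 0" for x
      using B(2)[of x] by blast
    with B(1) show ?thesis by blast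
  qed
qed

lemma common_kernel_nontrivial:
  fixes F :: "'a::complex_normed_vector cdual set"
  assumes "\<not> cfinite_dim (UNIV :: 'a set)" "finite F"
  obtains x and f :: "'a cdual" where "\<And>g. g \<in> F \<Longrightarrow> g x = 0" "f x = 1"
proof -
  obtain B :: "'a set" where B: "finite B" "\<And>x. \<exists>b\<in>cspan B. \<forall>f\<in>F. f (x - b) = 0"
    using common_kernel_complement[OF assms(2)] by blast
  have "cspan B \<noteq> UNIV" using assms(1) B(1) by (auto simp: cfinite_dim_def)
  then obtain y where y: "y \<notin> cspan B" by blast
  obtain b where b: "b \<in> cspan B" "\<forall>f\<in>F. f (y - b) = 0" using B(2) by blast
  have "y \<noteq> b" using y b(1) by blast
  then have "y - b \<noteq> 0" by simp
  then obtain f :: "'a cdual" where "f (y - b) = 1" by (rule separating_functional)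
  with b(2) show ?thesis by (intro that[of "y - b" f]) simp_all
qed

text \<open>In infinite dimension there are vectors and functionals with \<open>f n (x n) = 1\<close> and \<open>f n (x m) = 0\<close> for
\<open>m > n\<close>. If \<open>h\<close> were unbounded near \<open>0\<close>, a rapidly convergent series of multiples of the \<open>x n\<close>
could be chosen so that \<open>h\<close> of the value of \<open>f n\<close> at the sum, which depends only on the first
\<open>n + 1\<close> terms, exceeds \<open>n * M (f n)\<close> for every \<open>n\<close>. That contradicts the bound by \<open>N\<close> and \<open>M\<close>. In the
applications \<open>N\<close> and \<open>M\<close> are norms of the images of \<open>x\<close> and \<open>f\<close>.\<close>

lemma bounded_near_zero:
  fixes h :: "complex \<Rightarrow> complex" and N :: "'a::cbanach \<Rightarrow> real" and M :: "'a cdual \<Rightarrow> real"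
  assumes inf: "\<not> cfinite_dim (UNIV :: 'a set)" and h_add: "\<And>a b. h (a + b) = h a + h b"
    and M: "\<And>f. M f \<ge> 0" and le: "\<And>f x. cmod (h (cblinfun_apply f x)) \<le> N x * M f"
  obtains d K where "d > 0" "\<And>a. cmod a < d \<Longrightarrow> cmod (h a) \<le> K"
proof (rule ccontr)
  assume neg: "\<not> thesis"
  note witness = that
  have large: "\<exists>a. cmod a < d \<and> cmod (h a) > K" if "d > 0" for d K
  proof (rule ccontr)
    assume "\<not> ?thesis"
    then have "cmod (h a) \<le> K" if "cmod a < d" for a using that by force
    then show False using witness[OF \<open>d > 0\<close>] neg by blast
  qed
  have "\<exists>x (f :: 'a cdual). (\<forall>g\<in>F. g x = 0) \<and> f x = 1" if "finite F" for F :: "'a cdual set"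
    by (rule common_kernel_nontrivial[OF inf that]) blast
  then obtain X :: "'a cdual set \<Rightarrow> 'a" and Y :: "'a cdual set \<Rightarrow> 'a cdual"
    where XY: "\<And>F g. finite F \<Longrightarrow> g \<in> F \<Longrightarrow> cblinfun_apply g (X F) = 0"
    "\<And>F. finite F \<Longrightarrow> cblinfun_apply (Y F) (X F) = 1" by metis
  define F where "F = rec_nat {} (\<lambda>n G. insert (Y G) G)"
  have F: "F 0 = {}" "F (Suc n) = insert (Y (F n)) (F n)" for n by (simp_all add: F_def)
  have fin: "finite (F n)" for n by (induction n) (simp_all add: F)
  have F_mono: "F m \<subseteq> F n" if "m \<le> n" for m n
    using that by (induction rule: dec_induct) (auto simp: F)
  define x where "x n = X (F n)" for n
  define f where "f n = Y (F n)" for n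
  have f_x: "f n (x n) = 1" for n using XY(2)[OF fin] by (simp add: f_def x_def)
  have f_x_later: "f n (x m) = 0" if "n < m" for n m
  proof -
    have "f n \<in> F m" using F_mono[of "Suc n" m] that by (auto simp: F f_def)
    then show ?thesis using XY(1)[OF fin] by (simp add: x_def)
  qed
  have x_pos: "norm (x n) > 0" for n using f_x[of n] by auto
  have "\<exists>a. cmod a * norm (x n) \<le> (1/2) ^ n \<and> cmod (h (f n s + a)) > real n * M (f n)" for n s
  proof -
    have pos: "(1/2) ^ n / norm (x n) > 0" using x_pos[of n] by simp
    obtain a where a: "cmod a < (1/2) ^ n / norm (x n)" "cmod (h a) > real n * M (f n) + cmod (h (f n s))"
      using large[OF pos] by blast
    have "cmod a * norm (x n) \<le> (1/2) ^ n" using a(1) x_pos[of n] by (simp add: pos_less_divide_eq)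
    moreover have "cmod (h a) \<le> cmod (h (f n s + a)) + cmod (h (f n s))"
      using norm_triangle_ineq4[of "h (f n s + a)" "h (f n s)"] by (simp add: h_add)
    ultimately show ?thesis using a(2) by (intro exI[of _ a]) auto
  qed
  then obtain a where a: "\<And>n s. cmod (a n s) * norm (x n) \<le> (1/2) ^ n"
    "\<And>n s. cmod (h (f n s + a n s)) > real n * M (f n)" by metis
  define s where "s = rec_nat 0 (\<lambda>n s. s + a n s *\<^sub>C x n)"
  have s: "s 0 = 0" "s (Suc n) = s n + a n (s n) *\<^sub>C x n" for n by (simp_all add: s_def)
  define t where "t n = a n (s n) *\<^sub>C x n" for n
  have "norm (t n) \<le> (1/2) ^ n" for n using a(1) by (simp add: t_def norm_scaleC)
  then have "summable t"
    by (intro summable_comparison_test'[OF summable_geometric[of "1/2 :: real"]]) auto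
  moreover have "(\<Sum>k<n. t k) = s n" for n by (induction n) (simp_all add: s t_def)
  ultimately have lim: "s \<longlonglongrightarrow> suminf t" using summable_LIMSEQ[of t] by simp
  have f_s: "f n (s m) = f n (s (Suc n))" if "m \<ge> Suc n" for n m
    using that by (induction rule: dec_induct) (simp_all add: s f_x_later)
  have f_lim: "f n (suminf t) = f n (s n) + a n (s n)" for n
  proof -
    have "(\<lambda>m. f n (s m)) \<longlonglongrightarrow> f n (suminf t)"
      by (rule bounded_linear.tendsto[OF bounded_linear_cblinfun lim])
    moreover have "(\<lambda>m. f n (s m)) \<longlonglongrightarrow> f n (s (Suc n))"
      by (rule tendsto_eventually, rule eventually_sequentiallyI, rule f_s)
    ultimately have "f n (suminf t) = f n (s (Suc n))" by (rule LIMSEQ_unique)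
    then show ?thesis by (simp add: s f_x)
  qed
  have "real n < N (suminf t)" for n
  proof -
    have "real n * M (f n) < N (suminf t) * M (f n)"
      using a(2)[of n "s n"] le[of "f n" "suminf t"] by (simp add: f_lim)
    then show ?thesis using M[of "f n"] by (simp add: mult_less_cancel_right)
  qed
  then show False using reals_Archimedean2[of "N (suminf t)"] by (meson less_asym)
qed

text \<open>An additive function that fixes the integers and is bounded on the unit interval satisfies
\<open>n (h r - r) = h t - t\<close>, where \<open>t\<close> is the fractional part of \<open>n r\<close>. The right side stays bounded
as \<open>n\<close> grows.\<close>

lemma ring_automorphism_real:
  assumes h: "ring_automorphism h" and d: "d > 0" and K: "\<And>a. cmod a < d \<Longrightarrow> cmod (h a) \<le> K"
  shows "h (complex_of_real r) = complex_of_real r"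
proof -
  note hs = ring_automorphismD[OF h]
  have nat: "h (of_nat n) = of_nat n" for n
    by (induction n) (simp_all add: hs(1,3,4))
  have int: "h (of_int m) = of_int m" for m
    by (cases m rule: int_cases2) (simp_all add: nat hs(5))
  obtain p :: nat where p: "p > 0" "1 / real p < d"
    using d reals_Archimedean[of d] by (auto simp: inverse_eq_divide intro: that[of "Suc _"])
  have unit: "cmod (h a) \<le> real p * K" if "cmod a \<le> 1" for a
  proof -
    have "cmod (a / of_nat p) \<le> 1 / real p"
      using that by (simp add: norm_divide divide_right_mono)
    then have "cmod (a / of_nat p) < d" using p(2) by linarith
    then have "cmod (h (a / of_nat p)) \<le> K" by (rule K)
    moreover have "h a = of_nat p * h (a / of_nat p)"
      using hs(2)[of "of_nat p" "a / of_nat p"] p(1) by (simp add: nat)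
    ultimately show ?thesis by (simp add: norm_mult mult_left_mono)
  qed
  let ?e = "cmod (h (of_real r) - of_real r)"
  have "real n * ?e \<le> real p * K + 1" for n
  proof -
    define m where "m = \<lfloor>real n * r\<rfloor>"
    define t where "t = real n * r - of_int m"
    have t: "0 \<le> t" "t \<le> 1" unfolding t_def m_def by linarith+
    have eq: "complex_of_nat n * complex_of_real r = of_real t + of_int m" by (simp add: t_def)
    have "of_nat n * (h (of_real r) - of_real r) = h (of_nat n * of_real r) - of_nat n * of_real r"
      by (simp add: hs(2) nat right_diff_distrib)
    also have "\<dots> = h (of_real t) - of_real t" unfolding eq by (simp add: hs(1) int)
    finally have "real n * ?e = cmod (h (of_real t) - of_real t)"
      by (metis norm_mult norm_of_nat)
    also have "\<dots> \<le> cmod (h (of_real t)) + cmod (of_real t)" by (rule norm_triangle_ineq4)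
    also have "\<dots> \<le> real p * K + 1" using t by (intro add_mono unit) auto
    finally show ?thesis .
  qed
  then have "?e = 0" using reals_Archimedean3[of ?e] by (metis linorder_not_le zero_less_norm_iff norm_eq_zero)
  then show ?thesis by simp
qed

lemma ring_automorphism_continuous:
  assumes h: "ring_automorphism h" and d: "d > 0" and K: "\<And>a. cmod a < d \<Longrightarrow> cmod (h a) \<le> K"
  shows "h = (\<lambda>a. a) \<or> h = cnj"
proof -
  note hs = ring_automorphismD[OF h]
  have re: "h (of_real r) = of_real r" for r by (rule ring_automorphism_real[OF assms])
  have "h \<i> * h \<i> = - 1" using hs(2)[of \<i> \<i>] hs(5)[of 1] hs(4) by simp
  then have "(h \<i> - \<i>) * (h \<i> + \<i>) = 0" by (simp add: algebra_simps)
  then have i: "h \<i> = \<i> \<or> h \<i> = - \<i>" by (auto simp: add_eq_0_iff2)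
  have eq: "h a = of_real (Re a) + h \<i> * of_real (Im a)" for a
    using hs(1)[of "of_real (Re a)" "\<i> * of_real (Im a)"] hs(2)[of \<i> "of_real (Im a)"]
    by (simp add: re flip: complex_eq)
  from i show ?thesis
  proof
    assume "h \<i> = \<i>"
    then have "h a = a" for a using eq[of a] by (simp flip: complex_eq)
    then show ?thesis by blast
  next
    assume "h \<i> = - \<i>"
    then have "h a = cnj a" for a using eq[of a] by (simp add: complex_eq_iff)
    then show ?thesis by blast
  qed
qed

text \<open>The family \<open>g\<close> is kept general: it consists of functionals in the dual of the target space in three
applications, and of evaluations at vectors when the target space is itself a dual.\<close>

lemma bounded_linear_if_weakly_bounded:
  fixes T :: "'a::banach \<Rightarrow> 'b::real_normed_vector" and g :: "'i \<Rightarrow> 'b \<Rightarrow> complex"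
  assumes T: "linear T" and g: "\<And>i. i \<in> I \<Longrightarrow> linear (g i)"
    and weak: "\<And>i. i \<in> I \<Longrightarrow> \<exists>K. \<forall>x. norm (g i (T x)) \<le> K * norm x"
    and ptw: "\<And>y. \<exists>K. \<forall>i\<in>I. norm (g i y) \<le> K"
    and norming: "\<And>y M. (\<And>i. i \<in> I \<Longrightarrow> norm (g i y) \<le> M) \<Longrightarrow> norm y \<le> M"
  shows "bounded_linear T"
proof -
  have "bounded_linear (\<lambda>x. g i (T x))" if "i \<in> I" for i
  proof -
    obtain K where "\<And>x. norm (g i (T x)) \<le> K * norm x" using weak[OF \<open>i \<in> I\<close>] by blast
    moreover have "linear (\<lambda>x. g i (T x))"
      using linear_compose[OF T g[OF that]] by (simp add: o_def)
    ultimately show ?thesis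
      by (intro bounded_linear.intro) (auto simp: bounded_linear_axioms_def mult.commute)
  qed
  then obtain M where "\<And>i x. i \<in> I \<Longrightarrow> norm (g i (T x)) \<le> M * norm x"
    using uniform_boundedness[of I "\<lambda>i x. g i (T x)"] ptw by metis
  then have "norm (T x) \<le> M * norm x" for x by (rule norming)
  then show ?thesis
    by (intro bounded_linear_intro[where K = M]) (simp_all add: T linear_add linear_scale mult.commute)
qed

lemma bounded_linear_if_dual_bounded:
  fixes T :: "'a::banach \<Rightarrow> 'b::complex_normed_vector"
  assumes T: "linear T" and weak: "\<And>g :: 'b cdual. \<exists>K. \<forall>x. cmod (g (T x)) \<le> K * norm x"
  shows "bounded_linear T"
proof (rule bounded_linear_if_weakly_bounded[OF T, of "{g :: 'b cdual. norm g \<le> 2}" cblinfun_apply])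
  show "linear (cblinfun_apply g)" for g :: "'b cdual"
    using bounded_linear_cblinfun bounded_linear.linear by blast
  show "\<exists>K. \<forall>x. cmod (g (T x)) \<le> K * norm x" for g :: "'b cdual" by (rule weak)
  have "norm (g y) \<le> 2 * norm y" if "norm g \<le> 2" for y and g :: "'b cdual"
    using norm_cblinfun_apply[of g y] mult_right_mono[OF that norm_ge_zero[of y]] by linarith
  then show "\<exists>K. \<forall>g\<in>{g :: 'b cdual. norm g \<le> 2}. cmod (g y) \<le> K" for y by blast
  show "norm y \<le> M" if "\<And>g. g \<in> {g :: 'b cdual. norm g \<le> 2} \<Longrightarrow> cmod (g y) \<le> M" for y M
  proof -
    obtain g :: "'b cdual" where "norm g \<le> 2" "norm y \<le> cmod (g y)" by (rule norming_functional)
    then show ?thesis using that[of g] by simp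
  qed
qed

lemma semilinear_bij_real:
  assumes T: "semilinear_bij h T" and h: "h = (\<lambda>a. a) \<or> h = cnj"
  shows "linear T" "linear (inv_into UNIV T)" "inv_into UNIV T (a *\<^sub>C y) = h a *\<^sub>C inv_into UNIV T y"
proof -
  have bij: "bij T" and add: "\<And>x y. T (x + y) = T x + T y"
    and scale: "\<And>a x. T (a *\<^sub>C x) = h a *\<^sub>C T x"
    using T by (auto simp: semilinear_bij_def)
  have surj: "T (inv_into UNIV T y) = y" for y using bij by (simp add: bij_def surj_f_inv_f)
  have inj: "x = y" if "T x = T y" for x y using bij that by (simp add: bij_def inj_def)
  have hh: "h (h a) = a" "h (of_real r) = of_real r" for a r using h by auto
  show inv_scale: "inv_into UNIV T (a *\<^sub>C y) = h a *\<^sub>C inv_into UNIV T y" for a y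
    by (rule inj) (simp add: surj scale hh)
  show "linear T" by (rule linearI) (simp_all add: add scaleR_scaleC scale hh)
  show "linear (inv_into UNIV T)"
  proof (rule linearI)
    show "inv_into UNIV T (x + y) = inv_into UNIV T x + inv_into UNIV T y" for x y by (rule inj) (simp add: surj add)
    show "inv_into UNIV T (r *\<^sub>R x) = r *\<^sub>R inv_into UNIV T x" for r x by (simp add: scaleR_scaleC inv_scale hh)
  qed
qed

lemma semilinear_bij_invertible:
  assumes T: "semilinear_bij h T" and bdd: "bounded_linear T" "bounded_linear (inv_into UNIV T)"
  shows "h = (\<lambda>a. a) \<Longrightarrow> invertible_bounded_clinear T"
    "h = cnj \<Longrightarrow> invertible_bounded_antilinear T"
proof -
  assume h: "h = (\<lambda>a. a)"
  then show "invertible_bounded_clinear T"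
    using semilinear_bij_real(3)[OF T] T bdd
    by (auto simp: invertible_bounded_clinear_def bounded_clinear_def semilinear_bij_def)
next
  assume h: "h = cnj"
  then show "invertible_bounded_antilinear T"
    using semilinear_bij_real(3)[OF T] T bdd
    by (auto simp: invertible_bounded_antilinear_def bounded_antilinear_def semilinear_bij_def)
qed

text \<open>The identity \<open>(S f) (T x) = h (f x)\<close> bounds \<open>h\<close> near zero, so \<open>h\<close> preserves absolute values.
Then it also bounds \<open>g (T x)\<close> for \<open>g = S f\<close> by a multiple of \<open>norm x\<close>, and \<open>f (inv T y)\<close> by a
multiple of \<open>norm y\<close>, so \<open>T\<close> and its inverse are weakly bounded.\<close>

lemma direct_bounded:
  fixes T :: "'a::cbanach \<Rightarrow> 'b::cbanach" and S :: "'a cdual \<Rightarrow> 'b cdual"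
  assumes inf: "\<not> cfinite_dim (UNIV :: 'a set)" and h: "ring_automorphism h"
    and T: "semilinear_bij h T" and S: "semilinear_bij h S" and ST: "\<And>f x. S f (T x) = h (f x)"
  shows "invertible_bounded_clinear T \<or> invertible_bounded_antilinear T"
proof -
  have "cmod (h (cblinfun_apply f x)) \<le> norm (T x) * norm (S f)" for f x
    using norm_cblinfun_apply[of "S f" "T x"] by (simp add: ST mult.commute)
  then obtain d K where "d > 0" "\<And>a. cmod a < d \<Longrightarrow> cmod (h a) \<le> K"
    using bounded_near_zero[OF inf ring_automorphismD(1)[OF h], of "\<lambda>f. norm (S f)" "\<lambda>x. norm (T x)"]
    by (metis norm_ge_zero)
  then have h_cases: "h = (\<lambda>a. a) \<or> h = cnj" by (rule ring_automorphism_continuous[OF h])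
  then have h_norm: "cmod (h a) = cmod a" for a by auto
  have surj: "T (inv_into UNIV T y) = y" for y
    using T by (simp add: semilinear_bij_def bij_def surj_f_inv_f)
  have "bounded_linear T"
  proof (rule bounded_linear_if_dual_bounded)
    show "linear T" by (rule semilinear_bij_real[OF T h_cases])
    fix g :: "'b cdual"
    obtain f where "g = S f" using S unfolding semilinear_bij_def by (metis bij_pointE)
    then have "cmod (g (T x)) \<le> norm f * norm x" for x
      using norm_cblinfun_apply[of f x] by (simp add: ST h_norm)
    then show "\<exists>K. \<forall>x. cmod (g (T x)) \<le> K * norm x" by blast
  qed
  moreover have "bounded_linear (inv_into UNIV T)"
  proof (rule bounded_linear_if_dual_bounded)
    show "linear (inv_into UNIV T)" by (rule semilinear_bij_real[OF T h_cases])
    fix f :: "'a cdual"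
    have "cmod (f (inv_into UNIV T y)) \<le> norm (S f) * norm y" for y
      using norm_cblinfun_apply[of "S f" y] ST[of f "inv_into UNIV T y"] h_norm by (simp add: surj)
    then show "\<exists>K. \<forall>y. cmod (f (inv_into UNIV T y)) \<le> K * norm y" by blast
  qed
  ultimately show ?thesis using semilinear_bij_invertible[OF T] h_cases by blast
qed

lemma transposed_bounded:
  fixes T :: "'a::cbanach cdual \<Rightarrow> 'b::cbanach" and S :: "'a \<Rightarrow> 'b cdual"
  assumes inf: "\<not> cfinite_dim (UNIV :: 'a set)" and h: "ring_automorphism h"
    and T: "semilinear_bij h T" and S: "semilinear_bij h S" and ST: "\<And>f x. S x (T f) = h (f x)"
  shows "invertible_bounded_clinear T \<or> invertible_bounded_antilinear T"
proof -
  have "cmod (h (cblinfun_apply f x)) \<le> norm (S x) * norm (T f)" for f x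
    using norm_cblinfun_apply[of "S x" "T f"] by (simp add: ST)
  then obtain d K where "d > 0" "\<And>a. cmod a < d \<Longrightarrow> cmod (h a) \<le> K"
    using bounded_near_zero[OF inf ring_automorphismD(1)[OF h], of "\<lambda>f. norm (T f)" "\<lambda>x. norm (S x)"]
    by (metis norm_ge_zero)
  then have h_cases: "h = (\<lambda>a. a) \<or> h = cnj" by (rule ring_automorphism_continuous[OF h])
  then have h_norm: "cmod (h a) = cmod a" for a by auto
  have surj: "T (inv_into UNIV T y) = y" for y
    using T by (simp add: semilinear_bij_def bij_def surj_f_inv_f)
  have "bounded_linear T"
  proof (rule bounded_linear_if_dual_bounded)
    show "linear T" by (rule semilinear_bij_real[OF T h_cases])
    fix g :: "'b cdual"
    obtain x where "g = S x" using S unfolding semilinear_bij_def by (metis bij_pointE)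
    then have "cmod (g (T f)) \<le> norm x * norm f" for f
      using norm_cblinfun_apply[of f x] by (simp add: ST h_norm mult.commute)
    then show "\<exists>K. \<forall>f. cmod (g (T f)) \<le> K * norm f" by blast
  qed
  moreover have "bounded_linear (inv_into UNIV T)"
  proof (rule bounded_linear_if_weakly_bounded[of _ "{x :: 'a. norm x \<le> 1}" "\<lambda>x f. cblinfun_apply f x"])
    show "linear (inv_into UNIV T)" by (rule semilinear_bij_real[OF T h_cases])
    show "linear (\<lambda>f :: 'a cdual. f x)" for x by (rule linearI) (simp_all add: scaleR_scaleC)
    have "cmod (cblinfun_apply (inv_into UNIV T y) x) \<le> norm (S x) * norm y" for x y
      using norm_cblinfun_apply[of "S x" y] ST[of x "inv_into UNIV T y"] h_norm by (simp add: surj)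
    then show "\<exists>K. \<forall>y. cmod (cblinfun_apply (inv_into UNIV T y) x) \<le> K * norm y" for x by blast
    have "cmod (f x) \<le> norm f" if "norm x \<le> 1" for x and f :: "'a cdual"
      using norm_cblinfun_apply[of f x] mult_left_mono[OF that norm_ge_zero[of f]] by linarith
    then show "\<exists>K. \<forall>x\<in>{x :: 'a. norm x \<le> 1}. cmod (f x) \<le> K" for f :: "'a cdual" by blast
    show "norm f \<le> M" if M: "\<And>x. x \<in> {x :: 'a. norm x \<le> 1} \<Longrightarrow> cmod (f x) \<le> M"
      for f :: "'a cdual" and M
    proof (rule norm_cblinfun_le)
      show "M \<ge> 0" using M[of 0] by simp
      fix x
      show "norm (f x) \<le> M * norm x"
      proof (cases "x = 0")
        case False
        let ?y = "of_real (inverse (norm x)) *\<^sub>C x"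
        have "norm ?y \<le> 1" using False by (simp add: norm_scaleC norm_inverse)
        then have "cmod (f ?y) \<le> M" using M by blast
        then show ?thesis using False by (simp add: norm_divide field_simps)
      qed simp
    qed
  qed
  ultimately show ?thesis using semilinear_bij_invertible[OF T] h_cases by blast
qed

section \<open>Finite dimension: matrices\<close>

text \<open>Coordinate functionals on a finite-dimensional space are obtained directly as bounded functionals,
by induction on the basis, so that no equivalence of norms is needed.\<close>

lemma biorthogonal_functionals:
  fixes B :: "'a::complex_normed_vector set"
  assumes "finite B" "cindependent B"
  shows "\<exists>F :: 'a \<Rightarrow> 'a cdual. \<forall>b\<in>B. \<forall>c\<in>B. F b c = (if b = c then 1 else 0)"
  using assms
proof induction
  case (insert e B)
  have ind: "cindependent B" and e: "e \<notin> cspan B"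
    using insert.prems insert.hyps by (simp_all add: complex_vector.independent_insert)
  obtain F :: "'a \<Rightarrow> 'a cdual" where F: "\<And>b c. b \<in> B \<Longrightarrow> c \<in> B \<Longrightarrow> F b c = (if b = c then 1 else 0)"
    using insert.IH[OF ind] by blast
  define s where "s = (\<Sum>b\<in>B. F b e *\<^sub>C b)"
  have "s \<in> cspan B"
    unfolding s_def by (intro complex_vector.span_sum complex_vector.span_scale complex_vector.span_base)
  then have "e - s \<noteq> 0" using e by auto
  then obtain k :: "'a cdual" where k: "k (e - s) = 1"
    by (rule separating_functional)
  define G where "G = k - (\<Sum>b\<in>B. k b *\<^sub>C F b)"
  have G_e: "G e = 1" using k by (simp add: G_def s_def mult.commute)
  have G_B: "G c = 0" if "c \<in> B" for c
  proof -
    have "(\<Sum>b\<in>B. k b * F b c) = (\<Sum>b\<in>B. if b = c then k b else 0)"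
      using F that by (intro sum.cong) auto
    also have "\<dots> = k c" using that insert.hyps by simp
    finally show ?thesis by (simp add: G_def)
  qed
  let ?F = "\<lambda>b. if b = e then G else F b - F b e *\<^sub>C G"
  have "?F b c = (if b = c then 1 else 0)" if "b \<in> insert e B" "c \<in> insert e B" for b c
    using that insert.hyps(2) by (auto simp: G_e G_B F)
  then show ?case by (intro exI[of _ ?F] ballI)
qed simp

definition dual_system :: "nat \<Rightarrow> (nat \<Rightarrow> 'a::complex_normed_vector) \<Rightarrow> (nat \<Rightarrow> 'a cdual) \<Rightarrow> bool"
  where "dual_system n e f \<longleftrightarrow>
    (\<forall>i<n. \<forall>j<n. f i (e j) = (if i = j then 1 else 0)) \<and> (\<forall>x. (\<Sum>i<n. f i x *\<^sub>C e i) = x)"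

lemma dual_systemD:
  assumes "dual_system n e f"
  shows "i < n \<Longrightarrow> j < n \<Longrightarrow> cblinfun_apply (f i) (e j) = (if i = j then 1 else 0)"
    "(\<Sum>i<n. f i x *\<^sub>C e i) = x"
  using assms by (auto simp: dual_system_def)

lemma dual_system_coefficient:
  assumes d: "dual_system n e f" and j: "j < n"
  shows "(\<Sum>i<n. a i * cblinfun_apply (f j) (e i)) = a j"
    "(\<Sum>i<n. cblinfun_apply (f i) (e j) *\<^sub>C y i) = y j"
proof -
  have "(\<Sum>i<n. a i * f j (e i)) = (\<Sum>i<n. if i = j then a i else 0)"
    using j by (intro sum.cong) (auto simp: dual_systemD(1)[OF d])
  then show "(\<Sum>i<n. a i * f j (e i)) = a j" using j by simp
  have "(\<Sum>i<n. f i (e j) *\<^sub>C y i) = (\<Sum>i<n. if i = j then y i else 0)"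
    using j by (intro sum.cong) (auto simp: dual_systemD(1)[OF d])
  then show "(\<Sum>i<n. f i (e j) *\<^sub>C y i) = y j" using j by simp
qed

lemma cbasis_dual_system:
  assumes es: "is_cbasis (es :: 'a::complex_normed_vector list)"
  obtains f where "dual_system (length es) ((!) es) f"
    "\<And>i x. i < length es \<Longrightarrow> crepresentation (set es) x (es ! i) = cblinfun_apply (f i) x"
proof -
  have dist: "distinct es" and ind: "cindependent (set es)" and span: "cspan (set es) = UNIV"
    using es by (auto simp: is_cbasis_def)
  obtain F :: "'a \<Rightarrow> 'a cdual"
    where F: "\<And>b c. b \<in> set es \<Longrightarrow> c \<in> set es \<Longrightarrow> F b c = (if b = c then 1 else 0)"
    using biorthogonal_functionals[OF _ ind] by auto
  have rep: "(\<Sum>b\<in>set es. crepresentation (set es) x b *\<^sub>C b) = x" for x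
    using span by (intro complex_vector.sum_representation_eq[OF ind]) auto
  have F_rep: "F c x = crepresentation (set es) x c" if "c \<in> set es" for c x
  proof -
    have "F c x = F c (\<Sum>b\<in>set es. crepresentation (set es) x b *\<^sub>C b)" by (simp only: rep)
    also have "\<dots> = crepresentation (set es) x c"
      using that by (simp add: F mult_delta_right cong: sum.cong)
    finally show ?thesis .
  qed
  define f where "f i = F (es ! i)" for i
  have "(\<Sum>i<length es. f i x *\<^sub>C es ! i) = (\<Sum>b\<in>set es. F b x *\<^sub>C b)" for x
    unfolding f_def using sum.reindex_bij_betw[OF bij_betw_nth[OF dist refl refl], of "\<lambda>b. F b x *\<^sub>C b"]
    by simp
  also have "(\<Sum>b\<in>set es. F b x *\<^sub>C b) = (\<Sum>b\<in>set es. crepresentation (set es) x b *\<^sub>C b)" for x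
    by (rule sum.cong) (simp_all add: F_rep)
  finally have "dual_system (length es) ((!) es) f"
    using rep dist by (auto simp: dual_system_def f_def F nth_eq_iff_index_eq)
  then show ?thesis using F_rep by (intro that[of f]) (simp_all add: f_def)
qed

lemma dual_system_dim:
  assumes d: "dual_system n e (f :: nat \<Rightarrow> 'a::complex_normed_vector cdual)"
  shows "cfinite_dim (UNIV :: 'a set)" "cdim (UNIV :: 'a set) = n"
proof -
  let ?B = "e ` {..<n}"
  have inj: "inj_on e {..<n}"
    using dual_systemD(1)[OF d] by (intro inj_onI) (metis lessThan_iff zero_neq_one)
  have span: "cspan ?B = UNIV"
  proof -
    have "(\<Sum>i<n. f i x *\<^sub>C e i) \<in> cspan ?B" for x
      by (intro complex_vector.span_sum complex_vector.span_scale complex_vector.span_base) auto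
    then show ?thesis by (auto simp: dual_systemD(2)[OF d])
  qed
  then show "cfinite_dim (UNIV :: 'a set)" unfolding cfinite_dim_def by blast
  have "cindependent ?B"
  proof
    assume "cdependent ?B"
    then obtain u v where uv: "v \<in> ?B" "u v \<noteq> 0" "(\<Sum>v\<in>?B. u v *\<^sub>C v) = 0"
      by (auto simp: complex_vector.dependent_finite)
    then obtain j where j: "j < n" "v = e j" by auto
    have "0 = f j (\<Sum>i<n. u (e i) *\<^sub>C e i)" using uv(3) by (simp add: sum.reindex[OF inj])
    also have "\<dots> = u v" using j by (simp add: dual_system_coefficient(1)[OF d])
    finally show False using uv(2) by simp
  qed
  then have "cdim (UNIV :: 'a set) = card ?B"
    using span by (intro complex_vector.dim_eq_card) auto
  then show "cdim (UNIV :: 'a set) = n" by (simp add: card_image[OF inj])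
qed

lemma cbasis_exists:
  assumes "cfinite_dim (UNIV :: 'a set)"
  obtains es :: "'a::complex_normed_vector list" where "is_cbasis es"
proof -
  obtain W :: "'a set" where W: "finite W" "cspan W = UNIV"
    using assms by (auto simp: cfinite_dim_def)
  obtain B where B: "B \<subseteq> W" "cindependent B" "W \<subseteq> cspan B"
    using complex_vector.maximal_independent_subset[of W] by metis
  have "UNIV \<subseteq> cspan B"
    using complex_vector.span_mono[OF B(3)] W(2) by (simp add: complex_vector.span_span)
  moreover obtain es where "set es = B" "distinct es"
    using finite_distinct_list[OF finite_subset[OF B(1) W(1)]] by blast
  ultimately show ?thesis using that[of es] B(2) by (auto simp: is_cbasis_def)
qed

lemma dual_system_operator:
  fixes A :: "'a::complex_normed_vector \<Rightarrow>\<^sub>C\<^sub>L 'b::complex_normed_vector"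
  assumes "dual_system n e f"
  shows "A = (\<Sum>i<n. rank1 (A (e i)) (f i))"
proof (rule cblinfun_eqI)
  fix x
  have "A x = A (\<Sum>i<n. f i x *\<^sub>C e i)" by (simp only: dual_systemD(2)[OF assms])
  then show "A x = (\<Sum>i<n. rank1 (A (e i)) (f i)) x" by simp
qed

lemma standard_algebra_finite_dim:
  fixes \<A> :: "('a::complex_normed_vector \<Rightarrow>\<^sub>C\<^sub>L 'a) set" and e :: "nat \<Rightarrow> 'a"
  assumes d: "dual_system n e f" and std: "standard_operator_algebra \<A>"
  shows "\<A> = UNIV"
proof -
  have "(\<Sum>i<n. rank1 (x i) (f i)) \<in> \<A>" for x
    by (induction n) (simp_all add: standard_algebraD[OF std])
  then show ?thesis using dual_system_operator[OF d] by (metis UNIV_eq_I)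
qed

lemma matrix_of_bij:
  assumes d: "dual_system (length es) ((!) es) f"
    and mat: "\<And>A. matrix_of es A = mat (length es) (length es) (\<lambda>(i, j). f i (A (es ! j)))"
  shows "bij_betw (matrix_of es) UNIV (carrier_mat (length es) (length es))"
proof (rule bij_betwI[where g = "\<lambda>M. \<Sum>j<length es. rank1 (\<Sum>i<length es. M $$ (i, j) *\<^sub>C es ! i) (f j)"])
  let ?n = "length es"
  let ?A = "\<lambda>M. \<Sum>j<?n. rank1 (\<Sum>i<?n. M $$ (i, j) *\<^sub>C es ! i) (f j)"
  show "matrix_of es \<in> UNIV \<rightarrow> carrier_mat ?n ?n" by (simp add: mat)
  show "?A \<in> carrier_mat ?n ?n \<rightarrow> UNIV" by simp
  show "?A (matrix_of es A) = A" for A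
  proof -
    have "(\<Sum>i<?n. matrix_of es A $$ (i, j) *\<^sub>C es ! i) = A (es ! j)" if "j < ?n" for j
      using dual_systemD(2)[OF d, of "A (es ! j)"] that by (simp add: mat)
    then have "?A (matrix_of es A) = (\<Sum>j<?n. rank1 (A (es ! j)) (f j))" by simp
    then show ?thesis using dual_system_operator[OF d, of A] by simp
  qed
  show "matrix_of es (?A M) = M" if M: "M \<in> carrier_mat ?n ?n" for M
  proof (rule eq_matI)
    fix i j assume "i < dim_row M" "j < dim_col M"
    then have ij: "i < ?n" "j < ?n" using M by auto
    have "?A M (es ! j) = (\<Sum>i<?n. M $$ (i, j) *\<^sub>C es ! i)"
      using dual_system_coefficient(2)[OF d ij(2)] by simp
    then have "f i (?A M (es ! j)) = M $$ (i, j)"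
      using dual_system_coefficient(1)[OF d ij(1)] by simp
    then show "matrix_of es (?A M) $$ (i, j) = M $$ (i, j)" using ij by (simp add: mat)
  qed (use M in \<open>simp_all add: mat\<close>)
qed

definition transition_mat :: "nat \<Rightarrow> (nat \<Rightarrow> 'a::complex_normed_vector cdual) \<Rightarrow> (nat \<Rightarrow> 'a) \<Rightarrow> complex mat"
  where "transition_mat n f e = mat n n (\<lambda>(i, j). f i (e j))"

lemma transition_mat_inverts:
  assumes d: "dual_system n e f" and d': "dual_system n e' f'"
  shows "inverts_mat (transition_mat n f e') (transition_mat n f' e)"
proof -
  have "transition_mat n f e' * transition_mat n f' e = 1\<^sub>m n"
  proof (rule eq_matI)
    fix i k assume "i < dim_row (1\<^sub>m n :: complex mat)" "k < dim_col (1\<^sub>m n :: complex mat)"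
    then have ik: "i < n" "k < n" by auto
    have "f i (e k) = f i (\<Sum>j<n. f' j (e k) *\<^sub>C e' j)" by (simp only: dual_systemD(2)[OF d'])
    also have "\<dots> = (transition_mat n f e' * transition_mat n f' e) $$ (i, k)"
      using ik by (simp add: transition_mat_def scalar_prod_def mult.commute atLeast0LessThan)
    finally show "(transition_mat n f e' * transition_mat n f' e) $$ (i, k) = 1\<^sub>m n $$ (i, k)"
      using dual_systemD(1)[OF d ik] ik by simp
  qed (simp_all add: transition_mat_def)
  then show ?thesis by (simp add: inverts_mat_def transition_mat_def)
qed

lemma change_of_basis:
  assumes d: "dual_system n e f" and d': "dual_system n e' f'" and H: "H \<in> carrier_mat n n"
    and B: "\<And>j. j < n \<Longrightarrow> cblinfun_apply B (e' j) = c *\<^sub>C (\<Sum>i<n. H $$ (i, j) *\<^sub>C e' i)"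
  shows "mat n n (\<lambda>(i, j). f i (B (e j))) = c \<cdot>\<^sub>m (transition_mat n f e' * H * transition_mat n f' e)"
proof (rule eq_matI)
  let ?R = "c \<cdot>\<^sub>m (transition_mat n f e' * H * transition_mat n f' e)"
  fix i j assume "i < dim_row ?R" "j < dim_col ?R"
  then have ij: "i < n" "j < n" by (auto simp: transition_mat_def)
  have "B (e j) = B (\<Sum>k<n. f' k (e j) *\<^sub>C e' k)" by (simp only: dual_systemD(2)[OF d'])
  also have "\<dots> = (\<Sum>k<n. f' k (e j) *\<^sub>C c *\<^sub>C (\<Sum>l<n. H $$ (l, k) *\<^sub>C e' l))"
    by (simp add: B)
  finally have "f i (B (e j)) = (\<Sum>k<n. f' k (e j) * (c * (\<Sum>l<n. H $$ (l, k) * f i (e' l))))"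
    by (simp add: mult.assoc)
  also have "\<dots> = c * (\<Sum>k<n. (\<Sum>l<n. f i (e' l) * H $$ (l, k)) * f' k (e j))"
    by (simp add: sum_distrib_left mult_ac)
  also have "\<dots> = ?R $$ (i, j)"
    using ij H by (simp add: transition_mat_def scalar_prod_def atLeast0LessThan)
  finally show "mat n n (\<lambda>(i, j). f i (B (e j))) $$ (i, j) = ?R $$ (i, j)" using ij by simp
qed (simp_all add: transition_mat_def)

lemma semilinear_bij_sum:
  assumes T: "semilinear_bij h T"
  shows "T (\<Sum>i<n. a i *\<^sub>C x i) = (\<Sum>i<(n::nat). h (a i) *\<^sub>C T (x i))"
proof -
  have add: "\<And>x y. T (x + y) = T x + T y" and scale: "\<And>a x. T (a *\<^sub>C x) = h a *\<^sub>C T x"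
    using T by (auto simp: semilinear_bij_def)
  have "T 0 = 0" using add[of 0 0] by simp
  then show ?thesis by (induction n) (simp_all add: add scale)
qed

text \<open>The semilinear maps transport a basis and its coordinate functionals; in the transposed case they
exchange the two.\<close>

lemma direct_dual_system:
  assumes d: "dual_system n e f" and h: "ring_automorphism h"
    and T: "semilinear_bij h T" and ST: "\<And>f x. cblinfun_apply (S f) (T x) = h (cblinfun_apply f x)"
  shows "dual_system n (\<lambda>i. T (e i)) (\<lambda>i. S (f i))"
  unfolding dual_system_def
proof (intro conjI allI impI)
  show "S (f i) (T (e j)) = (if i = j then 1 else 0)" if "i < n" "j < n" for i j
    using that by (simp add: ST dual_systemD(1)[OF d] ring_automorphismD[OF h])
  fix y
  obtain x where "y = T x" using T unfolding semilinear_bij_def by (metis bij_pointE)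
  then show "(\<Sum>i<n. S (f i) y *\<^sub>C T (e i)) = y"
    by (simp add: ST dual_systemD(2)[OF d] flip: semilinear_bij_sum[OF T])
qed

lemma transposed_dual_system:
  assumes d: "dual_system n e f" and h: "ring_automorphism h"
    and T: "semilinear_bij h T" and ST: "\<And>f x. cblinfun_apply (S x) (T f) = h (cblinfun_apply f x)"
  shows "dual_system n (\<lambda>i. T (f i)) (\<lambda>i. S (e i))"
    "(\<Sum>i<n. cblinfun_apply k (e i) *\<^sub>C f i) = k"
proof -
  show k: "(\<Sum>i<n. cblinfun_apply k (e i) *\<^sub>C f i) = k" for k
  proof (rule cblinfun_eqI)
    fix x
    have "k x = k (\<Sum>i<n. f i x *\<^sub>C e i)" by (simp only: dual_systemD(2)[OF d])
    then show "(\<Sum>i<n. cblinfun_apply k (e i) *\<^sub>C f i) x = k x" by (simp add: mult.commute)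
  qed
  show "dual_system n (\<lambda>i. T (f i)) (\<lambda>i. S (e i))"
    unfolding dual_system_def
  proof (intro conjI allI impI)
    show "S (e i) (T (f j)) = (if i = j then 1 else 0)" if "i < n" "j < n" for i j
      using that by (simp add: ST dual_systemD(1)[OF d] ring_automorphismD[OF h])
    fix y
    obtain l where "y = T l" using T unfolding semilinear_bij_def by (metis bij_pointE)
    then show "(\<Sum>i<n. S (e i) y *\<^sub>C T (f i)) = y"
      by (simp add: ST k flip: semilinear_bij_sum[OF T])
  qed
qed

lemma not_multiple_exists:
  assumes "cfinite_dim (UNIV :: 'a::complex_normed_vector set) \<Longrightarrow> 3 \<le> cdim (UNIV :: 'a set)"
  shows "\<exists>y. \<forall>a. y \<noteq> a *\<^sub>C (x :: 'a)"
proof (rule ccontr)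
  assume "\<not> ?thesis"
  then have span: "cspan {x} = UNIV" by (auto simp: complex_vector.span_singleton)
  then have "cfinite_dim (UNIV :: 'a set)" by (auto simp: cfinite_dim_def intro: exI[of _ "{x}"])
  then have "3 \<le> cdim (UNIV :: 'a set)" by (rule assms)
  also have "\<dots> \<le> card {x}" using span by (intro complex_vector.dim_le_card) auto
  finally show False by simp
qed

text \<open>In the basis \<open>e'\<close> of the target the operator \<open>\<phi> A\<close> has, up to the sign, the matrix of \<open>A\<close> with \<open>h\<close>
applied to its entries, or the transpose of this.\<close>

lemma (in jordan_triple_iso) finite_dim_forms:
  assumes two_dim: "\<And>x :: 'a. \<exists>y. \<forall>a. y \<noteq> a *\<^sub>C x" and d: "dual_system n (e :: nat \<Rightarrow> 'a) f"
  obtains c h e' f' H where "c \<in> {-1, 1}" "ring_automorphism h" "dual_system n (e' :: nat \<Rightarrow> 'b) f'"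
    "\<forall>A\<in>\<A>. \<forall>j<n. \<phi> A (e' j) = c *\<^sub>C (\<Sum>i<n. H A i j *\<^sub>C e' i)"
    "H = (\<lambda>A i j. h (cblinfun_apply (f i) (cblinfun_apply A (e j)))) \<or> H = (\<lambda>A i j. h (cblinfun_apply (f j) (cblinfun_apply A (e i))))"
  using two_dim
proof (cases rule: two_forms)
  case (direct c h T S)
  show ?thesis
  proof (rule that[OF direct(1,2) direct_dual_system[OF d direct(2,3,5)] _ disjI1[OF refl]], intro ballI allI impI)
    fix A j assume "A \<in> \<A>"
    have "T (A (e j)) = T (\<Sum>i<n. f i (A (e j)) *\<^sub>C e i)" by (simp only: dual_systemD(2)[OF d])
    then show "\<phi> A (T (e j)) = c *\<^sub>C (\<Sum>i<n. h (f i (A (e j))) *\<^sub>C T (e i))"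
      using direct(6)[OF \<open>A \<in> \<A>\<close>] by (simp add: semilinear_bij_sum[OF direct(3)])
  qed
next
  case (transposed c h T S)
  show ?thesis
  proof (rule that[OF transposed(1,2) transposed_dual_system(1)[OF d transposed(2,3,5)] _ disjI2[OF refl]], intro ballI allI impI)
    fix A j assume "A \<in> \<A>"
    have "T (f j o\<^sub>C\<^sub>L A) = T (\<Sum>i<n. (f j o\<^sub>C\<^sub>L A) (e i) *\<^sub>C f i)"
      by (simp only: transposed_dual_system(2)[OF d transposed(2,3,5)])
    then show "\<phi> A (T (f j)) = c *\<^sub>C (\<Sum>i<n. h (f j (A (e i))) *\<^sub>C T (f i))"
      using transposed(6)[OF \<open>A \<in> \<A>\<close>] by (simp add: semilinear_bij_sum[OF transposed(3)])
  qed
qed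

lemma (in jordan_triple_iso) finite_dim_range:
  assumes two_dim: "\<And>x :: 'a. \<exists>y. \<forall>a. y \<noteq> a *\<^sub>C x" and fin: "cfinite_dim (UNIV :: 'a set)"
  shows "cfinite_dim (UNIV :: 'b set)" "cdim (UNIV :: 'a set) = cdim (UNIV :: 'b set)"
    "\<A> = UNIV" "\<B> = UNIV"
proof -
  obtain es :: "'a list" where "is_cbasis es" using cbasis_exists[OF fin] by blast
  then obtain f where d: "dual_system (length es) ((!) es) f" using cbasis_dual_system by blast
  obtain e' :: "nat \<Rightarrow> 'b" and f' where d': "dual_system (length es) e' f'"
    using finite_dim_forms[OF two_dim d] by metis
  show "cfinite_dim (UNIV :: 'b set)" "cdim (UNIV :: 'a set) = cdim (UNIV :: 'b set)"
    using dual_system_dim[OF d] dual_system_dim[OF d'] by simp_all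
  show "\<A> = UNIV" "\<B> = UNIV"
    using standard_algebra_finite_dim[OF d std_A] standard_algebra_finite_dim[OF d' std_B] by simp_all
qed

lemma (in jordan_triple_iso) matrix_forms:
  assumes two_dim: "\<And>x :: 'a. \<exists>y. \<forall>a. y \<noteq> a *\<^sub>C x"
    and es: "is_cbasis (es :: 'a list)" and fs: "is_cbasis (fs :: 'b list)"
    and n: "n = cdim (UNIV :: 'a set)" and \<Phi>: "\<Phi> = matrix_map es fs \<phi>"
  shows "bij_betw \<Phi> (carrier_mat n n) (carrier_mat n n)"
    "\<exists>h T S c. ring_automorphism h \<and> T \<in> carrier_mat n n \<and> S \<in> carrier_mat n n \<and>
      inverts_mat T S \<and> inverts_mat S T \<and> c \<in> {-1, 1} \<and>
      ((\<forall>M\<in>carrier_mat n n. \<Phi> M = c \<cdot>\<^sub>m (T * map_mat h M * S)) \<or>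
       (\<forall>M\<in>carrier_mat n n. \<Phi> M = c \<cdot>\<^sub>m (T * (map_mat h M)\<^sup>T * S)))"
proof -
  obtain f where f: "dual_system (length es) ((!) es) f"
    "\<And>i x. i < length es \<Longrightarrow> crepresentation (set es) x (es ! i) = f i x"
    using cbasis_dual_system[OF es] by metis
  obtain g where g: "dual_system (length fs) ((!) fs) g"
    "\<And>i x. i < length fs \<Longrightarrow> crepresentation (set fs) x (fs ! i) = g i x"
    using cbasis_dual_system[OF fs] by metis
  have len_es: "length es = n" using dual_system_dim(2)[OF f(1)] n by simp
  note range = finite_dim_range[OF two_dim dual_system_dim(1)[OF f(1)]]
  have len_fs: "length fs = n" using dual_system_dim(2)[OF g(1)] n range(2) by simp
  have mat_es: "matrix_of es A = mat (length es) (length es) (\<lambda>(i, j). f i (A (es ! j)))" for A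
    unfolding matrix_of_def by (rule cong_mat) (simp_all add: f(2))
  have mat_fs: "matrix_of fs A = mat (length fs) (length fs) (\<lambda>(i, j). g i (A (fs ! j)))" for A
    unfolding matrix_of_def by (rule cong_mat) (simp_all add: g(2))
  have bij_es: "bij_betw (matrix_of es) UNIV (carrier_mat n n)"
    using matrix_of_bij[OF f(1) mat_es] len_es by simp
  have bij_fs: "bij_betw (matrix_of fs) UNIV (carrier_mat n n)"
    using matrix_of_bij[OF g(1) mat_fs] len_fs by simp
  have "bij_betw (matrix_of fs \<circ> (\<phi> \<circ> inv_into UNIV (matrix_of es))) (carrier_mat n n) (carrier_mat n n)"
    using bij range(3,4) by (intro bij_betw_trans[OF _ bij_fs] bij_betw_trans[OF bij_betw_inv_into[OF bij_es]]) simp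
  moreover have "matrix_of fs \<circ> (\<phi> \<circ> inv_into UNIV (matrix_of es)) = \<Phi>"
    by (rule ext) (simp add: \<Phi> matrix_map_def)
  ultimately show "bij_betw \<Phi> (carrier_mat n n) (carrier_mat n n)" by simp
  have d: "dual_system n ((!) es) f" and dg: "dual_system n ((!) fs) g"
    using f(1) g(1) len_es len_fs by simp_all
  obtain c h e' f' H where c: "c \<in> {-1, 1}" and h: "ring_automorphism h" and d': "dual_system n e' f'"
    and H: "\<forall>A\<in>\<A>. \<forall>j<n. \<phi> A (e' j) = c *\<^sub>C (\<Sum>i<n. H A i j *\<^sub>C e' i)"
    and H_cases: "H = (\<lambda>A i j. h (f i (cblinfun_apply A (es ! j)))) \<or> H = (\<lambda>A i j. h (f j (cblinfun_apply A (es ! i))))"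
    by (rule finite_dim_forms[OF two_dim d], rule that, assumption+)
  let ?T = "transition_mat n g e'" and ?S = "transition_mat n f' ((!) fs)"
  have form: "\<Phi> M = c \<cdot>\<^sub>m (?T * mat n n (\<lambda>(i, j). H (inv_into UNIV (matrix_of es) M) i j) * ?S)" for M
  proof -
    let ?A = "inv_into UNIV (matrix_of es) M"
    have "\<Phi> M = mat n n (\<lambda>(i, j). g i (\<phi> ?A (fs ! j)))"
      by (simp add: \<Phi> matrix_map_def mat_fs len_fs)
    also have "\<dots> = c \<cdot>\<^sub>m (?T * mat n n (\<lambda>(i, j). H ?A i j) * ?S)"
      by (rule change_of_basis[OF dg d']) (simp_all add: H range(3))
    finally show ?thesis .
  qed
  have entries: "f i (inv_into UNIV (matrix_of es) M (es ! j)) = M $$ (i, j)"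
    if "M \<in> carrier_mat n n" "i < n" "j < n" for M i j
  proof -
    have "matrix_of es (inv_into UNIV (matrix_of es) M) = M"
      using that bij_es by (intro f_inv_into_f) (auto simp: bij_betw_def)
    from arg_cong[OF this, of "\<lambda>M. M $$ (i, j)"] show ?thesis
      using that by (simp add: mat_es len_es)
  qed
  have "(\<forall>M\<in>carrier_mat n n. \<Phi> M = c \<cdot>\<^sub>m (?T * map_mat h M * ?S)) \<or>
      (\<forall>M\<in>carrier_mat n n. \<Phi> M = c \<cdot>\<^sub>m (?T * (map_mat h M)\<^sup>T * ?S))"
    using H_cases
  proof
    assume Heq: "H = (\<lambda>A i j. h (f i (cblinfun_apply A (es ! j))))"
    have "mat n n (\<lambda>(i, j). H (inv_into UNIV (matrix_of es) M) i j) = map_mat h M"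
      if "M \<in> carrier_mat n n" for M
      using that by (intro eq_matI) (auto simp: Heq entries)
    then show ?thesis by (simp add: form)
  next
    assume Heq: "H = (\<lambda>A i j. h (f j (cblinfun_apply A (es ! i))))"
    have "mat n n (\<lambda>(i, j). H (inv_into UNIV (matrix_of es) M) i j) = (map_mat h M)\<^sup>T"
      if "M \<in> carrier_mat n n" for M
      using that by (intro eq_matI) (auto simp: Heq entries)
    then show ?thesis by (simp add: form)
  qed
  moreover have "inverts_mat ?T ?S" "inverts_mat ?S ?T"
    by (rule transition_mat_inverts[OF dg d'], rule transition_mat_inverts[OF d' dg])
  moreover have "?T \<in> carrier_mat n n" "?S \<in> carrier_mat n n" by (simp_all add: transition_mat_def)
  ultimately show "\<exists>h T S c. ring_automorphism h \<and> T \<in> carrier_mat n n \<and> S \<in> carrier_mat n n \<and>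
      inverts_mat T S \<and> inverts_mat S T \<and> c \<in> {-1, 1} \<and>
      ((\<forall>M\<in>carrier_mat n n. \<Phi> M = c \<cdot>\<^sub>m (T * map_mat h M * S)) \<or>
       (\<forall>M\<in>carrier_mat n n. \<Phi> M = c \<cdot>\<^sub>m (T * (map_mat h M)\<^sup>T * S)))"
    using c h by blast
qed

lemma infinite_dim_forms:
  fixes \<A> :: "('a::cbanach \<Rightarrow>\<^sub>C\<^sub>L 'a) set" and \<B> :: "('b::cbanach \<Rightarrow>\<^sub>C\<^sub>L 'b) set"
  assumes J: "jordan_triple_iso \<A> \<B> \<phi>" and inf: "\<not> cfinite_dim (UNIV :: 'a set)"
    and two_dim: "\<And>x :: 'a. \<exists>y. \<forall>a. y \<noteq> a *\<^sub>C x"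
  shows "(\<exists>(T :: 'a \<Rightarrow> 'b) c. (invertible_bounded_clinear T \<or> invertible_bounded_antilinear T) \<and>
        c \<in> {-1, 1} \<and> (\<forall>A\<in>\<A>. \<forall>y. \<phi> A y = c *\<^sub>C T (A (inv_into UNIV T y)))) \<or>
      (\<exists>(T :: 'a cdual \<Rightarrow> 'b) c. (invertible_bounded_clinear T \<or> invertible_bounded_antilinear T) \<and>
        c \<in> {-1, 1} \<and> (\<forall>A\<in>\<A>. \<forall>y. \<phi> A y = c *\<^sub>C T (cadjoint A (inv_into UNIV T y))))"
proof -
  interpret jordan_triple_iso \<A> \<B> \<phi> by (rule J)
  show ?thesis
    using two_dim
  proof (cases rule: two_forms)
    case (direct c h T S)
    have "T (inv_into UNIV T y) = y" for y
      using direct(3) by (simp add: semilinear_bij_def bij_def surj_f_inv_f)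
    then have "\<phi> A y = c *\<^sub>C T (A (inv_into UNIV T y))" if "A \<in> \<A>" for A y
      using direct(6)[OF that, of "inv_into UNIV T y"] by simp
    then show ?thesis using direct_bounded[OF inf direct(2-5)] direct(1) by blast
  next
    case (transposed c h T S)
    have "T (inv_into UNIV T y) = y" for y
      using transposed(3) by (simp add: semilinear_bij_def bij_def surj_f_inv_f)
    then have "\<phi> A y = c *\<^sub>C T (cadjoint A (inv_into UNIV T y))" if "A \<in> \<A>" for A y
      using transposed(6)[OF that, of "inv_into UNIV T y"] by simp
    then show ?thesis using transposed_bounded[OF inf transposed(2-5)] transposed(1) by blast
  qed
qed

theorem mainTheorem1:
  fixes \<A> :: "('a::cbanach \<Rightarrow>\<^sub>C\<^sub>L 'a) set"
    and \<B> :: "('b::cbanach \<Rightarrow>\<^sub>C\<^sub>L 'b) set"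
    and \<phi> :: "('a \<Rightarrow>\<^sub>C\<^sub>L 'a) \<Rightarrow> ('b \<Rightarrow>\<^sub>C\<^sub>L 'b)"
  assumes dim_X: "cfinite_dim (UNIV :: 'a set) \<Longrightarrow> 3 \<le> cdim (UNIV :: 'a set)"
    and std_A: "standard_operator_algebra \<A>"
    and std_B: "standard_operator_algebra \<B>"
    and bij: "bij_betw \<phi> \<A> \<B>"
    and triple: "\<And>A B. A \<in> \<A> \<Longrightarrow> B \<in> \<A> \<Longrightarrow>
      \<phi> (A o\<^sub>C\<^sub>L B o\<^sub>C\<^sub>L A) = \<phi> A o\<^sub>C\<^sub>L \<phi> B o\<^sub>C\<^sub>L \<phi> A"
  shows "(\<not> cfinite_dim (UNIV :: 'a set) \<longrightarrow>
      (\<exists>(T :: 'a \<Rightarrow> 'b) c. invertible_bounded_clinear T \<and> c \<in> {-1, 1} \<and>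
        (\<forall>A\<in>\<A>. \<forall>y. \<phi> A y = c *\<^sub>C T (A (inv_into UNIV T y)))) \<or>
      (\<exists>(T :: 'a \<Rightarrow> 'b) c. invertible_bounded_antilinear T \<and> c \<in> {-1, 1} \<and>
        (\<forall>A\<in>\<A>. \<forall>y. \<phi> A y = c *\<^sub>C T (A (inv_into UNIV T y)))) \<or>
      (\<exists>(T :: 'a cdual \<Rightarrow> 'b) c. invertible_bounded_clinear T \<and> c \<in> {-1, 1} \<and>
        (\<forall>A\<in>\<A>. \<forall>y. \<phi> A y = c *\<^sub>C T (cadjoint A (inv_into UNIV T y)))) \<or>
      (\<exists>(T :: 'a cdual \<Rightarrow> 'b) c. invertible_bounded_antilinear T \<and> c \<in> {-1, 1} \<and>
        (\<forall>A\<in>\<A>. \<forall>y. \<phi> A y = c *\<^sub>C T (cadjoint A (inv_into UNIV T y)))))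
    \<and> (cfinite_dim (UNIV :: 'a set) \<longrightarrow>
      cfinite_dim (UNIV :: 'b set) \<and> cdim (UNIV :: 'a set) = cdim (UNIV :: 'b set) \<and>
      \<A> = UNIV \<and> \<B> = UNIV \<and>
      (\<forall>(es :: 'a list) (fs :: 'b list) n \<Phi>.
        is_cbasis es \<and> is_cbasis fs \<and> n = cdim (UNIV :: 'a set) \<and> \<Phi> = matrix_map es fs \<phi> \<longrightarrow>
        bij_betw \<Phi> (carrier_mat n n) (carrier_mat n n) \<and>
        ((\<exists>h T S c. ring_automorphism h \<and> T \<in> carrier_mat n n \<and> S \<in> carrier_mat n n \<and>
            inverts_mat T S \<and> inverts_mat S T \<and> c \<in> {-1, 1} \<and>
            (\<forall>M \<in> carrier_mat n n. \<Phi> M = c \<cdot>\<^sub>m (T * map_mat h M * S))) \<or>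
         (\<exists>h T S c. ring_automorphism h \<and> T \<in> carrier_mat n n \<and> S \<in> carrier_mat n n \<and>
            inverts_mat T S \<and> inverts_mat S T \<and> c \<in> {-1, 1} \<and>
            (\<forall>M \<in> carrier_mat n n. \<Phi> M = c \<cdot>\<^sub>m (T * (map_mat h M)\<^sup>T * S))))))"
proof -
  interpret jordan_triple_iso \<A> \<B> \<phi>
    by unfold_locales (fact std_A std_B bij triple)+
  have two_dim: "\<exists>y. \<forall>a. y \<noteq> a *\<^sub>C x" for x :: 'a
    using not_multiple_exists dim_X by blast
  show ?thesis
  proof (rule conjI; rule impI)
    assume "\<not> cfinite_dim (UNIV :: 'a set)"
    from infinite_dim_forms[OF jordan_triple_iso_axioms this two_dim] show
      "(\<exists>(T :: 'a \<Rightarrow> 'b) c. invertible_bounded_clinear T \<and> c \<in> {-1, 1} \<and>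
        (\<forall>A\<in>\<A>. \<forall>y. \<phi> A y = c *\<^sub>C T (A (inv_into UNIV T y)))) \<or>
      (\<exists>(T :: 'a \<Rightarrow> 'b) c. invertible_bounded_antilinear T \<and> c \<in> {-1, 1} \<and>
        (\<forall>A\<in>\<A>. \<forall>y. \<phi> A y = c *\<^sub>C T (A (inv_into UNIV T y)))) \<or>
      (\<exists>(T :: 'a cdual \<Rightarrow> 'b) c. invertible_bounded_clinear T \<and> c \<in> {-1, 1} \<and>
        (\<forall>A\<in>\<A>. \<forall>y. \<phi> A y = c *\<^sub>C T (cadjoint A (inv_into UNIV T y)))) \<or>
      (\<exists>(T :: 'a cdual \<Rightarrow> 'b) c. invertible_bounded_antilinear T \<and> c \<in> {-1, 1} \<and>
        (\<forall>A\<in>\<A>. \<forall>y. \<phi> A y = c *\<^sub>C T (cadjoint A (inv_into UNIV T y))))"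
      by blast
  next
    assume fin: "cfinite_dim (UNIV :: 'a set)"
    show "cfinite_dim (UNIV :: 'b set) \<and> cdim (UNIV :: 'a set) = cdim (UNIV :: 'b set) \<and>
      \<A> = UNIV \<and> \<B> = UNIV \<and>
      (\<forall>(es :: 'a list) (fs :: 'b list) n \<Phi>.
        is_cbasis es \<and> is_cbasis fs \<and> n = cdim (UNIV :: 'a set) \<and> \<Phi> = matrix_map es fs \<phi> \<longrightarrow>
        bij_betw \<Phi> (carrier_mat n n) (carrier_mat n n) \<and>
        ((\<exists>h T S c. ring_automorphism h \<and> T \<in> carrier_mat n n \<and> S \<in> carrier_mat n n \<and>
            inverts_mat T S \<and> inverts_mat S T \<and> c \<in> {-1, 1} \<and>
            (\<forall>M \<in> carrier_mat n n. \<Phi> M = c \<cdot>\<^sub>m (T * map_mat h M * S))) \<or>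
         (\<exists>h T S c. ring_automorphism h \<and> T \<in> carrier_mat n n \<and> S \<in> carrier_mat n n \<and>
            inverts_mat T S \<and> inverts_mat S T \<and> c \<in> {-1, 1} \<and>
            (\<forall>M \<in> carrier_mat n n. \<Phi> M = c \<cdot>\<^sub>m (T * (map_mat h M)\<^sup>T * S)))))"
    proof (intro conjI finite_dim_range two_dim fin allI impI)
      fix es :: "'a list" and fs :: "'b list" and n \<Phi>
      assume "is_cbasis es \<and> is_cbasis fs \<and> n = cdim (UNIV :: 'a set) \<and> \<Phi> = matrix_map es fs \<phi>"
      then have hyps: "is_cbasis es" "is_cbasis fs" "n = cdim (UNIV :: 'a set)" "\<Phi> = matrix_map es fs \<phi>"
        by blast+
      show "bij_betw \<Phi> (carrier_mat n n) (carrier_mat n n)"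
        by (rule matrix_forms(1)[OF two_dim hyps])
      show "(\<exists>h T S c. ring_automorphism h \<and> T \<in> carrier_mat n n \<and> S \<in> carrier_mat n n \<and>
            inverts_mat T S \<and> inverts_mat S T \<and> c \<in> {-1, 1} \<and>
            (\<forall>M \<in> carrier_mat n n. \<Phi> M = c \<cdot>\<^sub>m (T * map_mat h M * S))) \<or>
         (\<exists>h T S c. ring_automorphism h \<and> T \<in> carrier_mat n n \<and> S \<in> carrier_mat n n \<and>
            inverts_mat T S \<and> inverts_mat S T \<and> c \<in> {-1, 1} \<and>
            (\<forall>M \<in> carrier_mat n n. \<Phi> M = c \<cdot>\<^sub>m (T * (map_mat h M)\<^sup>T * S)))"
        using matrix_forms(2)[OF two_dim hyps] by blast
    qed
  qed
qed

end
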